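(* Let $X_1,\dots,X_n,Y$ be Banach spaces over the same field ($\mathbb R$ or $\mathbb C$) and $1\le p<\infty$. The following conditions are equivalent for a bounded multilinear mapping $T\in\mathcal L(X_1,\dots,X_n;Y)$: (i) $T$ is Lipschitz $p$-summing. (ii) There exists $C>0$ such that for all $k\in\mathbb N$ and all $a_1,\dots,a_k,b_1,\dots,b_k\in\Sigma_{X_1,\dots,X_n}$, $$\Delta_p\Big((1\otimes\hat T)\Big(\sum_{i=1}^ke_i\otimes(a_i-b_i)\Big)\Big)\le C\cdot\varepsilon\Big(\sum_{i=1}^ke_i\otimes(a_i-b_i)\Big),$$ where $(e_i)_i$ is the canonical basis of $\ell_p$ and $1\otimes\hat T:\ell_p\otimes(X_1\hat\otimes_\pi\cdots\hat\otimes_\pi X_n)\to\ell_p\otimes Y$. In this case $\pi_p^{Lip}(T)$ is the infimum of the constants $C$ satisfying (ii).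
   Context: $\mathcal L(X_1,\dots,X_n;Y)$ is the space of bounded $n$-linear operators, $\mathcal L(X_1,\dots,X_n)$ the space of bounded scalar $n$-linear forms with the supremum norm over the product of unit balls, $B_E$ the closed unit ball of $E$. $\hat T:X_1\hat\otimes_\pi\cdots\hat\otimes_\pi X_n\to Y$ is the bounded linear operator on the completed projective tensor product with $\hat T(x_1\otimes\cdots\otimes x_n)=T(x_1,\dots,x_n)$, and $\Sigma_{X_1,\dots,X_n}=\{x_1\otimes\cdots\otimes x_n:x_i\in X_i\}$. $T$ is Lipschitz $p$-summing if there is $c>0$ such that for all $k\in\mathbb N$ and all $u_1,\dots,u_k,v_1,\dots,v_k\in X_1\times\cdots\times X_n$, $$\Big(\sum_{i=1}^k\|T(u_i)-T(v_i)\|^p\Big)^{1/p}\le c\cdot\sup_{\varphi\in B_{\mathcal L(X_1,\dots,X_n)}}\Big(\sum_{i=1}^k|\varphi(u_i)-\varphi(v_i)|^p\Big)^{1/p};$$ $\pi_p^{Lip}(T)$ is the infimum of such $c$. $\varepsilon$ is the injective tensor norm on $\ell_p\otimes(X_1\hat\otimes_\pi\cdots\hat\otimes_\pi X_n)$, and $\Delta_p$ is the norm on $\ell_p\otimes Y$ induced by the natural embedding into the space $\ell_p[Y]$ of $p$-summable $Y$-valued sequences, so that $\Delta_p(\sum_ie_i\otimes y_i)=(\sum_i\|y_i\|^p)^{1/p}$. *)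

theory Defs
  imports "HOL-Analysis.Analysis" "HOL-Algebra.Module"
begin

text \<open>
  The spaces $X_1,\dots,X_n,Y$ may all be different, so normed spaces are carrier-based: they
  extend the module record of HOL-Algebra by a norm. (That record also has fields \<open>mult\<close> and
  \<open>one\<close>, which play no role in a module and are left \<open>undefined\<close>.) A common type
  for the elements of $X_1,\dots,X_n$ is no restriction, since finitely many sets always embed in
  their disjoint union.

  The scalars are a type of sort \<open>{real_normed_field, banach}\<close>. Here
  \<open>norm (a * b) = norm a * norm b\<close>, so by the Gelfand--Mazur theorem such a
  field is isometrically isomorphic to the real or to the complex numbers, which are both instances.

  All finite families are indexed from \<open>0\<close>: $X_1,\dots,X_n$ are \<open>X i\<close> for
  \<open>i < n\<close>.
\<close>

record ('k, 'v) normed_module = "('k, 'v) module" +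
  nrm :: "'v \<Rightarrow> real"

definition scalars :: "('k::real_normed_field, 'k) normed_module" where
  "scalars = \<lparr>carrier = UNIV, mult = (*), one = 1, zero = 0, add = (+), smult = (*), nrm = norm\<rparr>"

definition is_normed_space :: "('k::real_normed_field, 'v) normed_module \<Rightarrow> bool" where
  "is_normed_space V \<longleftrightarrow>
     Module.module (scalars :: ('k, 'k) normed_module) V \<and>
     (\<forall>x\<in>carrier V. 0 \<le> nrm V x \<and> (nrm V x = 0 \<longleftrightarrow> x = \<zero>\<^bsub>V\<^esub>)) \<and>
     (\<forall>a. \<forall>x\<in>carrier V. nrm V (a \<odot>\<^bsub>V\<^esub> x) = norm a * nrm V x) \<and>
     (\<forall>x\<in>carrier V. \<forall>y\<in>carrier V. nrm V (x \<oplus>\<^bsub>V\<^esub> y) \<le> nrm V x + nrm V y)"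

text \<open>The value off the carrier is fixed because the locale \<open>Metric_space\<close> requires
  nonnegativity and symmetry on the whole type.\<close>

definition ndist :: "('k, 'v) normed_module \<Rightarrow> 'v \<Rightarrow> 'v \<Rightarrow> real" where
  "ndist V x y = (if x \<in> carrier V \<and> y \<in> carrier V then nrm V (x \<ominus>\<^bsub>V\<^esub> y) else 0)"

definition is_banach_space :: "('k::real_normed_field, 'v) normed_module \<Rightarrow> bool" where
  "is_banach_space V \<longleftrightarrow> is_normed_space V \<and> Metric_space.mcomplete (carrier V) (ndist V)"

definition linear_map ::
    "('k, 'v, 'm) module_scheme \<Rightarrow> ('k, 'w, 'l) module_scheme \<Rightarrow> ('v \<Rightarrow> 'w) \<Rightarrow> bool" where
  "linear_map V W f \<longleftrightarrow>
     f \<in> carrier V \<rightarrow> carrier W \<and>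
     (\<forall>x\<in>carrier V. \<forall>y\<in>carrier V. f (x \<oplus>\<^bsub>V\<^esub> y) = f x \<oplus>\<^bsub>W\<^esub> f y) \<and>
     (\<forall>a. \<forall>x\<in>carrier V. f (a \<odot>\<^bsub>V\<^esub> x) = a \<odot>\<^bsub>W\<^esub> f x)"

definition bounded_linear_map ::
    "('k, 'v) normed_module \<Rightarrow> ('k, 'w) normed_module \<Rightarrow> ('v \<Rightarrow> 'w) \<Rightarrow> bool" where
  "bounded_linear_map V W f \<longleftrightarrow>
     linear_map V W f \<and> (\<exists>M. \<forall>x\<in>carrier V. nrm W (f x) \<le> M * nrm V x)"

definition dual_norm :: "('k::real_normed_field, 'v) normed_module \<Rightarrow> ('v \<Rightarrow> 'k) \<Rightarrow> real" where
  "dual_norm V \<phi> = Sup {norm (\<phi> x) | x. x \<in> carrier V \<and> nrm V x \<le> 1}"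

definition dual_ball :: "('k::real_normed_field, 'v) normed_module \<Rightarrow> ('v \<Rightarrow> 'k) set" where
  "dual_ball V = {\<phi>. bounded_linear_map V scalars \<phi> \<and> dual_norm V \<phi> \<le> 1}"

definition tuples :: "nat \<Rightarrow> (nat \<Rightarrow> ('k, 'x, 'm) module_scheme) \<Rightarrow> (nat \<Rightarrow> 'x) set" where
  "tuples n X = (\<Pi>\<^sub>E i\<in>{..<n}. carrier (X i))"

definition multilinear_map ::
    "nat \<Rightarrow> (nat \<Rightarrow> ('k, 'x, 'm) module_scheme) \<Rightarrow> ('k, 'y, 'l) module_scheme \<Rightarrow>
     ((nat \<Rightarrow> 'x) \<Rightarrow> 'y) \<Rightarrow> bool" where
  "multilinear_map n X Y T \<longleftrightarrow>
     T \<in> tuples n X \<rightarrow> carrier Y \<and>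
     (\<forall>x\<in>tuples n X. \<forall>i<n. \<forall>y\<in>carrier (X i). \<forall>z\<in>carrier (X i).
        T (x(i := y \<oplus>\<^bsub>X i\<^esub> z)) = T (x(i := y)) \<oplus>\<^bsub>Y\<^esub> T (x(i := z))) \<and>
     (\<forall>x\<in>tuples n X. \<forall>i<n. \<forall>a. \<forall>y\<in>carrier (X i).
        T (x(i := a \<odot>\<^bsub>X i\<^esub> y)) = a \<odot>\<^bsub>Y\<^esub> T (x(i := y)))"

definition bounded_multilinear_map ::
    "nat \<Rightarrow> (nat \<Rightarrow> ('k, 'x) normed_module) \<Rightarrow> ('k, 'y) normed_module \<Rightarrow>
     ((nat \<Rightarrow> 'x) \<Rightarrow> 'y) \<Rightarrow> bool" where
  "bounded_multilinear_map n X Y T \<longleftrightarrow>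
     multilinear_map n X Y T \<and>
     (\<exists>M. \<forall>x\<in>tuples n X. nrm Y (T x) \<le> M * (\<Prod>i<n. nrm (X i) (x i)))"

definition form_norm ::
    "nat \<Rightarrow> (nat \<Rightarrow> ('k::real_normed_field, 'x) normed_module) \<Rightarrow> ((nat \<Rightarrow> 'x) \<Rightarrow> 'k) \<Rightarrow> real" where
  "form_norm n X \<phi> = Sup {norm (\<phi> x) | x. x \<in> tuples n X \<and> (\<forall>i<n. nrm (X i) (x i) \<le> 1)}"

definition form_ball ::
    "nat \<Rightarrow> (nat \<Rightarrow> ('k::real_normed_field, 'x) normed_module) \<Rightarrow> ((nat \<Rightarrow> 'x) \<Rightarrow> 'k) set" where
  "form_ball n X = {\<phi>. bounded_multilinear_map n X scalars \<phi> \<and> form_norm n X \<phi> \<le> 1}"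

definition lipschitz_summing_const ::
    "real \<Rightarrow> nat \<Rightarrow> (nat \<Rightarrow> ('k::real_normed_field, 'x) normed_module) \<Rightarrow>
     ('k, 'y) normed_module \<Rightarrow> ((nat \<Rightarrow> 'x) \<Rightarrow> 'y) \<Rightarrow> real \<Rightarrow> bool" where
  "lipschitz_summing_const p n X Y T c \<longleftrightarrow>
     (\<forall>(k::nat) u v. (\<forall>i<k. u i \<in> tuples n X \<and> v i \<in> tuples n X) \<longrightarrow>
        (\<Sum>i<k. nrm Y (T (u i) \<ominus>\<^bsub>Y\<^esub> T (v i)) powr p) powr (1 / p)
        \<le> c * (SUP \<phi>\<in>form_ball n X. (\<Sum>i<k. norm (\<phi> (u i) - \<phi> (v i)) powr p) powr (1 / p)))"

definition lipschitz_summing ::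
    "real \<Rightarrow> nat \<Rightarrow> (nat \<Rightarrow> ('k::real_normed_field, 'x) normed_module) \<Rightarrow>
     ('k, 'y) normed_module \<Rightarrow> ((nat \<Rightarrow> 'x) \<Rightarrow> 'y) \<Rightarrow> bool" where
  "lipschitz_summing p n X Y T \<longleftrightarrow> (\<exists>c>0. lipschitz_summing_const p n X Y T c)"

definition lipschitz_summing_norm ::
    "real \<Rightarrow> nat \<Rightarrow> (nat \<Rightarrow> ('k::real_normed_field, 'x) normed_module) \<Rightarrow>
     ('k, 'y) normed_module \<Rightarrow> ((nat \<Rightarrow> 'x) \<Rightarrow> 'y) \<Rightarrow> real" where
  "lipschitz_summing_norm p n X Y T = Inf {c. 0 < c \<and> lipschitz_summing_const p n X Y T c}"

text \<open>
  As in Ryan's ``Introduction to Tensor Products of Banach Spaces'', a tensor product is the span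
  of the elementary tensors $x_1\otimes\dots\otimes x_n\colon B\mapsto B(x_1,\dots,x_n)$ in the
  algebraic dual of the space of all (not necessarily bounded) multilinear forms \<open>B\<close>. In the
  generic construction, \<open>F\<close> is the set of these forms and \<open>D\<close> the set of
  tuples.
\<close>

definition evaluation :: "('t \<Rightarrow> 'k) set \<Rightarrow> 't \<Rightarrow> ('t \<Rightarrow> 'k::zero) \<Rightarrow> 'k" where
  "evaluation F t = (\<lambda>B. if B \<in> F then B t else 0)"

definition evaluation_span ::
    "('t \<Rightarrow> 'k) set \<Rightarrow> 't set \<Rightarrow> ('k::field, ('t \<Rightarrow> 'k) \<Rightarrow> 'k) module" where
  "evaluation_span F D =
     \<lparr>carrier = {(\<lambda>B. \<Sum>j<m. c j * evaluation F (t j) B) | (m::nat) c t. \<forall>j<m. t j \<in> D},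
      mult = undefined, one = undefined,
      zero = (\<lambda>_. 0), add = (\<lambda>u v B. u B + v B), smult = (\<lambda>a u B. a * u B)\<rparr>"

type_synonym ('k, 'x) tensors = "((nat \<Rightarrow> 'x) \<Rightarrow> 'k) \<Rightarrow> 'k"

definition elem_tensor ::
    "nat \<Rightarrow> (nat \<Rightarrow> ('k::real_normed_field, 'x) normed_module) \<Rightarrow> (nat \<Rightarrow> 'x) \<Rightarrow> ('k, 'x) tensors" where
  "elem_tensor n X x = evaluation {B. multilinear_map n X scalars B} x"

definition multi_tensor_space ::
    "nat \<Rightarrow> (nat \<Rightarrow> ('k::real_normed_field, 'x) normed_module) \<Rightarrow> ('k, ('k, 'x) tensors) module" where
  "multi_tensor_space n X = evaluation_span {B. multilinear_map n X scalars B} (tuples n X)"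

definition bilinear_forms ::
    "('k::real_normed_field, 'a, 'm) module_scheme \<Rightarrow> ('k, 'b, 'l) module_scheme \<Rightarrow>
     ('a \<times> 'b \<Rightarrow> 'k) set" where
  "bilinear_forms E F =
     {B. (\<forall>y\<in>carrier F. linear_map E scalars (\<lambda>x. B (x, y))) \<and>
         (\<forall>x\<in>carrier E. linear_map F scalars (\<lambda>y. B (x, y)))}"

type_synonym ('k, 'a, 'b) tensors2 = "('a \<times> 'b \<Rightarrow> 'k) \<Rightarrow> 'k"

definition tensor ::
    "('k::real_normed_field, 'a, 'm) module_scheme \<Rightarrow> ('k, 'b, 'l) module_scheme \<Rightarrow>
     'a \<Rightarrow> 'b \<Rightarrow> ('k, 'a, 'b) tensors2" where
  "tensor E F x y = evaluation (bilinear_forms E F) (x, y)"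

definition tensor_space ::
    "('k::real_normed_field, 'a, 'm) module_scheme \<Rightarrow> ('k, 'b, 'l) module_scheme \<Rightarrow>
     ('k, ('k, 'a, 'b) tensors2) module" where
  "tensor_space E F = evaluation_span (bilinear_forms E F) (carrier E \<times> carrier F)"

text \<open>The linear map on \<open>tensor_space E F\<close> induced by the bilinear map \<open>b\<close>; it is taken
  extensional to make it unique as a function.\<close>

definition tensor_lift ::
    "('k::real_normed_field, 'a, 'm) module_scheme \<Rightarrow> ('k, 'b, 'l) module_scheme \<Rightarrow>
     ('k, 'w, 'q) module_scheme \<Rightarrow> ('a \<Rightarrow> 'b \<Rightarrow> 'w) \<Rightarrow> ('k, 'a, 'b) tensors2 \<Rightarrow> 'w" where
  "tensor_lift E F W b =
     (THE L. linear_map (tensor_space E F) W L \<and> L \<in> extensional (carrier (tensor_space E F)) \<and>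
        (\<forall>x\<in>carrier E. \<forall>y\<in>carrier F. L (tensor E F x y) = b x y))"

definition tensor_map ::
    "('k::real_normed_field, 'a, 'm) module_scheme \<Rightarrow> ('k, 'b, 'l) module_scheme \<Rightarrow>
     ('k, 'c, 'q) module_scheme \<Rightarrow> ('k, 'd, 'r) module_scheme \<Rightarrow>
     ('a \<Rightarrow> 'c) \<Rightarrow> ('b \<Rightarrow> 'd) \<Rightarrow> ('k, 'a, 'b) tensors2 \<Rightarrow> ('k, 'c, 'd) tensors2" where
  "tensor_map E F E' F' R S = tensor_lift E F (tensor_space E' F') (\<lambda>x y. tensor E' F' (R x) (S y))"

text \<open>Cauchy sequences that differ by a null sequence are identified.\<close>

definition cauchy_rel :: "('k, 'v) normed_module \<Rightarrow> ((nat \<Rightarrow> 'v) \<times> (nat \<Rightarrow> 'v)) set" where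
  "cauchy_rel V =
     {(s, t). Metric_space.MCauchy (carrier V) (ndist V) s \<and>
              Metric_space.MCauchy (carrier V) (ndist V) t \<and>
              (\<lambda>m. ndist V (s m) (t m)) \<longlonglongrightarrow> 0}"

definition completion :: "('k, 'v) normed_module \<Rightarrow> ('k, (nat \<Rightarrow> 'v) set) normed_module" where
  "completion V =
     \<lparr>carrier = {s. Metric_space.MCauchy (carrier V) (ndist V) s} // cauchy_rel V,
      mult = undefined, one = undefined,
      zero = cauchy_rel V `` {\<lambda>_. \<zero>\<^bsub>V\<^esub>},
      add = (\<lambda>C D. \<Union>s\<in>C. \<Union>t\<in>D. cauchy_rel V `` {\<lambda>m. s m \<oplus>\<^bsub>V\<^esub> t m}),
      smult = (\<lambda>a C. \<Union>s\<in>C. cauchy_rel V `` {\<lambda>m. a \<odot>\<^bsub>V\<^esub> s m}),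
      nrm = (\<lambda>C. THE l. \<forall>s\<in>C. (\<lambda>m. nrm V (s m)) \<longlonglongrightarrow> l)\<rparr>"

definition to_completion :: "('k, 'v) normed_module \<Rightarrow> 'v \<Rightarrow> (nat \<Rightarrow> 'v) set" where
  "to_completion V v = cauchy_rel V `` {\<lambda>_. v}"

definition projective_norm ::
    "nat \<Rightarrow> (nat \<Rightarrow> ('k::real_normed_field, 'x) normed_module) \<Rightarrow> ('k, 'x) tensors \<Rightarrow> real" where
  "projective_norm n X w =
     Inf {(\<Sum>j<m. \<Prod>i<n. nrm (X i) (x j i)) | (m::nat) x.
            (\<forall>j<m. x j \<in> tuples n X) \<and> w = (\<lambda>B. \<Sum>j<m. elem_tensor n X (x j) B)}"

definition projective_tensor_algebraic ::
    "nat \<Rightarrow> (nat \<Rightarrow> ('k::real_normed_field, 'x) normed_module) \<Rightarrow>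
     ('k, ('k, 'x) tensors) normed_module" where
  "projective_tensor_algebraic n X =
     module.extend (multi_tensor_space n X) (normed_module.fields (projective_norm n X))"

definition projective_tensor ::
    "nat \<Rightarrow> (nat \<Rightarrow> ('k::real_normed_field, 'x) normed_module) \<Rightarrow>
     ('k, (nat \<Rightarrow> ('k, 'x) tensors) set) normed_module" where
  "projective_tensor n X = completion (projective_tensor_algebraic n X)"

definition proj_elem_tensor ::
    "nat \<Rightarrow> (nat \<Rightarrow> ('k::real_normed_field, 'x) normed_module) \<Rightarrow>
     (nat \<Rightarrow> 'x) \<Rightarrow> (nat \<Rightarrow> ('k, 'x) tensors) set" where
  "proj_elem_tensor n X x = to_completion (projective_tensor_algebraic n X) (elem_tensor n X x)"

definition segre ::
    "nat \<Rightarrow> (nat \<Rightarrow> ('k::real_normed_field, 'x) normed_module) \<Rightarrow>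
     (nat \<Rightarrow> ('k, 'x) tensors) set set" where
  "segre n X = {proj_elem_tensor n X x | x. x \<in> tuples n X}"

definition linearization ::
    "nat \<Rightarrow> (nat \<Rightarrow> ('k::real_normed_field, 'x) normed_module) \<Rightarrow> ('k, 'y) normed_module \<Rightarrow>
     ((nat \<Rightarrow> 'x) \<Rightarrow> 'y) \<Rightarrow> (nat \<Rightarrow> ('k, 'x) tensors) set \<Rightarrow> 'y" where
  "linearization n X Y T =
     (THE S. bounded_linear_map (projective_tensor n X) Y S \<and>
        S \<in> extensional (carrier (projective_tensor n X)) \<and>
        (\<forall>x\<in>tuples n X. S (proj_elem_tensor n X x) = T x))"

text \<open>\<open>lp_space p Y\<close> is $\ell_p[Y]$; the scalar space $\ell_p$ is
  \<open>lp_space p scalars\<close>.\<close>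

definition lp_space :: "real \<Rightarrow> ('k, 'y) normed_module \<Rightarrow> ('k, nat \<Rightarrow> 'y) normed_module" where
  "lp_space p Y =
     \<lparr>carrier = {s. (\<forall>i. s i \<in> carrier Y) \<and> summable (\<lambda>i. nrm Y (s i) powr p)},
      mult = undefined, one = undefined,
      zero = (\<lambda>_. \<zero>\<^bsub>Y\<^esub>), add = (\<lambda>s t i. s i \<oplus>\<^bsub>Y\<^esub> t i), smult = (\<lambda>a s i. a \<odot>\<^bsub>Y\<^esub> s i),
      nrm = (\<lambda>s. (\<Sum>i. nrm Y (s i) powr p) powr (1 / p))\<rparr>"

definition unit_seq :: "nat \<Rightarrow> nat \<Rightarrow> 'k::zero_neq_one" where
  "unit_seq i = (\<lambda>j. if j = i then 1 else 0)"

definition delta_norm ::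
    "real \<Rightarrow> ('k::real_normed_field, 'y) normed_module \<Rightarrow> ('k, nat \<Rightarrow> 'k, 'y) tensors2 \<Rightarrow> real" where
  "delta_norm p Y w =
     nrm (lp_space p Y)
       (tensor_lift (lp_space p scalars) Y (lp_space p Y) (\<lambda>s y i. s i \<odot>\<^bsub>Y\<^esub> y) w)"

text \<open>If $w=\sum_j x_j\otimes y_j$, then \<open>w\<close> applied to the bilinear form
  $(x,y)\mapsto\psi(x)\varphi(y)$ is $\sum_j\psi(x_j)\varphi(y_j)$.\<close>

definition injective_norm ::
    "('k::real_normed_field, 'a) normed_module \<Rightarrow> ('k, 'b) normed_module \<Rightarrow>
     ('k, 'a, 'b) tensors2 \<Rightarrow> real" where
  "injective_norm E F w =
     Sup {norm (w (\<lambda>(x, y). \<psi> x * \<phi> y)) | \<psi> \<phi>. \<psi> \<in> dual_ball E \<and> \<phi> \<in> dual_ball F}"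

definition tensor_summing_const ::
    "real \<Rightarrow> nat \<Rightarrow> (nat \<Rightarrow> ('k::real_normed_field, 'x) normed_module) \<Rightarrow>
     ('k, 'y) normed_module \<Rightarrow> ((nat \<Rightarrow> 'x) \<Rightarrow> 'y) \<Rightarrow> real \<Rightarrow> bool" where
  "tensor_summing_const p n X Y T C \<longleftrightarrow>
     (let L = lp_space p (scalars :: ('k, 'k) normed_module); P = projective_tensor n X in
      \<forall>(k::nat) a b. (\<forall>i<k. a i \<in> segre n X \<and> b i \<in> segre n X) \<longrightarrow>
        (let z = (\<Oplus>\<^bsub>tensor_space L P\<^esub> i\<in>{..<k}. tensor L P (unit_seq i) (a i \<ominus>\<^bsub>P\<^esub> b i)) in
         delta_norm p Y (tensor_map L P L Y (\<lambda>s. s) (linearization n X Y T) z)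
         \<le> C * injective_norm L P z))"

end

theory Submission
  imports Defs "HOL-Computational_Algebra.Fundamental_Theorem_Algebra"
begin

text \<open>
  For every single constant \<open>c\<close>, condition (i) holds with \<open>c\<close> if and only if condition (ii) does,
  because the two inequalities have the same left-hand sides and the same right-hand sides. Let
  $a_i$ and $b_i$ be the elementary tensors of $u_i$ and $v_i$, and let
  $z=\sum_i e_i\otimes(a_i-b_i)$.

  \<^item> On the left (\<open>delta_side\<close>), $(1\otimes\hat T)z=\sum_i e_i\otimes(T(u_i)-T(v_i))$. Its image in
    $\ell_p[Y]$ is the finite sequence of the vectors $T(u_i)-T(v_i)$.

  \<^item> On the right (\<open>injective_side\<close>), $\varepsilon(z)$ is the supremum of
    $|\sum_i\psi(e_i)\varphi(a_i-b_i)|$ over the unit balls of $\ell_p'$ and of the dual of the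
    projective tensor product. By linearization, the latter ball consists of the linearizations of
    the forms \<open>g\<close> in the unit ball of ${\cal L}(X_1,\dots,X_n)$ (\<open>form_of_dual\<close>,
    \<open>dual_of_form\<close>), so that $\varphi(a_i-b_i)=g(u_i)-g(v_i)$. For fixed \<open>g\<close> the supremum over
    $\psi$ is the $\ell_p$-norm of these numbers, by the duality of $\ell_p$ and $\ell_{p'}$ for
    finite sequences (\<open>lp_dual_le\<close>, \<open>lp_dual_norming\<close>).

  It remains to see that the objects in these formulas have their usual properties. A linear map on
  a tensor product is determined by its values on elementary tensors, and it exists as soon as the
  target has a separating family of linear functionals (\<open>evaluation_span_lift\<close>). The linearization
  extends by density to the completion (\<open>completion_extend\<close>, \<open>linearization_spec\<close>). For the
  completion to be a completion of a metric space, the projective norm has to be definite, that is,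
  the bounded multilinear forms have to separate the tensors. This comes from the Hahn-Banach
  theorem: a tensor involves only finitely many vectors, which are fixed by operators of finite
  rank, and composing an arbitrary multilinear form with such operators makes it bounded
  (\<open>bounded_forms_separate\<close>).

  The Hahn-Banach theorem over the abstract scalar field is obtained from the real one, and this
  is where the field has to be identified: since its norm is multiplicative, it is either the field
  of real numbers or that of complex numbers (\<open>reals_or_complex\<close>).
\<close>

section \<open>Fields with a multiplicative norm\<close>

definition rpoly_at :: "'k::real_normed_field \<Rightarrow> real poly \<Rightarrow> 'k" where
  "rpoly_at a q = poly (map_poly of_real q) a"

lemma rpoly_at_simps [simp]:
  "rpoly_at a 0 = 0" "rpoly_at a (pCons c q) = of_real c + a * rpoly_at a q" "rpoly_at a 1 = 1"
  by (simp_all add: rpoly_at_def map_poly_pCons)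

lemma rpoly_at_add: "rpoly_at a (p + q) = rpoly_at a p + rpoly_at a q"
  by (induction p q rule: poly_induct2) (simp_all add: algebra_simps)

lemma rpoly_at_smult: "rpoly_at a (Polynomial.smult c q) = of_real c * rpoly_at a q"
  by (induction q) (simp_all add: algebra_simps)

lemma rpoly_at_mult: "rpoly_at a (p * q) = rpoly_at a p * rpoly_at a q"
  by (induction p) (simp_all add: rpoly_at_add rpoly_at_smult algebra_simps)

lemma rpoly_at_minus: "rpoly_at a (p - q) = rpoly_at a p - rpoly_at a q"
  using rpoly_at_add[of a "p - q" q] by (simp add: algebra_simps)

lemma rpoly_at_power: "rpoly_at a (p ^ n) = rpoly_at a p ^ n"
  by (induction n) (simp_all add: rpoly_at_mult)

text \<open>
  The monic real polynomial with the roots \<open>w\<close> and \<open>cnj w\<close>.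
\<close>

definition conj_quadratic :: "complex \<Rightarrow> real poly" where
  "conj_quadratic w = [:(cmod w)\<^sup>2, - 2 * Re w, 1:]"

lemma poly_conj_quadratic: "poly (conj_quadratic w) x = (cmod (of_real x - w))\<^sup>2"
  unfolding cmod_power2 conj_quadratic_def by (simp add: power2_eq_square algebra_simps)

text \<open>
  A bound for the quadratics with conjugate roots propagates to all monic polynomials: over the
  complex numbers \<open>p\<close> splits into linear factors, so the real polynomial \<open>p * cnj p\<close>, called \<open>q\<close>
  here, is a product of such quadratics, and the norm of the field is multiplicative. The
  polynomial \<open>q\<close> is described by its values on the real line.
\<close>

lemma norm_rpoly_at_lower:
  fixes a :: "'k::real_normed_field" and p :: "complex poly"
  assumes m: "0 \<le> m" "\<And>w. m \<le> norm (rpoly_at a (conj_quadratic w))"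
    and "lead_coeff p = 1"
  shows "\<exists>q. (\<forall>x::real. poly q x = (cmod (poly p (of_real x)))\<^sup>2) \<and> m ^ degree p \<le> norm (rpoly_at a q)"
  using assms(3)
proof (induction "degree p" arbitrary: p)
  case 0
  then have "p = 1"
    by (metis coeff_pCons_0 degree_eq_zeroE degree_pCons_0 one_pCons)
  then show ?case by (intro exI[of _ 1]) simp
next
  case (Suc d)
  have "\<not> constant (poly p)"
    using Suc.hyps(2) by (simp add: constant_degree)
  then obtain w where "poly p w = 0" using fundamental_theorem_of_algebra by blast
  then obtain p' where p: "p = [:-w, 1:] * p'" by (auto simp: poly_eq_0_iff_dvd dvd_def)
  have "p' \<noteq> 0" using p Suc.prems by auto
  then have deg: "degree p = Suc (degree p')" unfolding p by (subst degree_mult_eq) auto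
  have "lead_coeff p' = 1" using Suc.prems unfolding p lead_coeff_mult by simp
  then obtain q where q: "\<And>x::real. poly q x = (cmod (poly p' (of_real x)))\<^sup>2"
    "m ^ degree p' \<le> norm (rpoly_at a q)"
    using Suc.hyps(1)[of p'] Suc.hyps(2) deg by auto
  show ?case
  proof (intro exI conjI allI)
    fix x :: real
    show "poly (conj_quadratic w * q) x = (cmod (poly p (of_real x)))\<^sup>2"
      unfolding p poly_mult norm_mult power_mult_distrib poly_conj_quadratic q by simp
    show "m ^ degree p \<le> norm (rpoly_at a (conj_quadratic w * q))"
      using mult_mono[OF m(2) q(2)] m(1) order_trans[OF m(1) m(2)]
      by (simp add: deg rpoly_at_mult norm_mult)
  qed
qed

text \<open>
  For a real polynomial \<open>g\<close>, the product \<open>g * cnj g\<close> of the previous lemma is the square of \<open>g\<close>.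
\<close>

lemma norm_rpoly_at_lower_real:
  fixes a :: "'k::real_normed_field" and g :: "real poly"
  assumes m: "0 \<le> m" "\<And>w. m \<le> norm (rpoly_at a (conj_quadratic w))"
    and g: "lead_coeff g = 1" "degree g = 2 * N"
  shows "m ^ N * m ^ N \<le> norm (rpoly_at a g) ^ 2"
proof -
  define p :: "complex poly" where "p = map_poly of_real g"
  have 1: "degree p = 2 * N" using g(2) by (simp add: p_def degree_map_poly)
  have "lead_coeff p = 1" unfolding 1 using g by (simp add: p_def coeff_map_poly)
  then obtain q where q: "\<And>x::real. poly q x = (cmod (poly p (of_real x)))\<^sup>2"
    "m ^ degree p \<le> norm (rpoly_at a q)"
    using norm_rpoly_at_lower[OF m, of p] by auto
  have pg: "poly p (of_real x) = of_real (poly g x)" for x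
    unfolding p_def by (induction g) (simp_all add: map_poly_pCons)
  have "poly q = poly (g * g)"
    by (rule ext) (simp add: q pg power2_eq_square flip: abs_mult)
  then have "q = g * g" using poly_eq_poly_eq_iff by blast
  then show ?thesis using q(2) 1 by (simp add: rpoly_at_mult norm_mult power2_eq_square power_add mult_2)
qed

text \<open>
  The idea is Ostrowski's. The norm of the value at \<open>a\<close> of the quadratic with the roots \<open>w\<close> and
  \<open>cnj w\<close> has a minimum \<open>m\<close>. Suppose that \<open>m > 0\<close> and let \<open>h\<close> be a minimal quadratic, with
  value \<open>y\<close> at \<open>a\<close>. For \<open>0 < e < m\<close> the polynomial \<open>h ^ (N + 1) - (-e) ^ (N + 1)\<close> has the factor \<open>h + e\<close>,
  and its cofactor takes at \<open>a\<close> a value of norm at least \<open>m ^ N\<close>. Hence the norm of \<open>y + e\<close> is at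
  most \<open>m + e * (e / m) ^ N\<close>. As \<open>N\<close> grows, this shows that \<open>h + e\<close> is minimal again. Repeating
  the step adds arbitrarily large constants to \<open>y\<close> while the norm remains equal to \<open>m\<close>, which is
  impossible.
\<close>

lemma quadratic_over_reals:
  fixes a :: "'k::real_normed_field"
  shows "\<exists>w. rpoly_at a (conj_quadratic w) = 0"
proof -
  define f where "f w = norm (rpoly_at a (conj_quadratic w))" for w
  have f_eq: "f w = norm (of_real ((cmod w)\<^sup>2) + (a * a - of_real (2 * Re w) * a))" for w
    unfolding f_def conj_quadratic_def by (simp add: algebra_simps)
  define A where "A = norm a"
  have A0: "0 \<le> A" by (simp add: A_def)
  \<comment> \<open>Far away from the origin the constant term dominates, so the minimum over a large disc is
      global.\<close>
  have big: "f 0 < f w" if "cmod w > 3 * A + 1" for w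
  proof -
    have "norm (a * a - of_real (2 * Re w) * a) \<le> A * A + 2 * \<bar>Re w\<bar> * A"
      by (rule order_trans[OF norm_triangle_ineq4]) (simp add: norm_mult A_def)
    also have "\<dots> \<le> A * A + 2 * cmod w * A"
      using abs_Re_le_cmod[of w] A0 by (intro add_left_mono mult_right_mono) auto
    moreover have "norm (of_real ((cmod w)\<^sup>2) :: 'k) = (cmod w)\<^sup>2" by (simp only: norm_of_real) simp
    ultimately have "f w \<ge> (cmod w)\<^sup>2 - (A * A + 2 * cmod w * A)"
      unfolding f_eq using norm_diff_ineq[of "of_real ((cmod w)\<^sup>2) :: 'k" "a * a - of_real (2 * Re w) * a"]
      by linarith
    moreover have "cmod w * (cmod w - 2 * A) \<ge> (3 * A + 1) * (A + 1)"
      using that A0 by (intro mult_mono) auto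
    moreover have "f 0 = A * A" by (simp add: f_eq A_def norm_mult)
    moreover have "0 \<le> A * A" by simp
    ultimately show ?thesis using A0 unfolding power2_eq_square right_diff_distrib distrib_left distrib_right
      by (simp only: mult_1 mult_1_right mult_ac)
  qed
  have "continuous_on (cball 0 (3 * A + 1)) f" unfolding f_eq by (intro continuous_intros)
  then obtain z where z: "\<And>w. w \<in> cball 0 (3 * A + 1) \<Longrightarrow> f z \<le> f w"
    using continuous_attains_inf[of "cball (0::complex) (3 * A + 1)" f] A0 by fastforce
  have "f z \<le> f w" for w
    using z[of w] big[of w] z[of 0] A0 by (cases "cmod w \<le> 3 * A + 1") auto
  moreover define m where "m = f z"
  ultimately have m: "m \<le> f w" for w by auto
  have m0: "0 \<le> m" by (simp add: m_def f_def)
  have "m = 0"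
  proof (rule ccontr)
    assume "m \<noteq> 0"
    then have mp: "0 < m" using m0 by simp
    have step: "norm (rpoly_at a (conj_quadratic w) + of_real e) = m"
      if w: "norm (rpoly_at a (conj_quadratic w)) = m" and e: "0 < e" "e < m" for w e
    proof (rule antisym)
      define h where "h = conj_quadratic w"
      \<comment> \<open>Adding a positive constant to a quadratic with the roots \<open>w\<close> and \<open>cnj w\<close> only increases the
          imaginary part of the roots.\<close>
      define w' where "w' = Complex (Re w) (sqrt ((Im w)\<^sup>2 + e))"
      have w': "conj_quadratic w' = h + [:e:]"
        using e by (simp add: h_def conj_quadratic_def w'_def cmod_power2 algebra_simps)
      then have rpoly_at': "rpoly_at a (conj_quadratic w') = rpoly_at a h + of_real e" by (simp add: rpoly_at_add)
      show "m \<le> norm (rpoly_at a (conj_quadratic w) + of_real e)"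
        using m[of w'] by (simp add: f_def rpoly_at' h_def)
      have bound: "norm (rpoly_at a h + of_real e) \<le> m + e * (e / m) ^ N" for N
      proof -
        have "h - [:-e:] dvd h ^ Suc N - [:-e:] ^ Suc N"
          by (metis dvd_triv_left power_diff_sumr2)
        then obtain g where g: "h ^ Suc N - [:-e:] ^ Suc N = (h - [:-e:]) * g" by (auto simp: dvd_def)
        have dh: "degree h = 2" "lead_coeff h = 1" "h \<noteq> 0" by (simp_all add: h_def conj_quadratic_def)
        have dw: "degree (h - [:-e:]) = 2" "lead_coeff (h - [:-e:]) = 1"
          by (simp_all add: h_def conj_quadratic_def)
        have dc: "degree ([:-e:] ^ Suc N) = 0" by (simp add: poly_const_pow)
        have dH: "degree (h ^ Suc N) = 2 * Suc N" using degree_power_eq[OF dh(3), of "Suc N"] unfolding dh(1) by (simp only: mult.commute)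
        have "degree (h ^ Suc N - [:-e:] ^ Suc N) = 2 * Suc N"
          using dH dc degree_add_eq_left[of "- ([:-e:] ^ Suc N)" "h ^ Suc N"] by simp
        moreover have "lead_coeff (h ^ Suc N - [:-e:] ^ Suc N) = 1"
          using dH dc dh lead_coeff_add_le[of "- ([:-e:] ^ Suc N)" "h ^ Suc N"] lead_coeff_power[of h "Suc N"]
          by (metis add.commute coeff_diff coeff_eq_0 calculation diff_zero power_one zero_less_Suc nat_0_less_mult_iff zero_less_numeral)
        ultimately have *: "degree ((h - [:-e:]) * g) = 2 * Suc N" "lead_coeff ((h - [:-e:]) * g) = 1"
          unfolding g by (simp_all only:)
        have "g \<noteq> 0" using * by auto
        have lg: "lead_coeff g = 1" using *(2) dw(2) by (simp only: lead_coeff_mult mult_1)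
        have "h - [:-e:] \<noteq> 0" using dw by auto
        then have dg: "degree g = 2 * N" using *(1) dw(1) \<open>g \<noteq> 0\<close> by (simp add: degree_mult_eq del: minus_pCons)
        have "(m ^ N)\<^sup>2 \<le> (norm (rpoly_at a g))\<^sup>2"
          using norm_rpoly_at_lower_real[OF m0 m[unfolded f_def] lg dg] by (simp add: power2_eq_square)
        then have gN: "m ^ N \<le> norm (rpoly_at a g)" using power2_le_imp_le norm_ge_zero by blast
        have E: "rpoly_at a (h ^ Suc N - [:-e:] ^ Suc N) = rpoly_at a h ^ Suc N - of_real (-e) ^ Suc N"
          by (simp only: rpoly_at_minus rpoly_at_power rpoly_at_simps) simp
        have E2: "(rpoly_at a h + of_real e) * rpoly_at a g = rpoly_at a h ^ Suc N - of_real (-e) ^ Suc N"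
          using E unfolding g rpoly_at_mult rpoly_at_minus by simp
        have "norm (rpoly_at a h + of_real e) * m ^ N \<le> norm (rpoly_at a h + of_real e) * norm (rpoly_at a g)"
          by (rule mult_left_mono[OF gN]) simp
        also have "\<dots> = norm (rpoly_at a h ^ Suc N - of_real (-e) ^ Suc N)"
          unfolding E2[symmetric] norm_mult ..
        also have "\<dots> \<le> m ^ Suc N + e ^ Suc N"
          by (rule order_trans[OF norm_triangle_ineq4])
            (use w e in \<open>simp add: h_def norm_power norm_mult\<close>)
        finally show ?thesis using mp by (simp add: field_simps power_divide)
      qed
      have "(\<lambda>N. m + e * (e / m) ^ N) \<longlonglongrightarrow> m + e * 0"
        using e mp by (intro tendsto_intros LIMSEQ_power_zero) auto
      then show "norm (rpoly_at a (conj_quadratic w) + of_real e) \<le> m"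
        using bound by (intro LIMSEQ_le_const[of _ "m"]) (auto simp: h_def)
    qed
    have iter: "\<exists>w. rpoly_at a (conj_quadratic w) = rpoly_at a (conj_quadratic z) + of_real (real j * (m / 2)) \<and>
         norm (rpoly_at a (conj_quadratic w)) = m" for j
    proof (induction j)
      case 0 then show ?case by (intro exI[of _ z]) (simp add: m_def f_def)
    next
      case (Suc j)
      then obtain w where w: "rpoly_at a (conj_quadratic w) = rpoly_at a (conj_quadratic z) + of_real (real j * (m / 2))"
         "norm (rpoly_at a (conj_quadratic w)) = m" by blast
      define w' where "w' = Complex (Re w) (sqrt ((Im w)\<^sup>2 + m / 2))"
      have "conj_quadratic w' = conj_quadratic w + [:m / 2:]"
        using mp by (simp add: conj_quadratic_def w'_def cmod_power2 algebra_simps)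
      then have "rpoly_at a (conj_quadratic w') = rpoly_at a (conj_quadratic w) + of_real (m / 2)" by (simp add: rpoly_at_add)
      then show ?case using step[OF w(2), of "m / 2"] w mp
        by (intro exI[of _ w']) (simp add: algebra_simps)
    qed
    \<comment> \<open>Five steps of size \<open>m / 2\<close> are more than the diameter \<open>2 * m\<close> of the sphere of radius \<open>m\<close>.\<close>
    obtain w where w: "rpoly_at a (conj_quadratic w) = rpoly_at a (conj_quadratic z) + of_real (real 5 * (m / 2))"
         "norm (rpoly_at a (conj_quadratic w)) = m" using iter[of 5] by auto
    have "norm (of_real (real 5 * (m / 2)) :: 'k) \<le> norm (rpoly_at a (conj_quadratic w)) + norm (rpoly_at a (conj_quadratic z))"
      using norm_triangle_ineq4[of "rpoly_at a (conj_quadratic w)" "rpoly_at a (conj_quadratic z)"] w(1) by simp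
    moreover have "norm (of_real (real 5 * (m / 2)) :: 'k) = 5 * (m / 2)" unfolding norm_of_real using mp by simp
    ultimately show False using w(2) mp by (simp add: m_def f_def)
  qed
  then show ?thesis unfolding m_def f_def by auto
qed

text \<open>
  The Gelfand-Mazur theorem for fields. Completing the square in the quadratic equation of an
  element outside the reals yields a square root of \<open>- 1\<close>, and a field contains at most two of
  them.
\<close>

lemma reals_or_complex:
  shows "(\<forall>a::'k::real_normed_field. a \<in> \<real>) \<or> (\<exists>\<iota>::'k. \<iota> * \<iota> = - 1 \<and> (\<forall>a. \<exists>s t. a = of_real s + \<iota> * of_real t))"
proof -
  have key: "\<exists>s t. \<exists>j::'k. a = of_real s + j * of_real t \<and> j * j = -1" if "a \<notin> \<real>" for a :: 'k
  proof -
    obtain w where w: "rpoly_at a (conj_quadratic w) = 0" using quadratic_over_reals by blast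
    define b where "b = a - of_real (Re w)"
    have bb: "b * b = - of_real ((Im w)\<^sup>2)"
      using w unfolding b_def conj_quadratic_def cmod_power2
      by (simp add: algebra_simps power2_eq_square add_eq_0_iff)
    have "Im w \<noteq> 0"
    proof
      assume "Im w = 0"
      then have "b = 0" using bb by simp
      then show False using that by (simp add: b_def)
    qed
    then show ?thesis
      using bb by (intro exI[of _ "Re w"] exI[of _ "Im w"] exI[of _ "b / of_real (Im w)"])
        (auto simp: b_def field_simps power2_eq_square)
  qed
  show ?thesis
  proof (cases "\<forall>a::'k. a \<in> \<real>")
    case False
    then obtain \<iota> :: 'k where \<iota>: "\<iota> * \<iota> = -1" using key by blast
    have "\<exists>s t. a = of_real s + \<iota> * of_real t" for a
    proof (cases "a \<in> \<real>")
      case True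
      then obtain r where "a = of_real r" by (auto elim: Reals_cases)
      then show ?thesis by (intro exI[of _ r] exI[of _ 0]) simp
    next
      case False
      from key[OF False] obtain s t j where a: "a = of_real s + j * of_real t" "j * j = -1" by auto
      have "(j - \<iota>) * (j + \<iota>) = 0" using a(2) \<iota> by (simp add: algebra_simps)
      then have "j = \<iota> \<or> j = - \<iota>" by (auto simp: add_eq_0_iff2)
      then show ?thesis
      proof
        assume "j = - \<iota>"
        then show ?thesis using a by (intro exI[of _ s] exI[of _ "-t"]) simp
      qed (use a in auto)
    qed
    then show ?thesis using \<iota> by blast
  qed auto
qed

section \<open>Vector spaces and normed spaces\<close>

lemma scalars_simps [simp]:
  "carrier scalars = UNIV" "mult scalars = (*)" "one scalars = 1" "zero scalars = 0"
  "add scalars = (+)" "smult scalars = (*)" "nrm scalars = norm"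
  by (simp_all add: scalars_def)

lemma cring_scalars: "cring (scalars :: ('k::real_normed_field, 'k) normed_module)"
proof (rule cringI)
  show "abelian_group (scalars :: ('k, 'k) normed_module)"
    by (rule abelian_groupI) (auto simp: add.assoc add.commute intro: exI[of _ "- _"] add.left_inverse)
  show "Group.comm_monoid (scalars :: ('k, 'k) normed_module)"
    by (rule Group.comm_monoidI) (auto simp: mult.assoc mult.commute)
qed (simp add: algebra_simps)

locale vspace =
  fixes V (structure)
  assumes mod: "Module.module (scalars :: ('k::real_normed_field, 'k) normed_module) V"
begin

sublocale M: Module.module "scalars :: ('k, 'k) normed_module" V by (rule mod)

lemma smult_closed [simp, intro]: "x \<in> carrier V \<Longrightarrow> (a::'k) \<odot> x \<in> carrier V"
  by (rule M.smult_closed) simp_all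

lemma smult_l_distr: "x \<in> carrier V \<Longrightarrow> ((a::'k) + b) \<odot> x = a \<odot> x \<oplus> b \<odot> x"
  using M.smult_l_distr[of a b x] by simp

lemma smult_r_distr: "x \<in> carrier V \<Longrightarrow> y \<in> carrier V \<Longrightarrow> (a::'k) \<odot> (x \<oplus> y) = a \<odot> x \<oplus> a \<odot> y"
  using M.smult_r_distr[of a x y] by simp

lemma smult_assoc: "x \<in> carrier V \<Longrightarrow> ((a::'k) * b) \<odot> x = a \<odot> (b \<odot> x)"
  using M.smult_assoc1[of a b x] by simp

lemma smult_one [simp]: "x \<in> carrier V \<Longrightarrow> (1::'k) \<odot> x = x"
  using M.smult_one[of x] by simp

lemma smult_zero [simp]: "x \<in> carrier V \<Longrightarrow> (0::'k) \<odot> x = \<zero>"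
  using M.smult_l_null[of x] by simp

lemma smult_r_zero [simp]: "(a::'k) \<odot> \<zero> = \<zero>"
  using M.smult_r_null[of a] by simp

lemma neg_eq_smult: "x \<in> carrier V \<Longrightarrow> \<ominus> x = (-1::'k) \<odot> x"
  by (rule M.M.minus_equality) (use smult_l_distr[of x "-1" 1] in simp_all)

lemma minus_eq_smult: "x \<in> carrier V \<Longrightarrow> y \<in> carrier V \<Longrightarrow> x \<ominus> y = x \<oplus> (-1::'k) \<odot> y"
  by (simp add: a_minus_def neg_eq_smult)

lemma smult_minus: "x \<in> carrier V \<Longrightarrow> y \<in> carrier V \<Longrightarrow> (a::'k) \<odot> (x \<ominus> y) = a \<odot> x \<ominus> a \<odot> y"
  by (simp add: minus_eq_smult smult_r_distr flip: smult_assoc)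

end

locale nspace =
  fixes V :: "('k::real_normed_field, 'v) normed_module" (structure)
  assumes nsp: "is_normed_space V"
begin

sublocale vspace V by (rule vspace.intro) (use nsp in \<open>simp add: is_normed_space_def\<close>)

lemma nrm_nonneg [simp]: "x \<in> carrier V \<Longrightarrow> 0 \<le> nrm V x"
  and nrm_eq_0: "x \<in> carrier V \<Longrightarrow> nrm V x = 0 \<longleftrightarrow> x = \<zero>"
  and nrm_smult: "x \<in> carrier V \<Longrightarrow> nrm V (a \<odot> x) = norm a * nrm V x"
  and nrm_triangle: "x \<in> carrier V \<Longrightarrow> y \<in> carrier V \<Longrightarrow> nrm V (x \<oplus> y) \<le> nrm V x + nrm V y"
  using nsp by (simp_all add: is_normed_space_def)

lemma nrm_zero [simp]: "nrm V \<zero> = 0" by (simp add: nrm_eq_0)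

lemma nrm_minus: "x \<in> carrier V \<Longrightarrow> y \<in> carrier V \<Longrightarrow> nrm V (x \<ominus> y) \<le> nrm V x + nrm V y"
  using nrm_triangle[of x "(-1) \<odot> y"] by (simp add: minus_eq_smult nrm_smult)

lemma minus_eq_0: "x \<in> carrier V \<Longrightarrow> y \<in> carrier V \<Longrightarrow> x \<ominus> y = \<zero> \<longleftrightarrow> x = y"
  by (metis M.M.add.m_assoc M.M.a_inv_closed M.M.l_neg M.M.l_zero M.M.minus_eq M.M.r_neg M.M.r_zero)

lemma ndist_eq: "x \<in> carrier V \<Longrightarrow> y \<in> carrier V \<Longrightarrow> ndist V x y = nrm V (x \<ominus> y)"
  by (simp add: ndist_def)

lemma minus_swap: "x \<in> carrier V \<Longrightarrow> y \<in> carrier V \<Longrightarrow> (-1) \<odot> (x \<ominus> y) = y \<ominus> x"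
  by (simp add: minus_eq_smult smult_r_distr M.M.a_comm flip: smult_assoc)

lemma minus_trans: "x \<in> carrier V \<Longrightarrow> y \<in> carrier V \<Longrightarrow> z \<in> carrier V \<Longrightarrow>
   x \<ominus> z = (x \<ominus> y) \<oplus> (y \<ominus> z)"
  by (simp add: a_minus_def M.M.a_assoc M.M.r_neg2 M.M.r_neg1)

sublocale D: Metric_space "carrier V" "ndist V"
proof
  show "0 \<le> ndist V x y" for x y by (simp add: ndist_def)
  show "ndist V x y = ndist V y x" for x y
  proof (cases "x \<in> carrier V \<and> y \<in> carrier V")
    case True
    then show ?thesis using nrm_smult[of "x \<ominus> y" "-1"] by (simp add: ndist_def minus_swap)
  qed (auto simp: ndist_def)
  show "ndist V x y = 0 \<longleftrightarrow> x = y" if "x \<in> carrier V" "y \<in> carrier V" for x y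
    using that by (simp add: ndist_def nrm_eq_0 minus_eq_0)
  show "ndist V x z \<le> ndist V x y + ndist V y z"
    if "x \<in> carrier V" "y \<in> carrier V" "z \<in> carrier V" for x y z
    using that nrm_triangle[of "x \<ominus> y" "y \<ominus> z"] minus_trans[of x y z] by (simp add: ndist_def)
qed

end

lemma (in vspace) linear_map_zero:
  assumes "linear_map V W f" "vspace (W :: ('k, 'w, 'm) module_scheme)"
  shows "f \<zero> = \<zero>\<^bsub>W\<^esub>"
proof -
  interpret W: vspace W by fact
  have car: "f \<zero> \<in> carrier W" using assms(1) M.M.zero_closed unfolding linear_map_def by blast
  have "f ((0::'k) \<odot> \<zero>) = (0::'k) \<odot>\<^bsub>W\<^esub> f \<zero>"
    using assms(1) M.M.zero_closed unfolding linear_map_def by blast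
  then show ?thesis unfolding W.smult_zero[OF car] by simp
qed

lemma (in vspace) linear_map_minus:
  assumes "linear_map V W f" "vspace (W :: ('k, 'w, 'm) module_scheme)" "x \<in> carrier V" "y \<in> carrier V"
  shows "f (x \<ominus> y) = f x \<ominus>\<^bsub>W\<^esub> f y"
proof -
  interpret W: vspace W by fact
  have "f x \<in> carrier W" "f y \<in> carrier W" using assms unfolding linear_map_def by auto
  then show ?thesis using assms unfolding linear_map_def
    by (simp add: minus_eq_smult W.minus_eq_smult)
qed

lemma vspace_scalars: "vspace (scalars :: ('k::real_normed_field, 'k) normed_module)"
  by (rule vspace.intro, rule moduleI) (auto simp: cring_scalars algebra_simps
   intro: cring_scalars[THEN cring.axioms(1), THEN ring.is_abelian_group])

lemma scalars_minus [simp]: "x \<ominus>\<^bsub>scalars\<^esub> y = x - (y :: 'k::real_normed_field)"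
  using vspace.minus_eq_smult[OF vspace_scalars, of x y] by simp

lemma nspace_scalars: "nspace (scalars :: ('k::real_normed_field, 'k) normed_module)"
  using vspace_scalars by (intro nspace.intro)
    (auto simp: is_normed_space_def vspace_def norm_mult norm_triangle_ineq)

section \<open>The Hahn-Banach theorem\<close>

context nspace begin

definition sublinear :: "('v \<Rightarrow> real) \<Rightarrow> bool" where
  "sublinear q \<longleftrightarrow>
     (\<forall>x\<in>carrier V. \<forall>y\<in>carrier V. q (x \<oplus> y) \<le> q x + q y) \<and>
     (\<forall>c>0. \<forall>x\<in>carrier V. q (of_real c \<odot> x) \<le> c * q x) \<and>
     (\<forall>x. x \<notin> carrier V \<longrightarrow> q x = 0)"

lemma sublinear_zero:
  assumes "sublinear q" shows "q \<zero> = 0"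
proof (rule antisym)
  have "q \<zero> \<le> 1/2 * q \<zero>"
    using assms unfolding sublinear_def
    by (metis M.M.zero_closed half_gt_zero_iff smult_r_zero zero_less_one)
  then show "q \<zero> \<le> 0" by simp
  have "q (\<zero> \<oplus> \<zero>) \<le> q \<zero> + q \<zero>" using assms unfolding sublinear_def by blast
  then show "q \<zero> \<ge> 0" by simp
qed

lemma sublinear_scale:
  assumes "sublinear q" "0 < c" "x \<in> carrier V"
  shows "q (of_real c \<odot> x) = c * q x"
proof (rule antisym)
  show "q (of_real c \<odot> x) \<le> c * q x" using assms unfolding sublinear_def by blast
  have "q (of_real (1/c) \<odot> (of_real c \<odot> x)) \<le> 1/c * q (of_real c \<odot> x)"
    using assms unfolding sublinear_def by (meson smult_closed zero_less_divide_1_iff)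
  moreover have "of_real (1/c) \<odot> (of_real c \<odot> x) = x"
    using assms smult_assoc[of x "of_real (1/c)" "of_real c"] by simp
  ultimately show "c * q x \<le> q (of_real c \<odot> x)" using assms(2) by (simp add: field_simps)
qed

lemma sublinear_lower:
  assumes "sublinear q" "x \<in> carrier V" shows "- q ((-1) \<odot> x) \<le> q x"
proof -
  have "q (x \<oplus> (-1) \<odot> x) \<le> q x + q ((-1) \<odot> x)" using assms unfolding sublinear_def by blast
  then show ?thesis
    using sublinear_zero[OF assms(1)] assms(2) by (simp add: M.M.r_neg flip: neg_eq_smult)
qed

text \<open>
  The largest sublinear functional below \<open>q\<close> whose value at \<open>- y\<close> is \<open>- q y\<close>. In the proof of the
  Hahn-Banach theorem it replaces the extension of a functional by one dimension.
\<close>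

definition dir_inf :: "('v \<Rightarrow> real) \<Rightarrow> 'v \<Rightarrow> 'v \<Rightarrow> real" where
  "dir_inf q y x = (if x \<in> carrier V then INF t\<in>{0..}. q (x \<oplus> of_real t \<odot> y) - t * q y else 0)"

lemma dir_inf_lower:
  assumes q: "sublinear q" and xy: "x \<in> carrier V" "y \<in> carrier V" and t: "0 \<le> t"
  shows "- q ((-1) \<odot> x) \<le> q (x \<oplus> of_real t \<odot> y) - t * q y"
proof -
  have "t * q y = q (of_real t \<odot> y)"
    using t sublinear_scale[OF q _ xy(2), of t] sublinear_zero[OF q] xy by (cases "t = 0") auto
  also have "of_real t \<odot> y = (x \<oplus> of_real t \<odot> y) \<oplus> (-1) \<odot> x"
    using xy by (simp add: M.M.a_comm M.M.a_assoc M.M.r_neg1 M.M.r_neg2 flip: neg_eq_smult)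
  also have "q \<dots> \<le> q (x \<oplus> of_real t \<odot> y) + q ((-1) \<odot> x)"
    using q xy unfolding sublinear_def by auto
  finally show ?thesis by simp
qed

lemma dir_inf_le:
  assumes q: "sublinear q" and xy: "x \<in> carrier V" "y \<in> carrier V" and t: "0 \<le> t"
  shows "dir_inf q y x \<le> q (x \<oplus> of_real t \<odot> y) - t * q y"
proof -
  have "bdd_below ((\<lambda>t. q (x \<oplus> of_real t \<odot> y) - t * q y) ` {0..})"
    using dir_inf_lower[OF q xy] by (intro bdd_belowI2[of _ "- q ((-1) \<odot> x)"]) auto
  then show ?thesis using t xy by (auto simp: dir_inf_def intro!: cINF_lower)
qed

lemma dir_inf_ge:
  assumes "x \<in> carrier V" "\<And>t. 0 \<le> t \<Longrightarrow> B \<le> q (x \<oplus> of_real t \<odot> y) - t * q y"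
  shows "B \<le> dir_inf q y x"
  using assms unfolding dir_inf_def by (auto intro!: cINF_greatest)

lemma dir_inf_sublinear:
  assumes q: "sublinear q" and y: "y \<in> carrier V"
  shows "sublinear (dir_inf q y)"
  unfolding sublinear_def
proof (intro conjI ballI allI impI)
  fix x z assume xz: "x \<in> carrier V" "z \<in> carrier V"
  have *: "dir_inf q y (x \<oplus> z) \<le> (q (x \<oplus> of_real t \<odot> y) - t * q y) + (q (z \<oplus> of_real s \<odot> y) - s * q y)"
    if "0 \<le> t" "0 \<le> s" for t s
  proof -
    have eq: "(x \<oplus> z) \<oplus> of_real (t + s) \<odot> y = (x \<oplus> of_real t \<odot> y) \<oplus> (z \<oplus> of_real s \<odot> y)"
      using xz y by (simp add: smult_l_distr M.M.a_ac)
    have "dir_inf q y (x \<oplus> z) \<le> q ((x \<oplus> z) \<oplus> of_real (t + s) \<odot> y) - (t + s) * q y"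
      using xz y that by (intro dir_inf_le[OF q]) auto
    also have "q ((x \<oplus> z) \<oplus> of_real (t + s) \<odot> y) \<le> q (x \<oplus> of_real t \<odot> y) + q (z \<oplus> of_real s \<odot> y)"
      unfolding eq using q xz y unfolding sublinear_def by auto
    finally show ?thesis by (simp add: algebra_simps)
  qed
  have "dir_inf q y (x \<oplus> z) - dir_inf q y x \<le> dir_inf q y z"
  proof (rule dir_inf_ge[OF xz(2)])
    fix s :: real assume s: "0 \<le> s"
    have "dir_inf q y (x \<oplus> z) - (q (z \<oplus> of_real s \<odot> y) - s * q y) \<le> dir_inf q y x"
      by (rule dir_inf_ge[OF xz(1)]) (use *[OF _ s] in \<open>simp add: algebra_simps\<close>)
    then show "dir_inf q y (x \<oplus> z) - dir_inf q y x \<le> q (z \<oplus> of_real s \<odot> y) - s * q y" by simp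
  qed
  then show "dir_inf q y (x \<oplus> z) \<le> dir_inf q y x + dir_inf q y z" by simp
next
  fix c :: real and x assume c: "0 < c" and x: "x \<in> carrier V"
  have "dir_inf q y (of_real c \<odot> x) / c \<le> dir_inf q y x"
  proof (rule dir_inf_ge[OF x])
    fix t :: real assume t: "0 \<le> t"
    have "dir_inf q y (of_real c \<odot> x) \<le> q (of_real c \<odot> x \<oplus> of_real (c * t) \<odot> y) - (c * t) * q y"
      using x y c t by (intro dir_inf_le[OF q]) auto
    also have "of_real c \<odot> x \<oplus> of_real (c * t) \<odot> y = of_real c \<odot> (x \<oplus> of_real t \<odot> y)"
      using x y by (simp add: smult_r_distr smult_assoc)
    also have "q \<dots> = c * q (x \<oplus> of_real t \<odot> y)" using x y by (intro sublinear_scale[OF q c]) auto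
    finally show "dir_inf q y (of_real c \<odot> x) / c \<le> q (x \<oplus> of_real t \<odot> y) - t * q y"
      using c by (simp add: field_simps)
  qed
  then show "dir_inf q y (of_real c \<odot> x) \<le> c * dir_inf q y x" using c by (simp add: field_simps)
qed (simp add: dir_inf_def)

text \<open>
  Zorn's lemma applies because every sublinear functional \<open>q\<close> below \<open>p\<close> satisfies
  \<open>- p (- x) \<le> q x\<close>, so that the pointwise infimum of a chain exists.
\<close>

lemma minimal_sublinear:
  assumes p: "sublinear p"
  obtains q where "sublinear q" "\<And>x. q x \<le> p x" "\<And>r. sublinear r \<Longrightarrow> (\<And>x. r x \<le> q x) \<Longrightarrow> r = q"
proof -
  define A where "A = {q. sublinear q \<and> (\<forall>x. q x \<le> p x)}"
  define P where "P q r \<longleftrightarrow> (\<forall>x. r x \<le> (q x :: real))" for q r :: "'v \<Rightarrow> real"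
  have lower: "- p ((-1) \<odot> x) \<le> q x" if "q \<in> A" "x \<in> carrier V" for q x
    using that sublinear_lower[of q x] unfolding A_def
    by (smt (verit, ccfv_SIG) mem_Collect_eq)
  have "\<exists>q\<in>A. \<forall>r\<in>A. P q r \<longrightarrow> r = q"
  proof (rule predicate_Zorn)
    show "partial_order_on A (relation_of P A)"
    proof (rule partial_order_on_relation_ofI)
      show "q = r" if "P q r" "P r q" for q r
        using that by (intro ext antisym) (auto simp: P_def)
    qed (auto simp: P_def intro: order_trans)
    fix C assume "C \<in> Chains (relation_of P A)"
    then have C: "C \<subseteq> A" "\<And>q r. q \<in> C \<Longrightarrow> r \<in> C \<Longrightarrow> P q r \<or> P r q"
      unfolding Chains_def relation_of_def by auto
    show "\<exists>u\<in>A. \<forall>q\<in>C. P q u"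
    proof (cases "C = {}")
      case True then show ?thesis using p by (auto simp: A_def)
    next
      case ne: False
      define u where "u x = (if x \<in> carrier V then INF q\<in>C. q x else 0)" for x
      have bdd: "bdd_below ((\<lambda>q. q x) ` C)" if "x \<in> carrier V" for x
        using lower[OF _ that] C by (intro bdd_belowI2) auto
      have off: "q x = 0" if "q \<in> C" "x \<notin> carrier V" for q x
        using that C(1) by (auto simp: A_def sublinear_def)
      have le: "u x \<le> q x" if "q \<in> C" for q x
        using that bdd off[OF that, of x] by (auto simp: u_def intro: cINF_lower)
      have ge: "B \<le> u x" if "x \<in> carrier V" "\<And>q. q \<in> C \<Longrightarrow> B \<le> q x" for B x
        using that ne by (auto simp: u_def intro!: cINF_greatest)
      have "sublinear u"
        unfolding sublinear_def
      proof (intro conjI ballI allI impI)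
        fix x z assume xz: "x \<in> carrier V" "z \<in> carrier V"
        have *: "u (x \<oplus> z) \<le> q x + r z" if qr: "q \<in> C" "r \<in> C" for q r
        proof -
          from C(2)[OF qr] obtain s where s: "s \<in> C" "s x \<le> q x" "s z \<le> r z"
            using qr by (auto simp: P_def)
          have "s (x \<oplus> z) \<le> s x + s z" using s(1) C(1) xz by (auto simp: A_def sublinear_def)
          then show ?thesis using le[OF s(1), of "x \<oplus> z"] s by simp
        qed
        have "u (x \<oplus> z) - u x \<le> u z"
        proof (rule ge[OF xz(2)])
          fix r assume r: "r \<in> C"
          have "u (x \<oplus> z) - r z \<le> u x" by (rule ge[OF xz(1)]) (use *[OF _ r] in \<open>simp add: algebra_simps\<close>)
          then show "u (x \<oplus> z) - u x \<le> r z" by simp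
        qed
        then show "u (x \<oplus> z) \<le> u x + u z" by simp
      next
        fix c :: real and x assume c: "0 < c" and x: "x \<in> carrier V"
        have "u (of_real c \<odot> x) / c \<le> u x"
        proof (rule ge[OF x])
          fix q assume q: "q \<in> C"
          then have "q (of_real c \<odot> x) \<le> c * q x" using C(1) c x by (auto simp: A_def sublinear_def)
          then show "u (of_real c \<odot> x) / c \<le> q x" using le[OF q, of "of_real c \<odot> x"] c by (simp add: field_simps)
        qed
        then show "u (of_real c \<odot> x) \<le> c * u x" using c by (simp add: field_simps)
      qed (simp add: u_def)
      moreover have "u x \<le> p x" for x
      proof -
        from ne obtain q where "q \<in> C" by blast
        then show ?thesis using le[of q x] C(1) by (auto simp: A_def intro: order_trans)
      qed
      ultimately show ?thesis using le by (auto simp: A_def P_def)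
    qed
  qed
  then obtain q where q: "q \<in> A" "\<And>r. r \<in> A \<Longrightarrow> P q r \<Longrightarrow> r = q" by blast
  show ?thesis
  proof (rule that[of q])
    show "r = q" if r: "sublinear r" "\<And>x. r x \<le> q x" for r
    proof (rule q(2))
      have "r x \<le> p x" for x using r(2)[of x] q(1) order_trans by (auto simp: A_def)
      then show "r \<in> A" "P q r" using r by (auto simp: A_def P_def)
    qed
  qed (use q in \<open>auto simp: A_def\<close>)
qed

text \<open>
  A minimal sublinear functional \<open>q\<close> is linear: by minimality it equals \<open>dir_inf q y\<close> for
  every \<open>y\<close>, and this says that \<open>q x + q y \<le> q (x + y)\<close>.
\<close>

lemma real_hahn_banach:
  assumes p: "sublinear p"
  obtains f where "\<And>x. x \<in> carrier V \<Longrightarrow> f x \<le> p x"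
    "\<And>x y. x \<in> carrier V \<Longrightarrow> y \<in> carrier V \<Longrightarrow> f (x \<oplus> y) = f x + f y"
    "\<And>c x. x \<in> carrier V \<Longrightarrow> f (of_real c \<odot> x) = c * f x"
proof -
  obtain q where q: "sublinear q" "\<And>x. q x \<le> p x"
    and min: "\<And>r. sublinear r \<Longrightarrow> (\<And>x. r x \<le> q x) \<Longrightarrow> r = q" using minimal_sublinear[OF p] by blast
  have add: "q (x \<oplus> y) = q x + q y" if xy: "x \<in> carrier V" "y \<in> carrier V" for x y
  proof (rule antisym)
    show "q (x \<oplus> y) \<le> q x + q y" using q xy unfolding sublinear_def by blast
    have "dir_inf q y z \<le> q z" for z
      using dir_inf_le[OF q(1) _ xy(2), of z 0] xy q(1) by (cases "z \<in> carrier V") (auto simp: dir_inf_def sublinear_def)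
    then have "dir_inf q y = q" using dir_inf_sublinear[OF q(1) xy(2)] min by blast
    then show "q x + q y \<le> q (x \<oplus> y)" using dir_inf_le[OF q(1) xy, of 1] xy by simp
  qed
  have neg: "q ((-1) \<odot> x) = - q x" if "x \<in> carrier V" for x
    using add[of x "(-1) \<odot> x"] that sublinear_zero[OF q(1)] by (simp add: M.M.r_neg flip: neg_eq_smult)
  have "q (of_real c \<odot> x) = c * q x" if x: "x \<in> carrier V" for c x
  proof (cases c "0::real" rule: linorder_cases)
    case less
    have "of_real c \<odot> x = (-1) \<odot> (of_real (-c) \<odot> x)" using x smult_assoc[of x "-1" "of_real (-c)"] by simp
    then show ?thesis using neg[of "of_real (-c) \<odot> x"] sublinear_scale[OF q(1), of "-c" x] less x by simp
  qed (use x sublinear_zero[OF q(1)] sublinear_scale[OF q(1)] in auto)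
  then show ?thesis using that[of q] q add by blast
qed

text \<open>
  Starting below \<open>dir_inf\<close> of the norm in the direction \<open>x0\<close>, rather than below the norm
  itself, forces the value at \<open>x0\<close>.
\<close>

lemma real_norming_functional:
  assumes x0: "x0 \<in> carrier V"
  obtains f where "\<And>x. x \<in> carrier V \<Longrightarrow> \<bar>f x\<bar> \<le> nrm V x" "nrm V x0 \<le> f x0"
    "\<And>x y. x \<in> carrier V \<Longrightarrow> y \<in> carrier V \<Longrightarrow> f (x \<oplus> y) = f x + f y"
    "\<And>c x. x \<in> carrier V \<Longrightarrow> f (of_real c \<odot> x) = c * f x"
proof -
  define q where "q x = (if x \<in> carrier V then nrm V x else 0)" for x
  have q: "sublinear q" unfolding sublinear_def q_def by (auto simp: nrm_triangle nrm_smult)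
  obtain f where f: "\<And>x. x \<in> carrier V \<Longrightarrow> f x \<le> dir_inf q x0 x"
    "\<And>x y. x \<in> carrier V \<Longrightarrow> y \<in> carrier V \<Longrightarrow> f (x \<oplus> y) = f x + f y"
    "\<And>c x. x \<in> carrier V \<Longrightarrow> f (of_real c \<odot> x) = c * f x"
    using real_hahn_banach[OF dir_inf_sublinear[OF q x0]] by blast
  have neg: "f ((-1) \<odot> x) = - f x" if "x \<in> carrier V" for x using f(3)[OF that, of "-1"] by simp
  have le: "f x \<le> nrm V x" if "x \<in> carrier V" for x
    using order_trans[OF f(1)[OF that] dir_inf_le[OF q that x0, of 0]] that x0 by (simp add: q_def)
  show ?thesis
  proof (rule that[of f])
    show "\<bar>f x\<bar> \<le> nrm V x" if "x \<in> carrier V" for x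
      using le[OF that] le[of "(-1) \<odot> x"] neg that by (simp add: nrm_smult abs_le_iff)
    have "f ((-1) \<odot> x0) \<le> - nrm V x0"
      using order_trans[OF f(1) dir_inf_le[OF q _ x0, of "(-1) \<odot> x0" 1]] x0
      by (simp add: q_def M.M.l_neg flip: neg_eq_smult)
    then show "nrm V x0 \<le> f x0" using neg[OF x0] by simp
  qed (use f in auto)
qed

end

lemma bounded_linear_mapI:
  "linear_map V W f \<Longrightarrow> (\<And>x. x \<in> carrier V \<Longrightarrow> nrm W (f x) \<le> M * nrm V x) \<Longrightarrow> bounded_linear_map V W f"
  unfolding bounded_linear_map_def by blast

text \<open>
  For scalars that contain an imaginary unit \<open>\<iota>\<close>, a real-linear functional \<open>f\<close> gives rise to the
  linear functional \<open>f x - \<iota> f (\<iota> x)\<close>, as in the theorem of Bohnenblust and Sobczyk. It does not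
  vanish at \<open>x0\<close>, for otherwise the sum of the squares of the real numbers \<open>f x0\<close> and \<open>f (\<iota> x0)\<close>
  would be zero.
\<close>

lemma (in nspace) separating_functional:
  assumes x0: "x0 \<in> carrier V" "x0 \<noteq> \<zero>"
  shows "\<exists>F. bounded_linear_map V scalars F \<and> F x0 \<noteq> 0"
proof -
  obtain f where f: "\<And>x. x \<in> carrier V \<Longrightarrow> \<bar>f x\<bar> \<le> nrm V x" "nrm V x0 \<le> f x0"
    "\<And>x y. x \<in> carrier V \<Longrightarrow> y \<in> carrier V \<Longrightarrow> f (x \<oplus> y) = f x + f y"
    "\<And>c x. x \<in> carrier V \<Longrightarrow> f (of_real c \<odot> x) = c * f x"
    using real_norming_functional[OF x0(1)] by blast
  have "0 < nrm V x0" using x0 nrm_eq_0[of x0] nrm_nonneg[of x0] by (simp add: order_less_le)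
  then have fx0: "f x0 > 0" using f(2) by linarith
  consider "\<forall>a::'k. a \<in> \<real>" | \<iota> :: 'k where "\<iota> * \<iota> = - 1" "\<And>a. \<exists>s t. a = of_real s + \<iota> * of_real t"
    using reals_or_complex[where 'k='k] by blast
  then show ?thesis
  proof cases
    case 1
    define F where "F x = (of_real (f x) :: 'k)" for x
    have "F (a \<odot> x) = a * F x" if "x \<in> carrier V" for a x
    proof -
      obtain r where "a = of_real r" using 1 by (auto elim: Reals_cases)
      then show ?thesis using f(4)[OF that, of r] by (simp add: F_def)
    qed
    then have "bounded_linear_map V scalars F"
      unfolding bounded_linear_map_def linear_map_def using f by (auto simp: F_def intro!: exI[of _ 1])
    then show ?thesis using fx0 by (intro exI[of _ F]) (auto simp: F_def)
  next
    case 2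
    define F where "F x = of_real (f x) - \<iota> * of_real (f (\<iota> \<odot> x))" for x
    have add: "F (x \<oplus> y) = F x + F y" if "x \<in> carrier V" "y \<in> carrier V" for x y
      using that by (simp add: F_def f(3) smult_r_distr algebra_simps)
    have real: "F (of_real s \<odot> x) = of_real s * F x" if "x \<in> carrier V" for s x
    proof -
      have "\<iota> \<odot> (of_real s \<odot> x) = of_real s \<odot> (\<iota> \<odot> x)"
        using that by (simp add: mult.commute flip: smult_assoc)
      then show ?thesis using that by (simp add: F_def f(4) algebra_simps)
    qed
    have imag: "F (\<iota> \<odot> x) = \<iota> * F x" if "x \<in> carrier V" for x
    proof -
      have "\<iota> \<odot> (\<iota> \<odot> x) = of_real (- 1) \<odot> x" using that 2(1) by (simp flip: smult_assoc)
      then have "f (\<iota> \<odot> (\<iota> \<odot> x)) = - f x" using f(4)[OF that, of "-1"] by simp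
      then show ?thesis using 2(1) by (simp add: F_def algebra_simps flip: mult.assoc)
    qed
    have scale: "F (a \<odot> x) = a * F x" if x: "x \<in> carrier V" for a x
    proof -
      obtain s t where a: "a = of_real s + \<iota> * of_real t" using 2(2) by blast
      have "F (a \<odot> x) = F (of_real s \<odot> x) + F (\<iota> \<odot> (of_real t \<odot> x))"
        using x unfolding a by (simp add: smult_l_distr smult_assoc add)
      then show ?thesis using x by (simp add: imag real a algebra_simps)
    qed
    have bound: "norm (F x) \<le> (1 + norm \<iota> * norm \<iota>) * nrm V x" if x: "x \<in> carrier V" for x
    proof -
      have "norm (F x) \<le> \<bar>f x\<bar> + norm \<iota> * \<bar>f (\<iota> \<odot> x)\<bar>"
        unfolding F_def by (rule order_trans[OF norm_triangle_ineq4]) (simp add: norm_mult)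
      also have "\<dots> \<le> nrm V x + norm \<iota> * (norm \<iota> * nrm V x)"
        using f(1)[OF x] f(1)[of "\<iota> \<odot> x"] x by (intro add_mono mult_left_mono) (auto simp: nrm_smult)
      finally show ?thesis by (simp add: algebra_simps)
    qed
    have "F x0 \<noteq> 0"
    proof
      assume "F x0 = 0"
      then have "of_real (f x0) = \<iota> * of_real (f (\<iota> \<odot> x0))" by (simp add: F_def)
      then have "(of_real (f x0) :: 'k) * of_real (f x0) = \<iota> * \<iota> * (of_real (f (\<iota> \<odot> x0)) * of_real (f (\<iota> \<odot> x0)))"
        by (simp add: mult_ac)
      then have "(of_real (f x0 * f x0 + f (\<iota> \<odot> x0) * f (\<iota> \<odot> x0)) :: 'k) = 0" using 2(1) by simp
      then have "f x0 * f x0 + f (\<iota> \<odot> x0) * f (\<iota> \<odot> x0) = 0" by (simp only: of_real_eq_0_iff)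
      then show False using fx0 by (simp add: sum_squares_eq_zero_iff)
    qed
    moreover have "bounded_linear_map V scalars F"
      by (rule bounded_linear_mapI[OF _ bound[folded scalars_simps(7)]]) (auto simp: linear_map_def add scale)
    ultimately show ?thesis by blast
  qed
qed

section \<open>Linear maps on spans of evaluations\<close>

text \<open>
  Tensors are functions on forms, and $\ell_p[Y]$ consists of functions on the natural numbers. Both
  inherit the vector space axioms from the values.
\<close>

lemma pointwise_vspace:
  fixes V :: "('k::real_normed_field, 'i \<Rightarrow> 'y, 'm) module_scheme" and Y :: "('k, 'y, 'l) module_scheme"
  assumes Y: "vspace Y" and car: "\<And>s i. s \<in> carrier V \<Longrightarrow> s i \<in> carrier Y"
    and ops: "zero V = (\<lambda>_. \<zero>\<^bsub>Y\<^esub>)" "add V = (\<lambda>s t i. s i \<oplus>\<^bsub>Y\<^esub> t i)" "smult V = (\<lambda>a s i. a \<odot>\<^bsub>Y\<^esub> s i)"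
    and closed: "zero V \<in> carrier V"
      "\<And>s t. s \<in> carrier V \<Longrightarrow> t \<in> carrier V \<Longrightarrow> s \<oplus>\<^bsub>V\<^esub> t \<in> carrier V"
      "\<And>a s. s \<in> carrier V \<Longrightarrow> a \<odot>\<^bsub>V\<^esub> s \<in> carrier V"
  shows "vspace V"
proof -
  interpret Y: vspace Y by (rule Y)
  show ?thesis
  proof (rule vspace.intro, rule moduleI)
    show "cring (scalars :: ('k, 'k) normed_module)" by (rule cring_scalars)
    show "abelian_group V"
    proof (rule abelian_groupI)
      fix x assume x: "x \<in> carrier V"
      show "\<exists>y\<in>carrier V. y \<oplus>\<^bsub>V\<^esub> x = \<zero>\<^bsub>V\<^esub>"
      proof (rule bexI)
        show "((-1) \<odot>\<^bsub>V\<^esub> x) \<oplus>\<^bsub>V\<^esub> x = \<zero>\<^bsub>V\<^esub>"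
          using car[OF x] by (simp add: ops fun_eq_iff Y.M.M.l_neg flip: Y.neg_eq_smult)
      qed (use closed x in auto)
    qed (use closed car in \<open>auto simp: ops fun_eq_iff Y.M.M.a_ac\<close>)
  qed (use closed car in \<open>auto simp: ops fun_eq_iff Y.smult_l_distr Y.smult_r_distr Y.smult_assoc\<close>)
qed

lemma evaluation_span_simps [simp]:
  "zero (evaluation_span F D) = (\<lambda>_. 0)" "add (evaluation_span F D) = (\<lambda>u v B. u B + v B)"
  "smult (evaluation_span F D) = (\<lambda>a u B. a * u B)"
  by (simp_all add: evaluation_span_def)

lemma evaluation_span_zero: "(\<lambda>_. 0) \<in> carrier (evaluation_span F D)"
  unfolding evaluation_span_def by (auto intro!: exI[of _ 0])

lemma evaluation_spanI:
  "(\<And>j. j < m \<Longrightarrow> s j \<in> D) \<Longrightarrow>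
     (\<lambda>B. \<Sum>j<(m::nat). a j * evaluation F (s j) B) \<in> carrier (evaluation_span F D)"
  unfolding evaluation_span_def by auto

lemma evaluation_span_step:
  assumes "w \<in> carrier (evaluation_span F D)" "t \<in> D"
  shows "(\<lambda>B. w B + c * evaluation F t B) \<in> carrier (evaluation_span F D)"
proof -
  obtain m a s where w: "w = (\<lambda>B. \<Sum>j<m. a j * evaluation F (s j) B)" "\<forall>j<(m::nat). s j \<in> D"
    using assms(1) unfolding evaluation_span_def by auto
  have "(\<lambda>B. w B + c * evaluation F t B) =
     (\<lambda>B. \<Sum>j<Suc m. (a(m := c)) j * evaluation F ((s(m := t)) j) B)"
    unfolding w by (auto intro!: sum.cong)
  moreover have "\<dots> \<in> carrier (evaluation_span F D)"
    using w(2) assms(2) by (intro evaluation_spanI) auto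
  ultimately show ?thesis by simp
qed

lemma evaluation_span_induct [consumes 1, case_names zero step]:
  assumes "w \<in> carrier (evaluation_span F D)"
    and "P (\<lambda>_. 0)"
    and "\<And>w c t. w \<in> carrier (evaluation_span F D) \<Longrightarrow> P w \<Longrightarrow> t \<in> D \<Longrightarrow> P (\<lambda>B. w B + c * evaluation F t B)"
  shows "P w"
proof -
  obtain m a s where w: "w = (\<lambda>B. \<Sum>j<m. a j * evaluation F (s j) B)" "\<forall>j<(m::nat). s j \<in> D"
    using assms(1) unfolding evaluation_span_def by auto
  have "(\<lambda>B. \<Sum>j<m. a j * evaluation F (s j) B) \<in> carrier (evaluation_span F D) \<and>
     P (\<lambda>B. \<Sum>j<m. a j * evaluation F (s j) B)"
    using w(2)
  proof (induction m)
    case 0 then show ?case using assms(2) evaluation_span_zero by simp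
  next
    case (Suc m)
    then show ?case
      using evaluation_span_step[of "\<lambda>B. \<Sum>j<m. a j * evaluation F (s j) B" F D "s m" "a m"]
        assms(3)[of "\<lambda>B. \<Sum>j<m. a j * evaluation F (s j) B" "s m" "a m"] by simp
  qed
  then show ?thesis using w by simp
qed

lemma evaluation_span_evaluation: "t \<in> D \<Longrightarrow> evaluation F t \<in> carrier (evaluation_span F D)"
  using evaluation_span_step[OF evaluation_span_zero, where c = 1] by simp

lemma evaluation_span_add:
  assumes "u \<in> carrier (evaluation_span F D)" "v \<in> carrier (evaluation_span F D)"
  shows "(\<lambda>B. u B + v B) \<in> carrier (evaluation_span F D)"
  using assms(2)
proof (induction rule: evaluation_span_induct)
  case (step w c t)
  show ?case using evaluation_span_step[OF step.IH step.hyps(2), of c] by (simp add: add.assoc)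
qed (use assms(1) in simp)

lemma evaluation_span_smult:
  assumes "u \<in> carrier (evaluation_span F D)"
  shows "(\<lambda>B. a * u B) \<in> carrier (evaluation_span F D)"
  using assms
proof (induction rule: evaluation_span_induct)
  case (step w c t)
  show ?case using evaluation_span_step[OF step.IH step.hyps(2), of "a * c"] by (simp add: distrib_left mult.assoc)
qed (use evaluation_span_zero in simp)

lemma evaluation_span_vspace: "vspace (evaluation_span F D :: ('k::real_normed_field, _) module)"
  by (rule pointwise_vspace[OF vspace_scalars])
    (simp_all add: evaluation_span_zero evaluation_span_add evaluation_span_smult)

text \<open>
  The universal property of tensor products. A functional \<open>\<phi>\<close> on \<open>W\<close> turns the given map \<open>g\<close> into a
  form, so the value of \<open>\<phi>\<close> at \<open>L w\<close> can only be \<open>w\<close> applied to this form. If the functionals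
  separate the points of \<open>W\<close>, this determines \<open>L w\<close>, whatever representation of \<open>w\<close> is chosen.
\<close>

lemma evaluation_span_lift:
  fixes W :: "('k::real_normed_field, 'w, 'q) module_scheme" and F :: "('t \<Rightarrow> 'k) set"
  assumes W: "vspace W" and g: "g \<in> D \<rightarrow> carrier W"
    and lin: "\<And>\<phi>. \<phi> \<in> \<Phi> \<Longrightarrow> linear_map W scalars \<phi>"
    and sep: "\<And>y. y \<in> carrier W \<Longrightarrow> (\<And>\<phi>. \<phi> \<in> \<Phi> \<Longrightarrow> \<phi> y = 0) \<Longrightarrow> y = \<zero>\<^bsub>W\<^esub>"
    and F: "\<And>\<phi>. \<phi> \<in> \<Phi> \<Longrightarrow> (\<lambda>t. \<phi> (g t)) \<in> F"
  shows "\<exists>!L. linear_map (evaluation_span F D) W L \<and> L \<in> extensional (carrier (evaluation_span F D)) \<and>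
     (\<forall>t\<in>D. L (evaluation F t) = g t)"
proof -
  interpret W: vspace W by (rule W)
  let ?E = "evaluation_span F D"
  interpret E: vspace ?E by (rule evaluation_span_vspace)
  have lin': "\<And>\<phi> y z. \<phi> \<in> \<Phi> \<Longrightarrow> y \<in> carrier W \<Longrightarrow> z \<in> carrier W \<Longrightarrow> \<phi> (y \<oplus>\<^bsub>W\<^esub> z) = \<phi> y + \<phi> z"
    "\<And>\<phi> y a. \<phi> \<in> \<Phi> \<Longrightarrow> y \<in> carrier W \<Longrightarrow> \<phi> (a \<odot>\<^bsub>W\<^esub> y) = a * \<phi> y"
    using lin by (simp_all add: linear_map_def)
  have uniq: "y = z" if yz: "y \<in> carrier W" "z \<in> carrier W" "\<And>\<phi>. \<phi> \<in> \<Phi> \<Longrightarrow> \<phi> y = \<phi> z" for y z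
  proof -
    have d: "y \<oplus>\<^bsub>W\<^esub> (-1) \<odot>\<^bsub>W\<^esub> z = \<zero>\<^bsub>W\<^esub>"
    proof (rule sep)
      fix \<phi> assume \<phi>: "\<phi> \<in> \<Phi>"
      show "\<phi> (y \<oplus>\<^bsub>W\<^esub> (-1) \<odot>\<^bsub>W\<^esub> z) = 0"
        using lin'(1)[OF \<phi> yz(1), of "(-1) \<odot>\<^bsub>W\<^esub> z"] lin'(2)[OF \<phi> yz(2), of "-1"] yz(2) yz(3)[OF \<phi>] by simp
    qed (use yz in simp)
    have "y = y \<oplus>\<^bsub>W\<^esub> ((-1) \<odot>\<^bsub>W\<^esub> z \<oplus>\<^bsub>W\<^esub> z)"
      using yz by (simp add: W.M.M.l_neg flip: W.neg_eq_smult)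
    also have "\<dots> = z" using yz d by (simp flip: W.M.M.a_assoc)
    finally show ?thesis .
  qed
  have ex: "\<exists>y\<in>carrier W. \<forall>\<phi>\<in>\<Phi>. \<phi> y = w (\<lambda>t. \<phi> (g t))" if "w \<in> carrier ?E" for w
    using that
  proof (induction rule: evaluation_span_induct)
    case zero
    have "\<phi> \<zero>\<^bsub>W\<^esub> = 0" if "\<phi> \<in> \<Phi>" for \<phi>
      using W.linear_map_zero[OF lin[OF that] vspace_scalars] by simp
    then show ?case by (intro bexI[of _ "\<zero>\<^bsub>W\<^esub>"]) auto
  next
    case (step w c t)
    then obtain y where y: "y \<in> carrier W" "\<forall>\<phi>\<in>\<Phi>. \<phi> y = w (\<lambda>t. \<phi> (g t))" by blast
    have gt: "g t \<in> carrier W" using step g by auto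
    show ?case
      by (rule bexI[of _ "y \<oplus>\<^bsub>W\<^esub> c \<odot>\<^bsub>W\<^esub> g t"])
        (use y gt F in \<open>auto simp: lin' evaluation_def\<close>)
  qed
  have "\<forall>w\<in>carrier ?E. \<exists>y. y \<in> carrier W \<and> (\<forall>\<phi>\<in>\<Phi>. \<phi> y = w (\<lambda>t. \<phi> (g t)))" using ex by blast
  then obtain L0 where L0: "\<forall>w\<in>carrier ?E. L0 w \<in> carrier W \<and> (\<forall>\<phi>\<in>\<Phi>. \<phi> (L0 w) = w (\<lambda>t. \<phi> (g t)))"
    by (rule bchoice[THEN exE])
  define L where "L = restrict L0 (carrier ?E)"
  have L: "L w \<in> carrier W" "\<And>\<phi>. \<phi> \<in> \<Phi> \<Longrightarrow> \<phi> (L w) = w (\<lambda>t. \<phi> (g t))" if w: "w \<in> carrier ?E" for w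
    using bspec[OF L0 w] w by (simp_all add: L_def)
  have linL: "linear_map ?E W L"
    unfolding linear_map_def
  proof (intro conjI ballI allI)
    fix u v assume uv: "u \<in> carrier ?E" "v \<in> carrier ?E"
    then show "L (u \<oplus>\<^bsub>?E\<^esub> v) = L u \<oplus>\<^bsub>W\<^esub> L v"
      using L[OF evaluation_span_add[OF uv]] L[OF uv(1)] L[OF uv(2)] by (intro uniq) (auto simp: lin')
  next
    fix a u assume u: "u \<in> carrier ?E"
    show "L (a \<odot>\<^bsub>?E\<^esub> u) = a \<odot>\<^bsub>W\<^esub> L u"
      using L[OF evaluation_span_smult[OF u, of a]] L[OF u] by (intro uniq) (auto simp: lin')
  qed (use L in auto)
  show ?thesis
  proof (rule ex1I[of _ L])
    show "linear_map ?E W L \<and> L \<in> extensional (carrier ?E) \<and> (\<forall>t\<in>D. L (evaluation F t) = g t)"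
    proof (intro conjI ballI linL)
      show "L \<in> extensional (carrier ?E)" by (simp add: L_def)
      fix t assume t: "t \<in> D"
      show "L (evaluation F t) = g t"
        using L[OF evaluation_span_evaluation[OF t, of F]] g t F
        by (intro uniq) (auto simp: evaluation_def)
    qed
  next
    fix L' assume L': "linear_map ?E W L' \<and> L' \<in> extensional (carrier ?E) \<and> (\<forall>t\<in>D. L' (evaluation F t) = g t)"
    have "L' w = L w" if "w \<in> carrier ?E" for w
      using that
    proof (induction rule: evaluation_span_induct)
      case zero
      show ?case using E.linear_map_zero[OF _ W, of L] E.linear_map_zero[OF _ W, of L'] L' linL by simp
    next
      case (step w c t)
      have t: "evaluation F t \<in> carrier ?E" by (rule evaluation_span_evaluation) fact
      have *: "M (\<lambda>B. w B + c * evaluation F t B) = M w \<oplus>\<^bsub>W\<^esub> c \<odot>\<^bsub>W\<^esub> M (evaluation F t)"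
        if "linear_map ?E W M" for M
        using that step(1) t evaluation_span_smult[OF t, of c] unfolding linear_map_def by simp
      have "L (evaluation F t) = g t"
        using L[OF t] g step F by (intro uniq) (auto simp: evaluation_def)
      then show ?case using *[OF linL] *[of L'] L' step by simp
    qed
    then show "L' = L" using L' by (intro extensionalityI[of _ "carrier ?E"]) (auto simp: L_def)
  qed
qed

section \<open>Finite rank operators\<close>

inductive finite_rank :: "('k::real_normed_field, 'v) normed_module \<Rightarrow> ('v \<Rightarrow> 'v) \<Rightarrow> bool"
  for V where
  zero: "finite_rank V (\<lambda>_. \<zero>\<^bsub>V\<^esub>)"
| step: "finite_rank V P \<Longrightarrow> bounded_linear_map V scalars f \<Longrightarrow> e \<in> carrier V \<Longrightarrow>
     finite_rank V (\<lambda>x. P x \<oplus>\<^bsub>V\<^esub> f x \<odot>\<^bsub>V\<^esub> e)"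

lemma (in nspace) bounded_linear_map_bound:
  assumes "bounded_linear_map V W f"
  obtains M where "0 \<le> M" "\<And>x. x \<in> carrier V \<Longrightarrow> nrm W (f x) \<le> M * nrm V x"
proof -
  obtain M where M: "\<And>x. x \<in> carrier V \<Longrightarrow> nrm W (f x) \<le> M * nrm V x"
    using assms unfolding bounded_linear_map_def by blast
  have "nrm W (f x) \<le> \<bar>M\<bar> * nrm V x" if "x \<in> carrier V" for x
    using M[OF that] mult_right_mono[OF abs_ge_self[of M] nrm_nonneg[OF that]] by linarith
  then show ?thesis by (intro that[of "\<bar>M\<bar>"]) auto
qed

lemma (in nspace) finite_rank_bounded_linear:
  assumes "finite_rank V P" shows "bounded_linear_map V V P"
  using assms
proof induction
  case zero
  then show ?case by (auto simp: bounded_linear_map_def linear_map_def intro!: exI[of _ 0])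
next
  case (step P f e)
  obtain M where M: "\<And>x. x \<in> carrier V \<Longrightarrow> nrm V (P x) \<le> M * nrm V x"
    using bounded_linear_map_bound[OF step.IH] by blast
  obtain N where N: "\<And>x. x \<in> carrier V \<Longrightarrow> norm (f x) \<le> N * nrm V x"
    using bounded_linear_map_bound[OF step.hyps(2)] by auto
  have P: "linear_map V V P" and f: "linear_map V scalars f"
    using step by (auto simp: bounded_linear_map_def)
  have car: "\<And>x. x \<in> carrier V \<Longrightarrow> P x \<in> carrier V" using P by (auto simp: linear_map_def)
  have "nrm V (P x \<oplus> f x \<odot> e) \<le> (M + N * nrm V e) * nrm V x" if x: "x \<in> carrier V" for x
  proof -
    have "nrm V (P x \<oplus> f x \<odot> e) \<le> nrm V (P x) + norm (f x) * nrm V e"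
      using nrm_triangle[of "P x" "f x \<odot> e"] car[OF x] step.hyps(3) by (simp add: nrm_smult)
    also have "\<dots> \<le> M * nrm V x + (N * nrm V x) * nrm V e"
      using M[OF x] N[OF x] step.hyps(3) by (intro add_mono mult_right_mono) auto
    finally show ?thesis by (simp add: algebra_simps)
  qed
  moreover have "linear_map V V (\<lambda>x. P x \<oplus> f x \<odot> e)"
    using P f step.hyps(3) car unfolding linear_map_def
    by (auto simp: smult_l_distr smult_r_distr smult_assoc M.M.a_ac)
  ultimately show ?case unfolding bounded_linear_map_def by blast
qed

text \<open>
  By induction on \<open>S\<close>: if \<open>P\<close> fixes \<open>S\<close> but not \<open>x\<close>, choose a bounded functional \<open>g\<close> that does not
  vanish at \<open>y = x - P x\<close> and add to \<open>P z\<close> the multiple of \<open>y\<close> with coefficient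
  \<open>g (z - P z) / g y\<close>. This coefficient is \<open>0\<close> on \<open>S\<close> and \<open>1\<close> at \<open>x\<close>.
\<close>

lemma (in nspace) finite_rank_identity_on:
  assumes "finite S" "S \<subseteq> carrier V"
  shows "\<exists>P. finite_rank V P \<and> (\<forall>x\<in>S. P x = x)"
  using assms
proof (induction S)
  case empty
  then show ?case using finite_rank.zero[of V] by blast
next
  case (insert x S)
  then obtain P where P: "finite_rank V P" "\<forall>x\<in>S. P x = x" by auto
  have lin: "linear_map V V P" and bP: "bounded_linear_map V V P"
    using finite_rank_bounded_linear[OF P(1)] by (auto simp: bounded_linear_map_def)
  have car: "\<And>x. x \<in> carrier V \<Longrightarrow> P x \<in> carrier V" using lin by (auto simp: linear_map_def)
  define y where "y = x \<ominus> P x"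
  have x: "x \<in> carrier V" and y: "y \<in> carrier V" using insert.prems car by (auto simp: y_def)
  show ?case
  proof (cases "y = \<zero>")
    case True
    then have "P x = x" using minus_eq_0[of x "P x"] x car by (auto simp: y_def)
    then show ?thesis using P by auto
  next
    case False
    obtain g where g: "bounded_linear_map V scalars g" "g y \<noteq> 0" using separating_functional[OF y False] by blast
    obtain N where N: "0 \<le> N" "\<And>x. x \<in> carrier V \<Longrightarrow> norm (g x) \<le> N * nrm V x"
      using bounded_linear_map_bound[OF g(1)] by auto
    obtain M where M: "\<And>x. x \<in> carrier V \<Longrightarrow> nrm V (P x) \<le> M * nrm V x"
      using bounded_linear_map_bound[OF bP] by blast
    have glin: "linear_map V scalars g" using g by (auto simp: bounded_linear_map_def)
    define f where "f z = g (z \<ominus> P z) / g y" for z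
    have f_eq: "f z = (g z - g (P z)) / g y" if "z \<in> carrier V" for z
      using linear_map_minus[OF glin vspace_scalars, of z "P z"] that car by (simp add: f_def)
    have "linear_map V scalars f"
      using glin lin car unfolding linear_map_def by (auto simp: f_eq diff_divide_distrib add_divide_distrib right_diff_distrib)
    moreover have "norm (f z) \<le> (N * (1 + M) / norm (g y)) * nrm V z" if z: "z \<in> carrier V" for z
    proof -
      have "norm (g (z \<ominus> P z)) \<le> N * (nrm V z + nrm V (P z))"
        using N(2)[of "z \<ominus> P z"] mult_left_mono[OF nrm_minus[of z "P z"] N(1)] z car by auto
      also have "\<dots> \<le> N * (nrm V z + M * nrm V z)"
        using M[OF z] N(1) by (intro mult_left_mono add_mono) auto
      finally show ?thesis by (simp add: f_def norm_divide divide_right_mono algebra_simps)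
    qed
    ultimately have "bounded_linear_map V scalars f"
      by (intro bounded_linear_mapI[where M = "N * (1 + M) / norm (g y)"]) simp_all
    then have fr: "finite_rank V (\<lambda>z. P z \<oplus> f z \<odot> y)" using finite_rank.step[OF P(1) _ y] by blast
    have "P z \<oplus> f z \<odot> y = z" if "z \<in> S" for z
    proof -
      have "z \<in> carrier V" "P z = z" using that insert.prems P by auto
      then show ?thesis using y f_eq[of z] by simp
    qed
    moreover have "P x \<oplus> f x \<odot> y = x"
    proof -
      have "f x = 1" using g by (simp add: f_def y_def[symmetric])
      then show ?thesis using x y car by (simp add: y_def M.M.minus_eq M.M.a_ac M.M.r_neg M.M.r_neg2 M.M.r_neg1)
    qed
    ultimately show ?thesis using fr by blast
  qed
qed

section \<open>Multilinear maps and bounded forms\<close>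

lemma tuples_upd: "x \<in> tuples n X \<Longrightarrow> i < n \<Longrightarrow> y \<in> carrier (X i) \<Longrightarrow> x(i := y) \<in> tuples n X"
  by (auto simp: tuples_def PiE_def extensional_def)

lemma tuples_mem: "x \<in> tuples n X \<Longrightarrow> i < n \<Longrightarrow> x i \<in> carrier (X i)"
  by (auto simp: tuples_def)

lemma multilinear_mapD:
  assumes "multilinear_map n X Y T"
  shows "x \<in> tuples n X \<Longrightarrow> T x \<in> carrier Y"
    and "x \<in> tuples n X \<Longrightarrow> i < n \<Longrightarrow> y \<in> carrier (X i) \<Longrightarrow> z \<in> carrier (X i) \<Longrightarrow>
        T (x(i := y \<oplus>\<^bsub>X i\<^esub> z)) = T (x(i := y)) \<oplus>\<^bsub>Y\<^esub> T (x(i := z))"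
    and "x \<in> tuples n X \<Longrightarrow> i < n \<Longrightarrow> y \<in> carrier (X i) \<Longrightarrow>
        T (x(i := a \<odot>\<^bsub>X i\<^esub> y)) = a \<odot>\<^bsub>Y\<^esub> T (x(i := y))"
  using assms by (auto simp: multilinear_map_def)

lemma multilinear_map_compose:
  assumes "multilinear_map n X Y T" "linear_map Y Z \<phi>"
  shows "multilinear_map n X Z (\<lambda>x. \<phi> (T x))"
proof -
  note D = multilinear_mapD[OF assms(1)]
  have \<phi>: "\<And>y. y \<in> carrier Y \<Longrightarrow> \<phi> y \<in> carrier Z"
    "\<And>y z. y \<in> carrier Y \<Longrightarrow> z \<in> carrier Y \<Longrightarrow> \<phi> (y \<oplus>\<^bsub>Y\<^esub> z) = \<phi> y \<oplus>\<^bsub>Z\<^esub> \<phi> z"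
    "\<And>a y. y \<in> carrier Y \<Longrightarrow> \<phi> (a \<odot>\<^bsub>Y\<^esub> y) = a \<odot>\<^bsub>Z\<^esub> \<phi> y"
    using assms(2) by (auto simp: linear_map_def)
  show ?thesis
    unfolding multilinear_map_def using D \<phi> by (auto simp: tuples_upd)
qed

locale normed_spaces =
  fixes n :: nat and X :: "nat \<Rightarrow> ('k::{real_normed_field}, 'x) normed_module"
  assumes n_pos: "1 \<le> n" and nspaces: "\<And>i. i < n \<Longrightarrow> nspace (X i)"
begin

abbreviation "elt \<equiv> elem_tensor n X"

lemma prod_nonneg: "x \<in> tuples n X \<Longrightarrow> m \<le> n \<Longrightarrow> 0 \<le> (\<Prod>i<m. nrm (X i) (x i))"
  by (intro Groups_Big.linordered_semidom_class.prod_nonneg ballI)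
    (auto intro!: nspace.nrm_nonneg nspaces tuples_mem)

lemma multilinear_upd_zero:
  assumes B: "multilinear_map n X Y B" and Y: "vspace Y" and x: "x \<in> tuples n X" "i < n"
  shows "B (x(i := \<zero>\<^bsub>X i\<^esub>)) = \<zero>\<^bsub>Y\<^esub>"
proof -
  interpret N: nspace "X i" by (rule nspaces) fact
  interpret Y: vspace Y by (rule Y)
  have "B (x(i := 0 \<odot>\<^bsub>X i\<^esub> \<zero>\<^bsub>X i\<^esub>)) = 0 \<odot>\<^bsub>Y\<^esub> B (x(i := \<zero>\<^bsub>X i\<^esub>))"
    by (rule multilinear_mapD(3)[OF B x N.M.M.zero_closed])
  then show ?thesis
    using multilinear_mapD(1)[OF B tuples_upd[OF x N.M.M.zero_closed]] by simp
qed

text \<open>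
  Interpolates between \<open>y\<close> and the image of \<open>x\<close> under all operators, so that boundedness can be
  shown for one variable at a time.
\<close>

definition partial_apply :: "(nat \<Rightarrow> 'x \<Rightarrow> 'x) \<Rightarrow> nat \<Rightarrow> (nat \<Rightarrow> 'x) \<Rightarrow> (nat \<Rightarrow> 'x) \<Rightarrow> nat \<Rightarrow> 'x" where
  "partial_apply P m x y = (\<lambda>i. if i < m then P i (x i) else y i)"

lemma finite_rank_closed:
  "i < n \<Longrightarrow> finite_rank (X i) P \<Longrightarrow> z \<in> carrier (X i) \<Longrightarrow> P z \<in> carrier (X i)"
  using nspace.finite_rank_bounded_linear[OF nspaces, of i P]
  by (auto simp: bounded_linear_map_def linear_map_def)

lemma partial_apply_tuples:
  assumes "\<And>i. i < n \<Longrightarrow> finite_rank (X i) (P i)" "m \<le> n" "x \<in> tuples n X" "y \<in> tuples n X"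
  shows "partial_apply P m x y \<in> tuples n X"
  unfolding tuples_def
proof (rule PiE_I)
  fix i assume i: "i \<in> {..<n}"
  then show "partial_apply P m x y i \<in> carrier (X i)"
    using finite_rank_closed[OF _ assms(1) tuples_mem[OF assms(3)], of i] tuples_mem[OF assms(4), of i]
    by (simp add: partial_apply_def)
next
  fix i assume "i \<notin> {..<n}"
  then show "partial_apply P m x y i = undefined"
    using assms(2,4) by (auto simp: partial_apply_def tuples_def PiE_def extensional_def)
qed

text \<open>
  In each variable a finite rank operator replaces the argument by a combination of finitely many
  fixed vectors \<open>e\<close>, with coefficients \<open>f\<close> that are bounded by the norm of the argument. Thus the
  bound for \<open>m + 1\<close> variables follows from the bounds for \<open>m\<close> variables with \<open>e\<close> as the entry
  \<open>m\<close> of \<open>y\<close>.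
\<close>

lemma finite_rank_partial_bounded:
  assumes P: "\<And>i. i < n \<Longrightarrow> finite_rank (X i) (P i)" and B: "multilinear_map n X scalars B"
    and "m \<le> n" "y \<in> tuples n X"
  shows "\<exists>M\<ge>0. \<forall>x\<in>tuples n X. norm (B (partial_apply P m x y)) \<le> M * (\<Prod>i<m. nrm (X i) (x i))"
  using assms(3,4)
proof (induction m arbitrary: y)
  case 0
  then show ?case by (intro exI[of _ "norm (B y)"]) (simp add: partial_apply_def)
next
  case (Suc m)
  then have m: "m < n" "m \<le> n" by auto
  interpret N: nspace "X m" by (rule nspaces) fact
  have T: "partial_apply P m x y \<in> tuples n X" if "x \<in> tuples n X" "y \<in> tuples n X" for x y
    using partial_apply_tuples[OF P m(2) that] .
  have *: "\<exists>M\<ge>0. \<forall>x\<in>tuples n X. norm (B ((partial_apply P m x y)(m := Q (x m)))) \<le> M * (\<Prod>i<Suc m. nrm (X i) (x i))"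
    if "finite_rank (X m) Q" for Q
    using that
  proof induction
    case zero
    have "B ((partial_apply P m x y)(m := \<zero>\<^bsub>X m\<^esub>)) = 0" if "x \<in> tuples n X" for x
      using multilinear_upd_zero[OF B vspace_scalars T[OF that Suc.prems(2)] m(1)] by simp
    then show ?case by (intro exI[of _ 0]) (simp del: fun_upd_apply)
  next
    case (step Q f e)
    obtain M where M: "0 \<le> M" "\<And>x. x \<in> tuples n X \<Longrightarrow>
        norm (B ((partial_apply P m x y)(m := Q (x m)))) \<le> M * (\<Prod>i<Suc m. nrm (X i) (x i))"
      using step.IH by blast
    obtain K where K: "0 \<le> K" "\<And>z. z \<in> carrier (X m) \<Longrightarrow> norm (f z) \<le> K * nrm (X m) z"
      using N.bounded_linear_map_bound[OF step.hyps(2)] by auto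
    obtain L where L: "0 \<le> L" "\<And>x. x \<in> tuples n X \<Longrightarrow>
        norm (B (partial_apply P m x (y(m := e)))) \<le> L * (\<Prod>i<m. nrm (X i) (x i))"
      using Suc.IH[OF m(2) tuples_upd[OF Suc.prems(2) m(1) step.hyps(3)]] by blast
    have "norm (B ((partial_apply P m x y)(m := Q (x m) \<oplus>\<^bsub>X m\<^esub> f (x m) \<odot>\<^bsub>X m\<^esub> e)))
        \<le> (M + K * L) * (\<Prod>i<Suc m. nrm (X i) (x i))" if x: "x \<in> tuples n X" for x
    proof -
      let ?t = "partial_apply P m x y"
      have t: "?t \<in> tuples n X" using T x Suc.prems(2) by blast
      have xm: "x m \<in> carrier (X m)" using tuples_mem[OF x m(1)] .
      have Qx: "Q (x m) \<in> carrier (X m)" using finite_rank_closed[OF m(1) step.hyps(1) xm] .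
      have upd: "?t(m := e) = partial_apply P m x (y(m := e))" by (auto simp: partial_apply_def)
      have eq: "B (?t(m := Q (x m) \<oplus>\<^bsub>X m\<^esub> f (x m) \<odot>\<^bsub>X m\<^esub> e)) = B (?t(m := Q (x m))) + f (x m) * B (?t(m := e))"
        using multilinear_mapD(2)[OF B t m(1) Qx N.smult_closed[OF step.hyps(3)]]
          multilinear_mapD(3)[OF B t m(1) step.hyps(3)] by simp
      have "norm (B (?t(m := Q (x m) \<oplus>\<^bsub>X m\<^esub> f (x m) \<odot>\<^bsub>X m\<^esub> e)))
          \<le> norm (B (?t(m := Q (x m)))) + norm (f (x m)) * norm (B (?t(m := e)))"
        unfolding eq by (rule order_trans[OF norm_triangle_ineq]) (simp add: norm_mult)
      also have "\<dots> \<le> M * (\<Prod>i<Suc m. nrm (X i) (x i)) + (K * nrm (X m) (x m)) * (L * (\<Prod>i<m. nrm (X i) (x i)))"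
        unfolding upd
        by (rule add_mono[OF M(2)[OF x] mult_mono[OF K(2)[OF xm] L(2)[OF x]
              mult_nonneg_nonneg[OF K(1) N.nrm_nonneg[OF xm]] norm_ge_zero]])
      also have "\<dots> = (M + K * L) * (\<Prod>i<Suc m. nrm (X i) (x i))" by (simp add: algebra_simps)
      finally show ?thesis .
    qed
    then show ?case using M(1) K(1) L(1)
      by (intro exI[of _ "M + K * L"] conjI ballI) (simp_all del: fun_upd_apply)
  qed
  have "partial_apply P (Suc m) x y = (partial_apply P m x y)(m := P m (x m))" for x
    by (auto simp: partial_apply_def less_Suc_eq)
  then show ?case using *[OF P[OF m(1)]] by (simp del: fun_upd_apply prod.lessThan_Suc)
qed

text \<open>
  Choose in each \<open>X i\<close> a finite rank operator that fixes the \<open>i\<close>-th entries of the finitely many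
  tuples in a representation of \<open>w\<close>. Composing \<open>B\<close> with these operators does not change its values
  on these tuples, and it makes \<open>B\<close> bounded.
\<close>

lemma bounded_forms_separate:
  assumes w: "w \<in> carrier (multi_tensor_space n X)" and B: "multilinear_map n X scalars B"
  shows "\<exists>B'. bounded_multilinear_map n X scalars B' \<and> w B' = w B"
proof -
  let ?F = "{B. multilinear_map n X scalars B} :: ((nat \<Rightarrow> 'x) \<Rightarrow> 'k) set"
  obtain m c t where w: "w = (\<lambda>B. \<Sum>j<m. c j * evaluation ?F (t j) B)" "\<forall>j<(m::nat). t j \<in> tuples n X"
    using w unfolding multi_tensor_space_def evaluation_span_def by auto
  have "\<exists>P. finite_rank (X i) P \<and> (\<forall>x\<in>(\<lambda>j. t j i) ` {..<m}. P x = x)" if "i < n" for i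
    using that w(2) by (intro nspace.finite_rank_identity_on nspaces) (auto intro: tuples_mem)
  then obtain P where P: "\<And>i. i < n \<Longrightarrow> finite_rank (X i) (P i)" "\<And>i j. i < n \<Longrightarrow> j < m \<Longrightarrow> P i (t j i) = t j i"
    by (metis (no_types, lifting) image_eqI lessThan_iff)
  define B' where "B' x = B (partial_apply P n x (\<lambda>_. undefined))" for x
  \<comment> \<open>Tuples are extensional, hence \<open>undefined\<close> from the index \<open>n\<close> on.\<close>
  have und: "partial_apply P n x (\<lambda>_. undefined) = partial_apply P n x x" if "x \<in> tuples n X" for x
    using that by (auto simp: partial_apply_def tuples_def PiE_def extensional_def)
  have T: "partial_apply P n x (\<lambda>_. undefined) \<in> tuples n X" if "x \<in> tuples n X" for x
    unfolding und[OF that] using partial_apply_tuples[OF P(1) _ that that] by simp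
  have upd: "partial_apply P n (x(i := y)) (\<lambda>_. undefined) = (partial_apply P n x (\<lambda>_. undefined))(i := P i y)"
    if "i < n" for i x y using that by (auto simp: partial_apply_def)
  have "multilinear_map n X scalars B'"
    unfolding multilinear_map_def
  proof (intro conjI ballI allI impI)
    fix x i y z assume *: "x \<in> tuples n X" "i < n" "y \<in> carrier (X i)" "z \<in> carrier (X i)"
    have "P i (y \<oplus>\<^bsub>X i\<^esub> z) = P i y \<oplus>\<^bsub>X i\<^esub> P i z"
      using nspace.finite_rank_bounded_linear[OF nspaces P(1)] * by (auto simp: bounded_linear_map_def linear_map_def)
    then show "B' (x(i := y \<oplus>\<^bsub>X i\<^esub> z)) = B' (x(i := y)) \<oplus>\<^bsub>scalars\<^esub> B' (x(i := z))"
      using multilinear_mapD(2)[OF B T] * finite_rank_closed P(1) by (simp add: B'_def upd)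
  next
    fix x i a y assume *: "x \<in> tuples n X" "i < n" "y \<in> carrier (X i)"
    have "P i (a \<odot>\<^bsub>X i\<^esub> y) = a \<odot>\<^bsub>X i\<^esub> P i y"
      using nspace.finite_rank_bounded_linear[OF nspaces P(1)] * by (auto simp: bounded_linear_map_def linear_map_def)
    then show "B' (x(i := a \<odot>\<^bsub>X i\<^esub> y)) = a \<odot>\<^bsub>scalars\<^esub> B' (x(i := y))"
      using multilinear_mapD(3)[OF B T] * finite_rank_closed P(1) by (simp add: B'_def upd)
  qed simp
  moreover have "\<exists>M. \<forall>x\<in>tuples n X. nrm scalars (B' x) \<le> M * (\<Prod>i<n. nrm (X i) (x i))"
  proof (cases "tuples n X = {}")
    case False
    then obtain y where y: "y \<in> tuples n X" by blast
    have "partial_apply P n x y = partial_apply P n x (\<lambda>_. undefined)" for x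
      using y by (auto simp: partial_apply_def tuples_def PiE_def extensional_def)
    then show ?thesis using finite_rank_partial_bounded[OF P(1) B order_refl y] by (auto simp: B'_def)
  qed auto
  ultimately have bB': "bounded_multilinear_map n X scalars B'" by (simp add: bounded_multilinear_map_def)
  have "B' (t j) = B (t j)" if "j < m" for j
  proof -
    have "t j \<in> tuples n X" using w(2) that by blast
    then have "partial_apply P n (t j) (\<lambda>_. undefined) = t j"
      using P(2) that by (auto simp: partial_apply_def tuples_def PiE_def extensional_def)
    then show ?thesis by (simp add: B'_def)
  qed
  then have "w B' = w B"
    unfolding w(1) using B \<open>multilinear_map n X scalars B'\<close> by (intro sum.cong) (auto simp: evaluation_def)
  then show ?thesis using bB' by blast
qed

section \<open>The projective norm\<close>

text \<open>
  The numbers of which the projective norm of \<open>w\<close> is the infimum.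
\<close>

definition costs :: "('k, 'x) tensors \<Rightarrow> real set" where
  "costs w = {(\<Sum>j<m. \<Prod>i<n. nrm (X i) (x j i)) | (m::nat) x.
            (\<forall>j<m. x j \<in> tuples n X) \<and> w = (\<lambda>B. \<Sum>j<m. elt (x j) B)}"

lemma projective_norm_costs: "projective_norm n X w = Inf (costs w)"
  by (simp add: projective_norm_def costs_def)

lemma costsI:
  "(\<And>j. j < m \<Longrightarrow> x j \<in> tuples n X) \<Longrightarrow> w = (\<lambda>B. \<Sum>j<(m::nat). elt (x j) B) \<Longrightarrow>
     v = (\<Sum>j<m. \<Prod>i<n. nrm (X i) (x j i)) \<Longrightarrow> v \<in> costs w"
  unfolding costs_def by blast

lemma costsE:
  assumes "v \<in> costs w"
  obtains m :: nat and x where "\<And>j. j < m \<Longrightarrow> x j \<in> tuples n X"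
    "w = (\<lambda>B. \<Sum>j<m. elt (x j) B)" "v = (\<Sum>j<m. \<Prod>i<n. nrm (X i) (x j i))"
  using assms unfolding costs_def by blast

lemma costs_nonneg: "v \<in> costs w \<Longrightarrow> 0 \<le> v"
  by (erule costsE) (auto intro!: sum_nonneg prod_nonneg)

lemma costs_zero: "0 \<in> costs (\<lambda>_. 0)"
  by (rule costsI[of 0]) simp_all

lemma costs_elem:
  assumes "t \<in> tuples n X"
  shows "(\<Prod>i<n. nrm (X i) (t i)) \<in> costs (elt t)"
  using assms by (intro costsI[of 1 "\<lambda>_. t"]) simp_all

lemma sum_append:
  fixes f g :: "nat \<Rightarrow> 'b::comm_monoid_add"
  shows "(\<Sum>j<m + k. if j < m then f j else g (j - m)) = (\<Sum>j<m. f j) + (\<Sum>j<k. g j)"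
  by (induction k) (simp_all add: add.assoc)

lemma costs_add:
  assumes "v \<in> costs w" "v' \<in> costs w'"
  shows "v + v' \<in> costs (\<lambda>B. w B + w' B)"
proof -
  obtain m x where 1: "\<And>j. j<(m::nat) \<Longrightarrow> x j \<in> tuples n X" "w = (\<lambda>B. \<Sum>j<m. elt (x j) B)"
    "v = (\<Sum>j<m. \<Prod>i<n. nrm (X i) (x j i))" using costsE[OF assms(1)] by blast
  obtain k y where 2: "\<And>j. j<(k::nat) \<Longrightarrow> y j \<in> tuples n X" "w' = (\<lambda>B. \<Sum>j<k. elt (y j) B)"
    "v' = (\<Sum>j<k. \<Prod>i<n. nrm (X i) (y j i))" using costsE[OF assms(2)] by blast
  define z where "z j = (if j < m then x j else y (j - m))" for j
  have s: "(\<Sum>j<m + k. f (z j)) = (\<Sum>j<m. f (x j)) + (\<Sum>j<k. f (y j))" for f :: "(nat \<Rightarrow> 'x) \<Rightarrow> 'b::comm_monoid_add"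
    unfolding sum_append[symmetric] by (intro sum.cong) (auto simp: z_def)
  have zt: "z j \<in> tuples n X" if "j < m + k" for j using 1(1) 2(1) that by (simp add: z_def)
  have "(\<lambda>B. w B + w' B) = (\<lambda>B. \<Sum>j<m + k. elt (z j) B)"
    unfolding 1(2) 2(2) by (rule ext) (rule s[symmetric])
  moreover have "v + v' = (\<Sum>j<m + k. \<Prod>i<n. nrm (X i) (z j i))"
    unfolding 1(3) 2(3) using s[of "\<lambda>t. \<Prod>i<n. nrm (X i) (t i)"] by simp
  ultimately show ?thesis by (intro costsI[OF zt])
qed

lemma elem_tensor_upd:
  assumes "x \<in> tuples n X" "i < n"
  shows "y \<in> carrier (X i) \<Longrightarrow> elt (x(i := a \<odot>\<^bsub>X i\<^esub> y)) = (\<lambda>B. a * elt (x(i := y)) B)"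
    and "y \<in> carrier (X i) \<Longrightarrow> z \<in> carrier (X i) \<Longrightarrow> elt (x(i := y \<oplus>\<^bsub>X i\<^esub> z)) =
       (\<lambda>B. elt (x(i := y)) B + elt (x(i := z)) B)"
  using assms multilinear_mapD(2,3)[of n X "scalars :: ('k, 'k) normed_module"]
  by (auto simp: elem_tensor_def evaluation_def)

text \<open>
  A representation consists of elementary tensors without coefficients. The factor \<open>a\<close> is absorbed
  into the entry \<open>0\<close>, which exists because there is at least one space.
\<close>

lemma costs_smult:
  assumes "v \<in> costs w"
  shows "norm a * v \<in> costs (\<lambda>B. a * w B)"
proof -
  obtain m x where 1: "\<And>j. j<(m::nat) \<Longrightarrow> x j \<in> tuples n X" "w = (\<lambda>B. \<Sum>j<m. elt (x j) B)"
    "v = (\<Sum>j<m. \<Prod>i<n. nrm (X i) (x j i))" using costsE[OF assms] by blast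
  have n0: "0 < n" using n_pos by simp
  define y where "y j = (x j)(0 := a \<odot>\<^bsub>X 0\<^esub> x j 0)" for j
  interpret N: nspace "X 0" by (rule nspaces[OF n0])
  have xj: "x j 0 \<in> carrier (X 0)" if "j < m" for j using tuples_mem[OF 1(1)[OF that] n0] .
  have yt: "y j \<in> tuples n X" if "j < m" for j
    unfolding y_def using that by (intro tuples_upd 1(1) n0 N.smult_closed xj)
  have "(\<lambda>B. a * w B) = (\<lambda>B. \<Sum>j<m. elt (y j) B)"
    unfolding 1(2) sum_distrib_left y_def
    using elem_tensor_upd(1)[OF 1(1) n0 xj] by (intro ext sum.cong) simp_all
  moreover have "(\<Prod>i<n. nrm (X i) (y j i)) = norm a * (\<Prod>i<n. nrm (X i) (x j i))" if "j < m" for j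
  proof -
    have "(\<Prod>i<n. nrm (X i) (y j i)) = nrm (X 0) (y j 0) * (\<Prod>i\<in>{..<n} - {0}. nrm (X i) (y j i))"
      using n0 by (intro prod.remove) auto
    also have "(\<Prod>i\<in>{..<n} - {0}. nrm (X i) (y j i)) = (\<Prod>i\<in>{..<n} - {0}. nrm (X i) (x j i))"
      by (intro prod.cong) (auto simp: y_def)
    also have "nrm (X 0) (y j 0) = norm a * nrm (X 0) (x j 0)"
      using xj[OF that] by (simp add: y_def N.nrm_smult)
    also have "norm a * nrm (X 0) (x j 0) * (\<Prod>i\<in>{..<n} - {0}. nrm (X i) (x j i)) =
        norm a * (\<Prod>i<n. nrm (X i) (x j i))"
      using n0 by (subst (2) prod.remove[of _ 0]) simp_all
    finally show ?thesis .
  qed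
  then have "norm a * v = (\<Sum>j<m. \<Prod>i<n. nrm (X i) (y j i))" unfolding 1(3) sum_distrib_left by simp
  ultimately show ?thesis by (intro costsI[OF yt])
qed

lemma costs_nonempty:
  assumes "w \<in> carrier (multi_tensor_space n X)" shows "costs w \<noteq> {}"
  using assms unfolding multi_tensor_space_def
proof (induction rule: evaluation_span_induct)
  case zero then show ?case using costs_zero by blast
next
  case (step w c t)
  then obtain v where "v \<in> costs w" by blast
  from costs_add[OF this costs_smult[OF costs_elem[OF step.hyps(2)], of c]]
  show ?case by (auto simp: elem_tensor_def)
qed

lemma projective_norm_le: "v \<in> costs w \<Longrightarrow> projective_norm n X w \<le> v"
  unfolding projective_norm_costs using costs_nonneg by (auto intro!: cInf_lower bdd_belowI)

lemma projective_norm_ge: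
  "w \<in> carrier (multi_tensor_space n X) \<Longrightarrow> (\<And>v. v \<in> costs w \<Longrightarrow> c \<le> v) \<Longrightarrow> c \<le> projective_norm n X w"
  unfolding projective_norm_costs using costs_nonempty by (auto intro!: cInf_greatest)

lemma projective_norm_nonneg: "w \<in> carrier (multi_tensor_space n X) \<Longrightarrow> 0 \<le> projective_norm n X w"
  by (rule projective_norm_ge) (auto intro: costs_nonneg)

lemma multi_tensor_space_simps [simp]:
  "zero (multi_tensor_space n X) = (\<lambda>_. 0)" "add (multi_tensor_space n X) = (\<lambda>u v B. u B + v B)"
  "smult (multi_tensor_space n X) = (\<lambda>a u B. a * u B)"
  by (simp_all add: multi_tensor_space_def)

lemma multi_tensor_space_vspace: "vspace (multi_tensor_space n X)"
  unfolding multi_tensor_space_def by (rule evaluation_span_vspace)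

lemma elem_tensor_mem: "t \<in> tuples n X \<Longrightarrow> elt t \<in> carrier (multi_tensor_space n X)"
  unfolding multi_tensor_space_def elem_tensor_def by (rule evaluation_span_evaluation)

text \<open>
  Every representation of \<open>w\<close> as a sum of elementary tensors gives a bound for \<open>L w\<close>, and the
  infimum of these bounds is the projective norm.
\<close>

lemma projective_norm_linear:
  assumes W: "nspace W" and L: "linear_map (multi_tensor_space n X) W L"
    and M: "0 \<le> M" "\<And>x. x \<in> tuples n X \<Longrightarrow> nrm W (L (elt x)) \<le> M * (\<Prod>i<n. nrm (X i) (x i))"
    and w: "w \<in> carrier (multi_tensor_space n X)"
  shows "nrm W (L w) \<le> M * projective_norm n X w"
proof -
  interpret W: nspace W by (rule W)
  interpret E: vspace "multi_tensor_space n X" by (rule multi_tensor_space_vspace)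
  have *: "nrm W (L w) \<le> M * v" if v: "v \<in> costs w" for v
  proof -
    obtain m x where 1: "\<And>j. j<(m::nat) \<Longrightarrow> x j \<in> tuples n X" "w = (\<lambda>B. \<Sum>j<m. elt (x j) B)"
      "v = (\<Sum>j<m. \<Prod>i<n. nrm (X i) (x j i))" using costsE[OF v] by blast
    have "(\<lambda>B. \<Sum>j<k. elt (x j) B) \<in> carrier (multi_tensor_space n X) \<and>
      nrm W (L (\<lambda>B. \<Sum>j<k. elt (x j) B)) \<le> M * (\<Sum>j<k. \<Prod>i<n. nrm (X i) (x j i))"
      if "k \<le> m" for k
      using that
    proof (induction k)
      case 0
      then show ?case using E.linear_map_zero[OF L W.vspace_axioms] E.M.M.zero_closed by simp
    next
      case (Suc k)
      let ?w = "\<lambda>B. \<Sum>j<k. elt (x j) B"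
      have IH: "?w \<in> carrier (multi_tensor_space n X)"
        "nrm W (L ?w) \<le> M * (\<Sum>j<k. \<Prod>i<n. nrm (X i) (x j i))" using Suc by auto
      have xk: "x k \<in> tuples n X" using 1(1) Suc.prems by simp
      note ek = elem_tensor_mem[OF xk]
      have "(\<lambda>B. ?w B + elt (x k) B) \<in> carrier (multi_tensor_space n X)"
        using E.M.M.a_closed[OF IH(1) ek] by simp
      moreover have "L (\<lambda>B. ?w B + elt (x k) B) = L ?w \<oplus>\<^bsub>W\<^esub> L (elt (x k))"
        using L IH(1) ek by (simp add: linear_map_def)
      moreover have "nrm W (L ?w \<oplus>\<^bsub>W\<^esub> L (elt (x k))) \<le> nrm W (L ?w) + nrm W (L (elt (x k)))"
        using L IH(1) ek by (intro W.nrm_triangle) (auto simp: linear_map_def)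
      ultimately show ?case using IH(2) M(2)[OF xk] by (simp add: distrib_left)
    qed
    then show ?thesis unfolding 1(2,3) by blast
  qed
  show ?thesis
  proof (cases "M = 0")
    case True
    then show ?thesis using * costs_nonempty[OF w] by auto
  next
    case False
    then have "nrm W (L w) / M \<le> projective_norm n X w"
      using * M(1) by (intro projective_norm_ge[OF w]) (simp add: field_simps)
    then show ?thesis using False M(1) by (simp add: field_simps)
  qed
qed

abbreviation "PA \<equiv> projective_tensor_algebraic n X"

lemma PA_simps [simp]:
  "carrier PA = carrier (multi_tensor_space n X)"
  "zero PA = (\<lambda>_. 0)" "add PA = (\<lambda>u v B. u B + v B)" "smult PA = (\<lambda>a u B. a * u B)"
  "nrm PA = projective_norm n X"
  by (simp_all add: projective_tensor_algebraic_def multi_tensor_space_def evaluation_span_def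
     module.extend_def normed_module.fields_def)

text \<open>
  Definiteness is the only axiom with substance: a bounded form vanishes at every tensor of
  projective norm \<open>0\<close>, and the bounded forms separate the tensors.
\<close>

lemma nspace_PA: "nspace PA"
proof (rule nspace.intro, unfold is_normed_space_def, intro conjI ballI allI)
  note carrier_def = multi_tensor_space_def
  have "vspace PA"
    by (rule pointwise_vspace[OF vspace_scalars])
      (simp_all add: carrier_def evaluation_span_zero evaluation_span_add evaluation_span_smult)
  then show "Module.module (scalars :: ('k, 'k) normed_module) PA" by (simp add: vspace_def)
  show "0 \<le> nrm PA w" if "w \<in> carrier PA" for w using projective_norm_nonneg that by simp
  have zero: "projective_norm n X (\<lambda>_. 0) \<le> 0" by (rule projective_norm_le[OF costs_zero])
  show "nrm PA w = 0 \<longleftrightarrow> w = \<zero>\<^bsub>PA\<^esub>" if w: "w \<in> carrier PA" for w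
  proof
    assume 0: "nrm PA w = 0"
    have "w B = 0" for B
    proof (cases "multilinear_map n X scalars B")
      case True
      then obtain B' where B': "bounded_multilinear_map n X scalars B'" "w B' = w B"
        using bounded_forms_separate[of w B] w by auto
      then obtain M where M: "\<And>x. x \<in> tuples n X \<Longrightarrow> norm (B' x) \<le> M * (\<Prod>i<n. nrm (X i) (x i))"
        by (auto simp: bounded_multilinear_map_def)
      have "norm (B' x) \<le> \<bar>M\<bar> * (\<Prod>i<n. nrm (X i) (x i))" if "x \<in> tuples n X" for x
        by (rule order_trans[OF M[OF that]]) (intro mult_right_mono abs_ge_self prod_nonneg[OF that] order_refl)
      then have "norm (w B') \<le> \<bar>M\<bar> * projective_norm n X w"
        using projective_norm_linear[OF nspace_scalars, of "\<lambda>w. w B'" "\<bar>M\<bar>" w] w B'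
        by (simp add: linear_map_def bounded_multilinear_map_def elem_tensor_def evaluation_def)
      then show ?thesis using 0 B' by simp
    next
      case False
      then show ?thesis using w by (auto simp: multi_tensor_space_def evaluation_span_def evaluation_def)
    qed
    then show "w = \<zero>\<^bsub>PA\<^esub>" by auto
  next
    assume "w = \<zero>\<^bsub>PA\<^esub>"
    then show "nrm PA w = 0" using zero projective_norm_nonneg[of w] w by simp
  qed
  have le: "projective_norm n X (\<lambda>B. a * w B) \<le> norm a * projective_norm n X w"
    if w: "w \<in> carrier (multi_tensor_space n X)" for a w
  proof (cases "a = 0")
    case True
    then show ?thesis using zero by simp
  next
    case False
    then have "projective_norm n X (\<lambda>B. a * w B) / norm a \<le> projective_norm n X w"
      using costs_smult projective_norm_le by (intro projective_norm_ge[OF w]) (simp add: field_simps)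
    then show ?thesis using False by (simp add: field_simps)
  qed
  show "nrm PA (a \<odot>\<^bsub>PA\<^esub> w) = norm a * nrm PA w" if "w \<in> carrier PA" for a w
  proof (rule antisym)
    have w: "w \<in> carrier (multi_tensor_space n X)" using that by simp
    show "nrm PA (a \<odot>\<^bsub>PA\<^esub> w) \<le> norm a * nrm PA w" using le[OF w] by simp
    have aw: "(\<lambda>B. a * w B) \<in> carrier (multi_tensor_space n X)"
      using w by (simp add: carrier_def evaluation_span_smult)
    show "norm a * nrm PA w \<le> nrm PA (a \<odot>\<^bsub>PA\<^esub> w)"
    proof (cases "a = 0")
      case True
      then show ?thesis using projective_norm_nonneg[OF aw] by simp
    next
      case False
      have "projective_norm n X (\<lambda>B. inverse a * (a * w B)) \<le> norm (inverse a) * projective_norm n X (\<lambda>B. a * w B)"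
        by (rule le[OF aw])
      moreover have "(\<lambda>B. inverse a * (a * w B)) = w" using False by (auto simp flip: mult.assoc)
      ultimately have "projective_norm n X w \<le> inverse (norm a) * projective_norm n X (\<lambda>B. a * w B)"
        by (simp add: norm_inverse)
      from mult_left_mono[OF this norm_ge_zero[of a]] False show ?thesis
        by (simp add: mult.assoc[symmetric])
    qed
  qed
  show "nrm PA (u \<oplus>\<^bsub>PA\<^esub> w) \<le> nrm PA u + nrm PA w" if "u \<in> carrier PA" "w \<in> carrier PA" for u w
  proof -
    have uw: "u \<in> carrier (multi_tensor_space n X)" "w \<in> carrier (multi_tensor_space n X)" using that by auto
    have "projective_norm n X (\<lambda>B. u B + w B) - projective_norm n X w \<le> projective_norm n X u"
    proof (rule projective_norm_ge[OF uw(1)])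
      fix v assume v: "v \<in> costs u"
      have "projective_norm n X (\<lambda>B. u B + w B) - v \<le> projective_norm n X w"
      proof (rule projective_norm_ge[OF uw(2)])
        fix v' assume "v' \<in> costs w"
        then show "projective_norm n X (\<lambda>B. u B + w B) - v \<le> v'"
          using projective_norm_le[OF costs_add[OF v]] by (simp add: diff_le_eq add.commute[of v'])
      qed
      then show "projective_norm n X (\<lambda>B. u B + w B) - projective_norm n X w \<le> v" by simp
    qed
    then show ?thesis by simp
  qed
qed

end

section \<open>Convergence in normed spaces\<close>

context nspace begin

lemma add_minus_add:
  assumes "x \<in> carrier V" "y \<in> carrier V" "x' \<in> carrier V" "y' \<in> carrier V"
  shows "(x \<oplus> y) \<ominus> (x' \<oplus> y') = (x \<ominus> x') \<oplus> (y \<ominus> y')"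
  using assms by (simp add: minus_eq_smult smult_r_distr M.M.a_ac)

lemma nrm_minus_commute: "x \<in> carrier V \<Longrightarrow> y \<in> carrier V \<Longrightarrow> nrm V (x \<ominus> y) = nrm V (y \<ominus> x)"
  using D.commute[of x y] by (simp add: ndist_eq)

lemma nrm_diff_le:
  assumes "x \<in> carrier V" "y \<in> carrier V"
  shows "\<bar>nrm V x - nrm V y\<bar> \<le> nrm V (x \<ominus> y)"
proof -
  have *: "nrm V u \<le> nrm V (u \<ominus> v) + nrm V v" if "u \<in> carrier V" "v \<in> carrier V" for u v
    using nrm_triangle[of "u \<ominus> v" v] that by (simp add: M.M.minus_eq M.M.a_assoc M.M.l_neg)
  show ?thesis
    using *[OF assms] *[OF assms(2,1)] nrm_minus_commute[OF assms] by linarith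
qed

definition null_seq :: "(nat \<Rightarrow> 'v) \<Rightarrow> bool" where
  "null_seq t \<longleftrightarrow> (\<forall>m. t m \<in> carrier V) \<and> (\<lambda>m. nrm V (t m)) \<longlonglongrightarrow> 0"

lemma null_seq_bound:
  assumes "\<And>m. t m \<in> carrier V" "\<And>m. nrm V (t m) \<le> b m" "b \<longlonglongrightarrow> 0"
  shows "null_seq t"
  unfolding null_seq_def
proof (intro conjI allI assms(1))
  show "(\<lambda>m. nrm V (t m)) \<longlonglongrightarrow> 0"
    by (rule tendsto_sandwich[OF _ _ tendsto_const assms(3)]) (simp_all add: assms(1,2))
qed

lemma null_seq_add:
  assumes "null_seq s" "null_seq t" shows "null_seq (\<lambda>m. s m \<oplus> t m)"
proof (rule null_seq_bound)
  show "(\<lambda>m. nrm V (s m) + nrm V (t m)) \<longlonglongrightarrow> 0"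
    using assms by (intro tendsto_add_zero) (simp_all add: null_seq_def)
qed (use assms in \<open>simp_all add: null_seq_def nrm_triangle\<close>)

lemma null_seq_smult: assumes "null_seq s" shows "null_seq (\<lambda>m. a \<odot> s m)"
proof (rule null_seq_bound)
  show "(\<lambda>m. norm a * nrm V (s m)) \<longlonglongrightarrow> 0"
    using assms by (intro tendsto_mult_right_zero) (simp add: null_seq_def)
qed (use assms in \<open>simp_all add: null_seq_def nrm_smult\<close>)

lemma null_seq_const: "null_seq (\<lambda>_. v) \<longleftrightarrow> v = \<zero>"
  unfolding null_seq_def using nrm_eq_0[of v] by (auto simp: LIMSEQ_const_iff)

definition converges :: "(nat \<Rightarrow> 'v) \<Rightarrow> 'v \<Rightarrow> bool" where
  "converges t y \<longleftrightarrow> y \<in> carrier V \<and> (\<forall>m. t m \<in> carrier V) \<and> null_seq (\<lambda>m. t m \<ominus> y)"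

lemma converges_add: "converges s x \<Longrightarrow> converges t y \<Longrightarrow> converges (\<lambda>m. s m \<oplus> t m) (x \<oplus> y)"
  using null_seq_add[of "\<lambda>m. s m \<ominus> x" "\<lambda>m. t m \<ominus> y"] by (simp add: converges_def add_minus_add)

lemma converges_smult: "converges s x \<Longrightarrow> converges (\<lambda>m. a \<odot> s m) (a \<odot> x)"
  using null_seq_smult[of "\<lambda>m. s m \<ominus> x" a] by (simp add: converges_def smult_minus)

lemma converges_const: "x \<in> carrier V \<Longrightarrow> converges (\<lambda>_. x) x"
  by (simp add: converges_def null_seq_const M.M.minus_eq M.M.r_neg)

lemma converges_cong:
  assumes "converges s x" "null_seq (\<lambda>m. t m \<ominus> s m)" "\<And>m. t m \<in> carrier V" shows "converges t x"
proof -
  have "null_seq (\<lambda>m. (t m \<ominus> s m) \<oplus> (s m \<ominus> x))"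
    using assms by (intro null_seq_add) (simp_all add: converges_def)
  moreover have "(t m \<ominus> s m) \<oplus> (s m \<ominus> x) = t m \<ominus> x" for m
    using assms by (intro minus_trans[symmetric]) (simp_all add: converges_def)
  ultimately show ?thesis using assms by (simp add: converges_def)
qed

lemma converges_unique:
  assumes "converges s x" "converges s y" shows "x = y"
proof -
  have "converges (\<lambda>m. s m \<oplus> (-1) \<odot> s m) (x \<oplus> (-1) \<odot> y)"
    by (intro converges_add converges_smult assms)
  moreover have "s m \<oplus> (-1) \<odot> s m = \<zero>" for m
    using assms(1) by (simp add: converges_def M.M.r_neg flip: neg_eq_smult)
  ultimately have "null_seq (\<lambda>_. \<zero> \<ominus> (x \<ominus> y))" using assms by (simp add: converges_def minus_eq_smult)
  then have "\<zero> = x \<ominus> y"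
    using assms minus_eq_0[of \<zero> "x \<ominus> y"] by (simp add: null_seq_const converges_def)
  then show ?thesis using assms minus_eq_0[of x y] by (simp add: converges_def)
qed

lemma converges_nrm:
  assumes "converges s x" shows "(\<lambda>m. nrm V (s m)) \<longlonglongrightarrow> nrm V x"
proof -
  have "(\<lambda>m. nrm V (s m \<ominus> x)) \<longlonglongrightarrow> 0" using assms by (simp add: converges_def null_seq_def)
  then have "(\<lambda>m. nrm V (s m) - nrm V x) \<longlonglongrightarrow> 0"
    by (rule Lim_null_comparison[rotated]) (use assms nrm_diff_le in \<open>simp add: converges_def\<close>)
  then show ?thesis by (rule LIM_zero_cancel)
qed

definition cauchy :: "(nat \<Rightarrow> 'v) \<Rightarrow> bool" where
  "cauchy s \<longleftrightarrow> (\<forall>m. s m \<in> carrier V) \<and> (\<forall>e>0. \<exists>N. \<forall>m\<ge>N. \<forall>k\<ge>N. nrm V (s m \<ominus> s k) < e)"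

lemma MCauchy_iff: "D.MCauchy s \<longleftrightarrow> cauchy s"
  unfolding D.MCauchy_def cauchy_def by (auto simp: ndist_eq image_subset_iff)

lemma cauchy_mem: "cauchy s \<Longrightarrow> s m \<in> carrier V" by (auto simp: cauchy_def)

lemma cauchy_add: assumes "cauchy s" "cauchy t" shows "cauchy (\<lambda>m. s m \<oplus> t m)"
  unfolding cauchy_def
proof (intro conjI allI impI)
  fix e :: real assume "0 < e"
  then have "0 < e / 2" by simp
  obtain N where N: "\<forall>m\<ge>N. \<forall>k\<ge>N. nrm V (s m \<ominus> s k) < e / 2"
    using assms(1) \<open>0 < e / 2\<close> unfolding cauchy_def by blast
  obtain K where K: "\<forall>m\<ge>K. \<forall>k\<ge>K. nrm V (t m \<ominus> t k) < e / 2"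
    using assms(2) \<open>0 < e / 2\<close> unfolding cauchy_def by blast
  have "nrm V ((s m \<oplus> t m) \<ominus> (s k \<oplus> t k)) < e" if "max N K \<le> m" "max N K \<le> k" for m k
    using nrm_triangle[of "s m \<ominus> s k" "t m \<ominus> t k"] N[rule_format, of m k] K[rule_format, of m k] that
    by (simp add: add_minus_add cauchy_mem assms)
  then show "\<exists>N. \<forall>m\<ge>N. \<forall>k\<ge>N. nrm V ((s m \<oplus> t m) \<ominus> (s k \<oplus> t k)) < e" by blast
qed (use assms in \<open>auto simp: cauchy_mem\<close>)

lemma linear_map_cauchy:
  assumes W: "nspace W" and f: "linear_map V W f" "\<And>x. x \<in> carrier V \<Longrightarrow> nrm W (f x) \<le> K * nrm V x" "0 \<le> K"
    and s: "cauchy s"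
  shows "nspace.cauchy W (\<lambda>m. f (s m))"
proof -
  interpret W: nspace W by (rule W)
  have fc: "f x \<in> carrier W" if "x \<in> carrier V" for x using f(1) that by (auto simp: linear_map_def)
  show ?thesis
    unfolding W.cauchy_def
  proof (intro conjI allI impI)
    fix e :: real assume e: "0 < e"
    then have "0 < e / (K + 1)" using f(3) by simp
    then obtain N where N: "\<forall>m\<ge>N. \<forall>k\<ge>N. nrm V (s m \<ominus> s k) < e / (K + 1)"
      using s unfolding cauchy_def by blast
    have "nrm W (f (s m) \<ominus>\<^bsub>W\<^esub> f (s k)) < e" if "N \<le> m" "N \<le> k" for m k
    proof -
      have "nrm W (f (s m) \<ominus>\<^bsub>W\<^esub> f (s k)) = nrm W (f (s m \<ominus> s k))"
        using linear_map_minus[OF f(1)] W.vspace_axioms s by (simp add: cauchy_mem)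
      also have "\<dots> \<le> K * nrm V (s m \<ominus> s k)" using f(2) s by (simp add: cauchy_mem)
      also have "\<dots> \<le> K * (e / (K + 1))" using N that f(3) by (intro mult_left_mono) (auto intro: less_imp_le)
      also have "\<dots> < e" using e f(3) by (simp add: field_simps)
      finally show ?thesis .
    qed
    then show "\<exists>N. \<forall>m\<ge>N. \<forall>k\<ge>N. nrm W (f (s m) \<ominus>\<^bsub>W\<^esub> f (s k)) < e" by blast
  qed (use s fc in \<open>auto simp: cauchy_mem\<close>)
qed

lemma cauchy_smult: assumes "cauchy s" shows "cauchy (\<lambda>m. a \<odot> s m)"
  by (rule linear_map_cauchy[where K = "norm a", OF nspace_axioms _ _ _ assms])
    (auto simp: linear_map_def smult_r_distr nrm_smult mult.commute[of _ a] simp flip: smult_assoc)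

lemma cauchy_const: "v \<in> carrier V \<Longrightarrow> cauchy (\<lambda>_. v)"
  by (simp add: cauchy_def M.M.minus_eq M.M.r_neg)

lemma cauchy_nrm: assumes "cauchy s" shows "convergent (\<lambda>m. nrm V (s m))"
proof -
  have "Cauchy (\<lambda>m. nrm V (s m))"
  proof (rule CauchyI)
    fix e :: real assume "0 < e"
    then obtain N where N: "\<forall>m\<ge>N. \<forall>k\<ge>N. nrm V (s m \<ominus> s k) < e"
      using assms unfolding cauchy_def by blast
    have "norm (nrm V (s m) - nrm V (s k)) < e" if "N \<le> m" "N \<le> k" for m k
      using le_less_trans[OF nrm_diff_le[OF cauchy_mem[OF assms] cauchy_mem[OF assms]]] N that by simp
    then show "\<exists>N. \<forall>m\<ge>N. \<forall>k\<ge>N. norm (nrm V (s m) - nrm V (s k)) < e" by blast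
  qed
  then show ?thesis by (simp add: Cauchy_convergent_iff)
qed

lemma banach_converges:
  assumes "is_banach_space V" "cauchy s" shows "\<exists>x. converges s x"
proof -
  obtain x where "limitin D.mtopology s x sequentially"
    using assms MCauchy_iff unfolding is_banach_space_def D.mcomplete_def by blast
  then have x: "x \<in> carrier V" "\<And>e. 0 < e \<Longrightarrow> \<exists>N. \<forall>m\<ge>N. s m \<in> carrier V \<and> ndist V (s m) x < e"
    by (auto simp: D.limit_metric_sequentially)
  have "(\<lambda>m. nrm V (s m \<ominus> x)) \<longlonglongrightarrow> 0"
  proof (rule LIMSEQ_I)
    fix e :: real assume "0 < e"
    then obtain N where N: "\<forall>m\<ge>N. s m \<in> carrier V \<and> ndist V (s m) x < e" using x(2) by blast
    have "norm (nrm V (s m \<ominus> x) - 0) < e" if m: "m \<ge> N" for m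
    proof -
      have "s m \<in> carrier V" "ndist V (s m) x < e" using N m by auto
      then show ?thesis using x(1) by (simp add: ndist_eq)
    qed
    then show "\<exists>N. \<forall>m\<ge>N. norm (nrm V (s m \<ominus> x) - 0) < e" by blast
  qed
  then show ?thesis using x(1) assms(2)
    by (intro exI[of _ x]) (auto simp: converges_def null_seq_def cauchy_mem)
qed

section \<open>The completion\<close>

abbreviation "C \<equiv> completion V"

definition limit_class :: "(nat \<Rightarrow> 'v) \<Rightarrow> (nat \<Rightarrow> 'v) set" where
  "limit_class s = cauchy_rel V `` {s}"

lemma cauchy_rel_iff: "(s, t) \<in> cauchy_rel V \<longleftrightarrow> cauchy s \<and> cauchy t \<and> null_seq (\<lambda>m. s m \<ominus> t m)"
  unfolding cauchy_rel_def MCauchy_iff null_seq_def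
  by (auto simp: ndist_eq cauchy_mem)

lemma null_seq_swap:
  assumes "null_seq (\<lambda>m. s m \<ominus> t m)" "cauchy s" "cauchy t" shows "null_seq (\<lambda>m. t m \<ominus> s m)"
  using null_seq_smult[OF assms(1), of "-1"] assms(2,3) by (simp add: minus_swap cauchy_mem)

lemma null_seq_trans:
  assumes "null_seq (\<lambda>m. s m \<ominus> t m)" "null_seq (\<lambda>m. t m \<ominus> u m)" "cauchy s" "cauchy t" "cauchy u"
  shows "null_seq (\<lambda>m. s m \<ominus> u m)"
  using null_seq_add[OF assms(1,2)] assms(3-5) by (simp add: cauchy_mem flip: minus_trans)

lemma null_seq_refl: "cauchy s \<Longrightarrow> null_seq (\<lambda>m. s m \<ominus> s m)"
  by (simp add: cauchy_mem M.M.minus_eq M.M.r_neg null_seq_const)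

lemma mem_limit_class: "t \<in> limit_class s \<longleftrightarrow> cauchy s \<and> cauchy t \<and> null_seq (\<lambda>m. s m \<ominus> t m)"
  by (simp add: limit_class_def cauchy_rel_iff)

lemma limit_class_eq_iff:
  assumes "cauchy s" "cauchy t"
  shows "limit_class s = limit_class t \<longleftrightarrow> null_seq (\<lambda>m. s m \<ominus> t m)"
proof
  assume "limit_class s = limit_class t"
  then have "t \<in> limit_class s" using mem_limit_class[of t t] null_seq_refl assms by simp
  then show "null_seq (\<lambda>m. s m \<ominus> t m)" by (simp add: mem_limit_class)
next
  assume "null_seq (\<lambda>m. s m \<ominus> t m)"
  then have st: "null_seq (\<lambda>m. s m \<ominus> t m)" "null_seq (\<lambda>m. t m \<ominus> s m)" using null_seq_swap assms by blast+
  have "u \<in> limit_class s \<longleftrightarrow> u \<in> limit_class t" for u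
    using null_seq_trans[OF st(1) _ assms, of u] null_seq_trans[OF st(2) _ assms(2,1), of u] assms
    by (auto simp: mem_limit_class)
  then show "limit_class s = limit_class t" by blast
qed

lemma carrier_completion: "carrier C = limit_class ` {s. cauchy s}"
  by (auto simp: completion_def quotient_def limit_class_def MCauchy_iff)

lemma completionE: assumes "z \<in> carrier C" obtains s where "cauchy s" "z = limit_class s"
  using assms by (auto simp: carrier_completion)

lemma limit_class_mem [simp]: "cauchy s \<Longrightarrow> limit_class s \<in> carrier C"
  by (auto simp: carrier_completion)

lemma completion_zero: "\<zero>\<^bsub>C\<^esub> = limit_class (\<lambda>_. \<zero>)"
  by (simp add: completion_def limit_class_def)

lemma completion_add:
  assumes "cauchy s" "cauchy t"
  shows "limit_class s \<oplus>\<^bsub>C\<^esub> limit_class t = limit_class (\<lambda>m. s m \<oplus> t m)"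
proof -
  have eq: "limit_class (\<lambda>m. s' m \<oplus> t' m) = limit_class (\<lambda>m. s m \<oplus> t m)" if "s' \<in> limit_class s" "t' \<in> limit_class t" for s' t'
  proof -
    have st: "cauchy s'" "cauchy t'" "null_seq (\<lambda>m. s m \<ominus> s' m)" "null_seq (\<lambda>m. t m \<ominus> t' m)"
      using that by (auto simp: mem_limit_class)
    have "null_seq (\<lambda>m. (s m \<oplus> t m) \<ominus> (s' m \<oplus> t' m))"
      using null_seq_add[OF st(3,4)] assms st(1,2) by (simp add: add_minus_add cauchy_mem)
    then show ?thesis using limit_class_eq_iff[OF cauchy_add[OF assms] cauchy_add[OF st(1,2)]] by simp
  qed
  have "s \<in> limit_class s" "t \<in> limit_class t" using assms by (auto simp: mem_limit_class null_seq_refl)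
  then have ne: "limit_class s \<noteq> {}" "limit_class t \<noteq> {}" by auto
  have "(\<Union>s'\<in>limit_class s. \<Union>t'\<in>limit_class t. limit_class (\<lambda>m. s' m \<oplus> t' m)) = limit_class (\<lambda>m. s m \<oplus> t m)"
    by (rule SUP_eq_const[OF ne(1) SUP_eq_const[OF ne(2) eq]])
  moreover have "limit_class s \<oplus>\<^bsub>C\<^esub> limit_class t = (\<Union>s'\<in>limit_class s. \<Union>t'\<in>limit_class t. limit_class (\<lambda>m. s' m \<oplus> t' m))"
    by (simp add: completion_def limit_class_def)
  ultimately show ?thesis by simp
qed

lemma completion_smult:
  assumes "cauchy s"
  shows "a \<odot>\<^bsub>C\<^esub> limit_class s = limit_class (\<lambda>m. a \<odot> s m)"
proof -
  have eq: "limit_class (\<lambda>m. a \<odot> s' m) = limit_class (\<lambda>m. a \<odot> s m)" if "s' \<in> limit_class s" for s'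
  proof -
    have st: "cauchy s'" "null_seq (\<lambda>m. s m \<ominus> s' m)" using that by (auto simp: mem_limit_class)
    have "null_seq (\<lambda>m. a \<odot> s m \<ominus> a \<odot> s' m)"
      using null_seq_smult[OF st(2), of a] assms st(1) by (simp add: smult_minus cauchy_mem)
    then show ?thesis using limit_class_eq_iff[OF cauchy_smult[OF assms] cauchy_smult[OF st(1)], of a a] by simp
  qed
  have "s \<in> limit_class s" using assms by (auto simp: mem_limit_class null_seq_refl)
  then have ne: "limit_class s \<noteq> {}" by auto
  have "(\<Union>s'\<in>limit_class s. limit_class (\<lambda>m. a \<odot> s' m)) = limit_class (\<lambda>m. a \<odot> s m)"
    by (rule SUP_eq_const[OF ne eq])
  moreover have "a \<odot>\<^bsub>C\<^esub> limit_class s = (\<Union>s'\<in>limit_class s. limit_class (\<lambda>m. a \<odot> s' m))"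
    by (simp add: completion_def limit_class_def)
  ultimately show ?thesis by simp
qed

lemma completion_nrm:
  assumes "cauchy s" shows "(\<lambda>m. nrm V (s m)) \<longlonglongrightarrow> nrm C (limit_class s)"
proof -
  obtain l where l: "(\<lambda>m. nrm V (s m)) \<longlonglongrightarrow> l" using cauchy_nrm[OF assms] by (auto simp: convergent_def)
  have s: "s \<in> limit_class s" using assms by (auto simp: mem_limit_class null_seq_refl)
  have "(\<lambda>m. nrm V (t m)) \<longlonglongrightarrow> l" if "t \<in> limit_class s" for t
  proof -
    have t: "cauchy t" "null_seq (\<lambda>m. s m \<ominus> t m)" using that by (auto simp: mem_limit_class)
    have "(\<lambda>m. nrm V (t m \<ominus> s m)) \<longlonglongrightarrow> 0" using null_seq_swap[OF t(2) assms t(1)] by (simp add: null_seq_def)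
    then have "(\<lambda>m. nrm V (t m) - nrm V (s m)) \<longlonglongrightarrow> 0"
      by (rule Lim_null_comparison[rotated]) (use t(1) assms nrm_diff_le in \<open>simp add: cauchy_mem\<close>)
    from tendsto_add[OF this l] show ?thesis by simp
  qed
  then have "(THE l. \<forall>t\<in>limit_class s. (\<lambda>m. nrm V (t m)) \<longlonglongrightarrow> l) = l"
    using s by (intro the_equality) (auto intro: LIMSEQ_unique)
  then show ?thesis using l by (simp add: completion_def)
qed

lemma completion_nrm_eq: "cauchy s \<Longrightarrow> (\<lambda>m. nrm V (s m)) \<longlonglongrightarrow> l \<Longrightarrow> nrm C (limit_class s) = l"
  using completion_nrm LIMSEQ_unique by blast

lemma nspace_completion: "nspace C"
proof (rule nspace.intro, unfold is_normed_space_def, intro conjI ballI allI)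
  note ops = completion_add completion_smult completion_zero cauchy_add cauchy_smult cauchy_const cauchy_mem
  show "Module.module (scalars :: ('k, 'k) normed_module) C"
  proof (rule moduleI[OF cring_scalars])
    show "abelian_group C"
    proof (rule abelian_groupI)
      fix z assume "z \<in> carrier C"
      then obtain s where s: "cauchy s" "z = limit_class s" by (rule completionE)
      have "(-1) \<odot>\<^bsub>C\<^esub> z \<oplus>\<^bsub>C\<^esub> z = limit_class (\<lambda>m. (-1) \<odot> s m \<oplus> s m)" using s by (simp add: ops)
      also have "\<dots> = \<zero>\<^bsub>C\<^esub>" using s by (simp add: ops M.M.l_neg flip: neg_eq_smult)
      finally show "\<exists>y\<in>carrier C. y \<oplus>\<^bsub>C\<^esub> z = \<zero>\<^bsub>C\<^esub>" using s by (intro bexI[of _ "(-1) \<odot>\<^bsub>C\<^esub> z"]) (simp_all add: ops)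
    qed (auto elim!: completionE simp: ops M.M.a_ac)
  qed (auto elim!: completionE simp: ops smult_l_distr smult_r_distr smult_assoc)
  show "0 \<le> nrm C z" if z: "z \<in> carrier C" for z
  proof -
    obtain s where s: "cauchy s" "z = limit_class s" using z by (rule completionE)
    show ?thesis unfolding s(2) by (rule LIMSEQ_le_const[OF completion_nrm[OF s(1)]]) (auto simp: ops s(1))
  qed
  show "nrm C z = 0 \<longleftrightarrow> z = \<zero>\<^bsub>C\<^esub>" if z: "z \<in> carrier C" for z
  proof -
    obtain s where s: "cauchy s" "z = limit_class s" using z by (rule completionE)
    have "z = \<zero>\<^bsub>C\<^esub> \<longleftrightarrow> null_seq (\<lambda>m. s m \<ominus> \<zero>)" using s by (simp add: completion_zero limit_class_eq_iff cauchy_const)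
    also have "\<dots> \<longleftrightarrow> null_seq s" using s(1) by (simp add: minus_eq_smult cauchy_mem)
    also have "\<dots> \<longleftrightarrow> nrm C z = 0"
      using s completion_nrm[OF s(1)] LIMSEQ_unique by (auto simp: null_seq_def cauchy_mem)
    finally show ?thesis by simp
  qed
  show "nrm C (a \<odot>\<^bsub>C\<^esub> z) = norm a * nrm C z" if z: "z \<in> carrier C" for a z
  proof -
    obtain s where s: "cauchy s" "z = limit_class s" using z by (rule completionE)
    show ?thesis unfolding s(2) completion_smult[OF s(1)]
      using tendsto_mult_left[OF completion_nrm[OF s(1)], of "norm a"] s(1)
      by (intro completion_nrm_eq) (simp_all add: nrm_smult ops)
  qed
  show "nrm C (y \<oplus>\<^bsub>C\<^esub> z) \<le> nrm C y + nrm C z" if y: "y \<in> carrier C" and z: "z \<in> carrier C" for y z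
  proof -
    obtain s where s: "cauchy s" "y = limit_class s" using y by (rule completionE)
    obtain t where t: "cauchy t" "z = limit_class t" using z by (rule completionE)
    show ?thesis unfolding s(2) t(2) completion_add[OF s(1) t(1)]
      by (rule LIMSEQ_le[OF completion_nrm[OF cauchy_add[OF s(1) t(1)]]
         tendsto_add[OF completion_nrm[OF s(1)] completion_nrm[OF t(1)]]])
        (auto intro!: nrm_triangle simp: ops s t)
  qed
qed

lemma to_completion_limit_class: "to_completion V v = limit_class (\<lambda>_. v)"
  by (simp add: to_completion_def limit_class_def)

lemma to_completion_simps:
  "v \<in> carrier V \<Longrightarrow> to_completion V v \<in> carrier C"
  "v \<in> carrier V \<Longrightarrow> w \<in> carrier V \<Longrightarrow> to_completion V (v \<oplus> w) = to_completion V v \<oplus>\<^bsub>C\<^esub> to_completion V w"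
  "v \<in> carrier V \<Longrightarrow> to_completion V (a \<odot> v) = a \<odot>\<^bsub>C\<^esub> to_completion V v"
  "v \<in> carrier V \<Longrightarrow> nrm C (to_completion V v) = nrm V v"
  by (simp_all add: to_completion_limit_class cauchy_const completion_add completion_smult completion_nrm_eq)

lemma to_completion_dense:
  assumes "cauchy s"
  shows "nspace.converges C (\<lambda>m. to_completion V (s m)) (limit_class s)"
proof -
  interpret C: nspace C by (rule nspace_completion)
  have mem: "to_completion V (s m) \<in> carrier C" for m using assms by (simp add: to_completion_simps cauchy_mem)
  have lim: "(\<lambda>k. nrm V (s m \<ominus> s k)) \<longlonglongrightarrow> nrm C (to_completion V (s m) \<ominus>\<^bsub>C\<^esub> limit_class s)" for m
  proof -
    have sm: "s m \<in> carrier V" using assms by (simp add: cauchy_mem)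
    have "to_completion V (s m) \<ominus>\<^bsub>C\<^esub> limit_class s = limit_class (\<lambda>k. s m \<oplus> (-1) \<odot> s k)"
      using assms sm mem[of m] by (simp add: C.minus_eq_smult to_completion_limit_class completion_smult completion_add
         cauchy_smult cauchy_const)
    moreover have "cauchy (\<lambda>k. s m \<oplus> (-1) \<odot> s k)"
      by (intro cauchy_add cauchy_const cauchy_smult sm assms)
    ultimately show ?thesis using completion_nrm[of "\<lambda>k. s m \<oplus> (-1) \<odot> s k"] sm assms
      by (simp add: minus_eq_smult cauchy_mem)
  qed
  have "(\<lambda>m. nrm C (to_completion V (s m) \<ominus>\<^bsub>C\<^esub> limit_class s)) \<longlonglongrightarrow> 0"
  proof (rule LIMSEQ_I)
    fix e :: real assume "0 < e"
    then have "0 < e / 2" by simp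
    then obtain N where N: "\<forall>m\<ge>N. \<forall>k\<ge>N. nrm V (s m \<ominus> s k) < e / 2"
      using assms unfolding cauchy_def by blast
    have "nrm C (to_completion V (s m) \<ominus>\<^bsub>C\<^esub> limit_class s) \<le> e / 2" if "m \<ge> N" for m
    proof (rule LIMSEQ_le_const2[OF lim])
      show "\<exists>K. \<forall>k\<ge>K. nrm V (s m \<ominus> s k) \<le> e / 2"
        using N that less_imp_le by blast
    qed
    then show "\<exists>N. \<forall>m\<ge>N. norm (nrm C (to_completion V (s m) \<ominus>\<^bsub>C\<^esub> limit_class s) - 0) < e"
      using \<open>0 < e\<close> mem assms by (intro exI[of _ N] allI impI) (force simp: le_less_trans)
  qed
  then show ?thesis using mem assms by (auto simp: C.converges_def C.null_seq_def)
qed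

lemma bounded_linear_converges:
  assumes W: "nspace W" and f: "bounded_linear_map V W f" and s: "converges s x"
  shows "nspace.converges W (\<lambda>m. f (s m)) (f x)"
proof -
  interpret W: nspace W by (rule W)
  obtain K where K: "\<And>x. x \<in> carrier V \<Longrightarrow> nrm W (f x) \<le> K * nrm V x"
    using bounded_linear_map_bound[OF f] by blast
  have fl: "linear_map V W f" using f by (simp add: bounded_linear_map_def)
  have fc: "f x \<in> carrier W" if "x \<in> carrier V" for x using fl that by (auto simp: linear_map_def)
  have x: "x \<in> carrier V" "\<And>m. s m \<in> carrier V" "(\<lambda>m. nrm V (s m \<ominus> x)) \<longlonglongrightarrow> 0"
    using s by (auto simp: converges_def null_seq_def)
  have "W.null_seq (\<lambda>m. f (s m) \<ominus>\<^bsub>W\<^esub> f x)"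
  proof (rule W.null_seq_bound)
    show "nrm W (f (s m) \<ominus>\<^bsub>W\<^esub> f x) \<le> K * nrm V (s m \<ominus> x)" for m
      using K[of "s m \<ominus> x"] x linear_map_minus[OF fl W.vspace_axioms] by simp
    show "(\<lambda>m. K * nrm V (s m \<ominus> x)) \<longlonglongrightarrow> 0" using tendsto_mult_right_zero[OF x(3)] .
  qed (use fc x in auto)
  then show ?thesis using fc x by (auto simp: W.converges_def)
qed

text \<open>
  The constant sequences are dense in the completion, since the terms of a Cauchy sequence, seen as
  elements of the completion, converge to its class.
\<close>

lemma completion_bounded_linear_eq:
  assumes W: "nspace W" and f: "bounded_linear_map C W f" and g: "bounded_linear_map C W g"
    and eq: "\<And>v. v \<in> carrier V \<Longrightarrow> f (to_completion V v) = g (to_completion V v)"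
    and z: "z \<in> carrier C"
  shows "f z = g z"
proof -
  interpret W: nspace W by (rule W)
  obtain s where s: "cauchy s" "z = limit_class s" using z by (rule completionE)
  have "W.converges (\<lambda>m. f (to_completion V (s m))) (f z)" "W.converges (\<lambda>m. g (to_completion V (s m))) (g z)"
    using nspace.bounded_linear_converges[OF nspace_completion W f to_completion_dense[OF s(1)]]
      nspace.bounded_linear_converges[OF nspace_completion W g to_completion_dense[OF s(1)]] s(2) by auto
  then show ?thesis using eq[OF cauchy_mem[OF s(1)]] by (intro W.converges_unique) simp_all
qed

text \<open>
  The image of a Cauchy sequence is a Cauchy sequence in a Banach space, and its limit depends only
  on the class of the sequence.
\<close>

lemma completion_extend:
  assumes W: "is_banach_space W" and f: "linear_map V W f"
    and K: "0 \<le> K" "\<And>x. x \<in> carrier V \<Longrightarrow> nrm W (f x) \<le> K * nrm V x"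
  shows "\<exists>S. linear_map C W S \<and> (\<forall>z\<in>carrier C. nrm W (S z) \<le> K * nrm C z) \<and>
     (\<forall>v\<in>carrier V. S (to_completion V v) = f v)"
proof -
  interpret W: nspace W using W by (simp add: nspace_def is_banach_space_def)
  have fc: "f x \<in> carrier W" if "x \<in> carrier V" for x using f that by (auto simp: linear_map_def)
  have ex: "\<exists>y. W.converges (\<lambda>m. f (s m)) y" if "cauchy s" for s
    using W.banach_converges[OF W linear_map_cauchy[OF W.nspace_axioms f K(2,1) that]] .
  have cong: "W.converges (\<lambda>m. f (t m)) y" if y: "W.converges (\<lambda>m. f (s m)) y" and st: "cauchy s" "cauchy t" "limit_class t = limit_class s" for s t y
  proof (rule W.converges_cong[OF y])
    have "null_seq (\<lambda>m. t m \<ominus> s m)" using st by (simp add: limit_class_eq_iff)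
    then show "W.null_seq (\<lambda>m. f (t m) \<ominus>\<^bsub>W\<^esub> f (s m))"
      using fc st(1,2) K(2) linear_map_minus[OF f W.vspace_axioms, symmetric]
      by (intro W.null_seq_bound[where b = "\<lambda>m. K * nrm V (t m \<ominus> s m)"])
        (simp_all add: cauchy_mem null_seq_def tendsto_mult_right_zero)
  qed (use fc st in \<open>auto simp: cauchy_mem\<close>)
  define S where "S z = (SOME y. \<exists>s. cauchy s \<and> z = limit_class s \<and> W.converges (\<lambda>m. f (s m)) y)" for z
  have S: "W.converges (\<lambda>m. f (s m)) (S (limit_class s))" if s: "cauchy s" for s
  proof -
    have "\<exists>y t. cauchy t \<and> limit_class s = limit_class t \<and> W.converges (\<lambda>m. f (t m)) y" using ex[OF s] s by blast
    from someI_ex[OF this] obtain t where "cauchy t" "limit_class s = limit_class t" "W.converges (\<lambda>m. f (t m)) (S (limit_class s))"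
      unfolding S_def by blast
    then show ?thesis using cong s by blast
  qed
  have S_eq: "S (limit_class s) = y" if "cauchy s" "W.converges (\<lambda>m. f (s m)) y" for s y
    using W.converges_unique[OF S[OF that(1)] that(2)] .
  have "linear_map C W S"
    unfolding linear_map_def
  proof (intro conjI ballI allI)
    show "S \<in> carrier C \<rightarrow> carrier W"
      using S by (auto simp: W.converges_def elim!: completionE)
    fix x y assume x: "x \<in> carrier C" and y: "y \<in> carrier C"
    obtain s where s: "cauchy s" "x = limit_class s" using x by (rule completionE)
    obtain t where t: "cauchy t" "y = limit_class t" using y by (rule completionE)
    have "(\<lambda>m. f (s m \<oplus> t m)) = (\<lambda>m. f (s m) \<oplus>\<^bsub>W\<^esub> f (t m))"
      using f s(1) t(1) by (auto simp: linear_map_def cauchy_mem)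
    then show "S (x \<oplus>\<^bsub>C\<^esub> y) = S x \<oplus>\<^bsub>W\<^esub> S y"
      unfolding s(2) t(2) completion_add[OF s(1) t(1)]
      using W.converges_add[OF S[OF s(1)] S[OF t(1)]] by (intro S_eq cauchy_add s t) simp
  next
    fix a x assume x: "x \<in> carrier C"
    obtain s where s: "cauchy s" "x = limit_class s" using x by (rule completionE)
    have "(\<lambda>m. f (a \<odot> s m)) = (\<lambda>m. a \<odot>\<^bsub>W\<^esub> f (s m))"
      using f s(1) by (auto simp: linear_map_def cauchy_mem)
    then show "S (a \<odot>\<^bsub>C\<^esub> x) = a \<odot>\<^bsub>W\<^esub> S x"
      unfolding s(2) completion_smult[OF s(1)]
      using W.converges_smult[OF S[OF s(1)], of a] by (intro S_eq cauchy_smult s) simp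
  qed
  moreover have "nrm W (S z) \<le> K * nrm C z" if z: "z \<in> carrier C" for z
  proof -
    obtain s where s: "cauchy s" "z = limit_class s" using z by (rule completionE)
    show ?thesis unfolding s(2)
      by (rule LIMSEQ_le[OF W.converges_nrm[OF S[OF s(1)]] tendsto_mult_left[OF completion_nrm[OF s(1)]]])
        (use K(2) s(1) in \<open>auto simp: cauchy_mem\<close>)
  qed
  moreover have "S (to_completion V v) = f v" if "v \<in> carrier V" for v
    unfolding to_completion_limit_class using that fc by (intro S_eq cauchy_const W.converges_const)
  ultimately show ?thesis by blast
qed

end

section \<open>Unit balls of duals and of spaces of forms\<close>

text \<open>
  By homogeneity, a bound on the unit ball is a bound by the norm. The hypotheses on
  \<open>nrm\<close> are immediate for $\ell_p$ from the formula for its norm.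
\<close>

lemma dual_ball_iff:
  fixes V :: "('k::real_normed_field, 'v) normed_module"
  assumes V: "vspace V" and nonneg: "\<And>x. x \<in> carrier V \<Longrightarrow> 0 \<le> nrm V x"
    and zero: "nrm V \<zero>\<^bsub>V\<^esub> = 0" "\<And>x. x \<in> carrier V \<Longrightarrow> nrm V x = 0 \<Longrightarrow> x = \<zero>\<^bsub>V\<^esub>"
    and smult: "\<And>a x. x \<in> carrier V \<Longrightarrow> nrm V (a \<odot>\<^bsub>V\<^esub> x) = norm a * nrm V x"
  shows "\<phi> \<in> dual_ball V \<longleftrightarrow> linear_map V scalars \<phi> \<and> (\<forall>x\<in>carrier V. norm (\<phi> x) \<le> nrm V x)"
proof
  interpret V: vspace V by (rule V)
  let ?N = "{norm (\<phi> x) | x. x \<in> carrier V \<and> nrm V x \<le> 1}"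
  assume "\<phi> \<in> dual_ball V"
  then have lin: "linear_map V scalars \<phi>" and sup: "Sup ?N \<le> 1" and
    "\<exists>M. \<forall>x\<in>carrier V. norm (\<phi> x) \<le> M * nrm V x"
    by (simp_all add: dual_ball_def bounded_linear_map_def dual_norm_def)
  then obtain M where M: "\<And>x. x \<in> carrier V \<Longrightarrow> norm (\<phi> x) \<le> M * nrm V x" by blast
  have "y \<le> \<bar>M\<bar>" if y: "y \<in> ?N" for y
  proof -
    obtain x where x: "y = norm (\<phi> x)" "x \<in> carrier V" "nrm V x \<le> 1" using y by blast
    have "norm (\<phi> x) \<le> \<bar>M\<bar> * nrm V x"
      using M[OF x(2)] mult_right_mono[OF abs_ge_self[of M] nonneg[OF x(2)]] by linarith
    also have "\<dots> \<le> \<bar>M\<bar> * 1" using x(3) by (intro mult_left_mono) auto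
    finally show ?thesis using x(1) by simp
  qed
  then have bdd: "bdd_above ?N" by (rule bdd_aboveI)
  have "norm (\<phi> x) \<le> nrm V x" if x: "x \<in> carrier V" for x
  proof (cases "nrm V x = 0")
    case True
    then show ?thesis using zero(2)[OF x] V.linear_map_zero[OF lin vspace_scalars] by simp
  next
    case False
    then have r: "0 < nrm V x" using nonneg[OF x] by simp
    define y where "y = (of_real (1 / nrm V x) :: 'k) \<odot>\<^bsub>V\<^esub> x"
    have y: "y \<in> carrier V" "nrm V y \<le> 1" using x r by (simp_all add: y_def smult norm_divide)
    have "\<phi> y = of_real (1 / nrm V x) * \<phi> x" using lin x by (simp add: linear_map_def y_def)
    then have "norm (\<phi> y) = norm (\<phi> x) / nrm V x" using r by (simp add: norm_mult norm_divide)
    moreover have "norm (\<phi> y) \<in> ?N" using y by blast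
    then have "norm (\<phi> y) \<le> 1" using order_trans[OF cSup_upper[OF _ bdd] sup] by blast
    ultimately have "norm (\<phi> x) / nrm V x \<le> 1" by simp
    then show ?thesis using r by (simp add: field_simps)
  qed
  then show "linear_map V scalars \<phi> \<and> (\<forall>x\<in>carrier V. norm (\<phi> x) \<le> nrm V x)" using lin by blast
next
  interpret V: vspace V by (rule V)
  assume *: "linear_map V scalars \<phi> \<and> (\<forall>x\<in>carrier V. norm (\<phi> x) \<le> nrm V x)"
  have "Sup {norm (\<phi> x) | x. x \<in> carrier V \<and> nrm V x \<le> 1} \<le> 1"
  proof (rule cSup_least)
    show "{norm (\<phi> x) | x. x \<in> carrier V \<and> nrm V x \<le> 1} \<noteq> {}" using V.M.M.zero_closed zero(1) by force
  qed (use * in force)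
  moreover have "bounded_linear_map V scalars \<phi>"
    using * by (intro bounded_linear_mapI[where M = 1]) simp_all
  ultimately show "\<phi> \<in> dual_ball V" by (simp add: dual_ball_def dual_norm_def)
qed

context normed_spaces begin

lemma multilinear_scale:
  assumes \<phi>: "multilinear_map n X scalars \<phi>" and x: "x \<in> tuples n X" and "m \<le> n"
  shows "\<phi> (\<lambda>i. if i < m then c i \<odot>\<^bsub>X i\<^esub> x i else x i) = (\<Prod>i<m. c i) * \<phi> x"
  using assms(3)
proof (induction m)
  case (Suc m)
  let ?y = "\<lambda>i. if i < m then c i \<odot>\<^bsub>X i\<^esub> x i else x i"
  have y: "?y \<in> tuples n X"
    unfolding tuples_def
  proof (rule PiE_I)
    fix i assume i: "i \<in> {..<n}"
    then interpret N: nspace "X i" by (intro nspaces) simp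
    show "?y i \<in> carrier (X i)" using tuples_mem[OF x, of i] i by simp
  next
    fix i assume "i \<notin> {..<n}"
    then show "?y i = undefined" using x Suc.prems by (auto simp: tuples_def PiE_def extensional_def)
  qed
  have m: "m < n" "m \<le> n" using Suc.prems by auto
  have "(\<lambda>i. if i < Suc m then c i \<odot>\<^bsub>X i\<^esub> x i else x i) = ?y(m := c m \<odot>\<^bsub>X m\<^esub> ?y m)"
    by (auto simp: less_Suc_eq)
  then have "\<phi> (\<lambda>i. if i < Suc m then c i \<odot>\<^bsub>X i\<^esub> x i else x i) = c m * \<phi> (?y(m := ?y m))"
    using multilinear_mapD(3)[OF \<phi> y m(1) tuples_mem[OF y m(1)]] by (simp only: scalars_simps)
  also have "?y(m := ?y m) = ?y" by (rule fun_upd_triv)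
  finally show ?case unfolding Suc.IH[OF m(2)] by simp
qed simp

lemma zero_tuple: "(\<lambda>i\<in>{..<n}. \<zero>\<^bsub>X i\<^esub>) \<in> tuples n X"
proof -
  have "\<zero>\<^bsub>X i\<^esub> \<in> carrier (X i)" if "i < n" for i
  proof -
    interpret N: nspace "X i" using that by (rule nspaces)
    show ?thesis by simp
  qed
  then show ?thesis by (auto simp: tuples_def)
qed

text \<open>
  If no entry of \<open>x\<close> is zero, all entries can be scaled to norm \<open>1\<close>. Otherwise the form vanishes
  at \<open>x\<close>.
\<close>

lemma form_ball_iff:
  "\<phi> \<in> form_ball n X \<longleftrightarrow> multilinear_map n X scalars \<phi> \<and>
     (\<forall>x\<in>tuples n X. norm (\<phi> x) \<le> (\<Prod>i<n. nrm (X i) (x i)))"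
proof
  let ?N = "{norm (\<phi> x) | x. x \<in> tuples n X \<and> (\<forall>i<n. nrm (X i) (x i) \<le> 1)}"
  have prod1: "(\<Prod>i<n. nrm (X i) (x i)) \<le> 1" if "x \<in> tuples n X" "\<forall>i<n. nrm (X i) (x i) \<le> 1" for x
    using that by (intro prod_le_1) (auto intro!: nspace.nrm_nonneg nspaces tuples_mem)
  {
    assume "\<phi> \<in> form_ball n X"
    then have ml: "multilinear_map n X scalars \<phi>" and sup: "Sup ?N \<le> 1" and
      "\<exists>M. \<forall>x\<in>tuples n X. norm (\<phi> x) \<le> M * (\<Prod>i<n. nrm (X i) (x i))"
      by (simp_all add: form_ball_def bounded_multilinear_map_def form_norm_def)
    then obtain M where M: "\<And>x. x \<in> tuples n X \<Longrightarrow> norm (\<phi> x) \<le> M * (\<Prod>i<n. nrm (X i) (x i))" by blast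
    have "y \<le> \<bar>M\<bar>" if y: "y \<in> ?N" for y
    proof -
      obtain x where x: "y = norm (\<phi> x)" "x \<in> tuples n X" "\<forall>i<n. nrm (X i) (x i) \<le> 1" using y by blast
      have "norm (\<phi> x) \<le> \<bar>M\<bar> * (\<Prod>i<n. nrm (X i) (x i))"
        using M[OF x(2)] mult_right_mono[OF abs_ge_self[of M] prod_nonneg[OF x(2) order_refl]] by linarith
      also have "\<dots> \<le> \<bar>M\<bar> * 1" using prod1[OF x(2,3)] by (intro mult_left_mono) auto
      finally show ?thesis using x(1) by simp
    qed
    then have bdd: "bdd_above ?N" by (rule bdd_aboveI)
    have "norm (\<phi> x) \<le> (\<Prod>i<n. nrm (X i) (x i))" if x: "x \<in> tuples n X" for x
    proof (cases "\<exists>i<n. nrm (X i) (x i) = 0")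
      case True
      then obtain i where i: "i < n" "nrm (X i) (x i) = 0" by blast
      interpret N: nspace "X i" using i(1) by (rule nspaces)
      have "x i = \<zero>\<^bsub>X i\<^esub>" using i N.nrm_eq_0[OF tuples_mem[OF x i(1)]] by simp
      then have "\<phi> x = 0" using multilinear_upd_zero[OF ml vspace_scalars x i(1)] by (metis fun_upd_triv scalars_simps(4))
      then show ?thesis using prod_nonneg[OF x order_refl] by simp
    next
      case False
      have pos: "0 < nrm (X i) (x i)" if "i < n" for i
        using False that nspace.nrm_nonneg[OF nspaces[OF that] tuples_mem[OF x that]] by (auto simp: order_less_le)
      define c where "c i = (of_real (1 / nrm (X i) (x i)) :: 'k)" for i
      define y where "y = (\<lambda>i. if i < n then c i \<odot>\<^bsub>X i\<^esub> x i else x i)"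
      have yi: "y i \<in> carrier (X i) \<and> nrm (X i) (y i) \<le> 1" if i: "i < n" for i
      proof -
        interpret N: nspace "X i" using i by (rule nspaces)
        show ?thesis using i pos[OF i] tuples_mem[OF x i] by (simp add: y_def c_def N.nrm_smult norm_divide)
      qed
      have y: "y \<in> tuples n X" using yi x by (auto simp: tuples_def PiE_def extensional_def y_def)
      have P: "0 < (\<Prod>i<n. nrm (X i) (x i))" using pos by (intro prod_pos) auto
      have "\<phi> y = (\<Prod>i<n. c i) * \<phi> x" unfolding y_def by (rule multilinear_scale[OF ml x order_refl])
      moreover have "(\<Prod>i<n. c i) = of_real (1 / (\<Prod>i<n. nrm (X i) (x i)))"
        unfolding c_def by (simp add: prod_dividef flip: of_real_prod)
      ultimately have "norm (\<phi> y) = norm (\<phi> x) / (\<Prod>i<n. nrm (X i) (x i))"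
        using P by (simp add: norm_mult norm_divide del: of_real_prod)
      moreover have "norm (\<phi> y) \<in> ?N" using y yi by blast
      then have "norm (\<phi> y) \<le> 1" using order_trans[OF cSup_upper[OF _ bdd] sup] by blast
      ultimately have "norm (\<phi> x) / (\<Prod>i<n. nrm (X i) (x i)) \<le> 1" by simp
      then show ?thesis using P by (simp add: field_simps)
    qed
    then show "multilinear_map n X scalars \<phi> \<and> (\<forall>x\<in>tuples n X. norm (\<phi> x) \<le> (\<Prod>i<n. nrm (X i) (x i)))"
      using ml by blast
  }
  assume *: "multilinear_map n X scalars \<phi> \<and> (\<forall>x\<in>tuples n X. norm (\<phi> x) \<le> (\<Prod>i<n. nrm (X i) (x i)))"
  have "Sup ?N \<le> 1"
  proof (rule cSup_least)
    have "nrm (X i) ((\<lambda>i\<in>{..<n}. \<zero>\<^bsub>X i\<^esub>) i) \<le> 1" if i: "i < n" for i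
    proof -
      interpret N: nspace "X i" using i by (rule nspaces)
      show ?thesis using i by simp
    qed
    then show "?N \<noteq> {}" using zero_tuple by blast
    show "y \<le> 1" if "y \<in> ?N" for y
      using that * prod1 by (auto intro: order_trans)
  qed
  then show "\<phi> \<in> form_ball n X"
    using * by (auto simp: form_ball_def bounded_multilinear_map_def form_norm_def intro!: exI[of _ 1])
qed

section \<open>Linearization\<close>

abbreviation "P \<equiv> projective_tensor n X"

lemma P_completion: "P = completion PA" by (simp add: projective_tensor_def)

lemma nspace_P: "nspace P"
  unfolding P_completion by (rule nspace.nspace_completion[OF nspace_PA])

lemma linear_map_PA: "linear_map PA W L \<longleftrightarrow> linear_map (multi_tensor_space n X) W L"
  by (simp add: linear_map_def)

lemma proj_elem_tensor_multilinear: "multilinear_map n X P (proj_elem_tensor n X)"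
proof -
  note tc = nspace.to_completion_simps[OF nspace_PA, folded P_completion]
  have mem: "elt x \<in> carrier PA" if "x \<in> tuples n X" for x
    using that by (simp add: elem_tensor_mem)
  show ?thesis
    unfolding multilinear_map_def proj_elem_tensor_def
  proof (intro conjI ballI allI impI)
    show "(\<lambda>x. to_completion PA (elt x)) \<in> tuples n X \<rightarrow> carrier P"
      using mem tc(1) by auto
    fix x i y z assume x: "x \<in> tuples n X" "i < n" and yz: "y \<in> carrier (X i)" "z \<in> carrier (X i)"
    show "to_completion PA (elt (x(i := y \<oplus>\<^bsub>X i\<^esub> z))) =
      to_completion PA (elt (x(i := y))) \<oplus>\<^bsub>P\<^esub> to_completion PA (elt (x(i := z)))"
      using tc(2)[OF mem[OF tuples_upd[OF x yz(1)]] mem[OF tuples_upd[OF x yz(2)]]] elem_tensor_upd(2)[OF x yz]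
      by simp
  next
    fix x i a y assume x: "x \<in> tuples n X" "i < n" and y: "y \<in> carrier (X i)"
    show "to_completion PA (elt (x(i := a \<odot>\<^bsub>X i\<^esub> y))) =
      a \<odot>\<^bsub>P\<^esub> to_completion PA (elt (x(i := y)))"
      using tc(3)[OF mem[OF tuples_upd[OF x y]], of a] elem_tensor_upd(1)[OF x y, of a] by simp
  qed
qed

lemma proj_elem_tensor_nrm:
  assumes "x \<in> tuples n X" shows "nrm P (proj_elem_tensor n X x) \<le> (\<Prod>i<n. nrm (X i) (x i))"
  using nspace.to_completion_simps(4)[OF nspace_PA, of "elt x"] elem_tensor_mem[OF assms]
    projective_norm_le[OF costs_elem[OF assms]]
  by (simp add: proj_elem_tensor_def P_completion)

text \<open>
  The bounded functionals on \<open>W\<close> separate its points, so the universal property applies.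
\<close>

lemma multi_tensor_lift:
  assumes W: "nspace W" and T: "multilinear_map n X W T"
  shows "\<exists>L. linear_map (multi_tensor_space n X) W L \<and> (\<forall>x\<in>tuples n X. L (elt x) = T x)"
proof -
  interpret W: nspace W by (rule W)
  have "\<exists>!L. linear_map (evaluation_span {B. multilinear_map n X scalars B} (tuples n X)) W L \<and>
      L \<in> extensional (carrier (evaluation_span {B. multilinear_map n X scalars B} (tuples n X))) \<and>
     (\<forall>t\<in>tuples n X. L (evaluation {B. multilinear_map n X scalars B} t) = T t)"
  proof (rule evaluation_span_lift[where \<Phi> = "{\<phi>. bounded_linear_map W scalars \<phi>}"])
    show "vspace W" by (rule W.vspace_axioms)
    show "T \<in> tuples n X \<rightarrow> carrier W" using T by (simp add: multilinear_map_def)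
    show "y = \<zero>\<^bsub>W\<^esub>" if y: "y \<in> carrier W" "\<And>\<phi>. \<phi> \<in> {\<phi>. bounded_linear_map W scalars \<phi>} \<Longrightarrow> \<phi> y = 0" for y
      using W.separating_functional[OF y(1)] y(2) by blast
    show "(\<lambda>t. \<phi> (T t)) \<in> {B. multilinear_map n X scalars B}"
      if "\<phi> \<in> {\<phi>. bounded_linear_map W scalars \<phi>}" for \<phi>
      using that multilinear_map_compose[OF T, of scalars \<phi>] by (simp add: bounded_linear_map_def)
  qed (simp add: bounded_linear_map_def)
  then show ?thesis unfolding multi_tensor_space_def elem_tensor_def by blast
qed

lemma P_bounded_linear_eq:
  assumes W: "nspace W" and f: "bounded_linear_map P W f" and g: "bounded_linear_map P W g"
    and eq: "\<And>x. x \<in> tuples n X \<Longrightarrow> f (proj_elem_tensor n X x) = g (proj_elem_tensor n X x)"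
    and z: "z \<in> carrier P"
  shows "f z = g z"
proof (rule nspace.completion_bounded_linear_eq[OF nspace_PA W f[unfolded P_completion] g[unfolded P_completion] _ z[unfolded P_completion]])
  note tc = nspace.to_completion_simps[OF nspace_PA, folded P_completion]
  interpret P: nspace P by (rule nspace_P)
  interpret W: nspace W by (rule W)
  interpret A: nspace PA by (rule nspace_PA)
  fix v assume v: "v \<in> carrier PA"
  have fl: "linear_map P W f" and gl: "linear_map P W g" using f g by (simp_all add: bounded_linear_map_def)
  have zero: "to_completion PA (\<lambda>_. 0) = \<zero>\<^bsub>P\<^esub>"
    using nspace.to_completion_limit_class[OF nspace_PA] nspace.completion_zero[OF nspace_PA] by (simp add: P_completion)
  have "v \<in> carrier (evaluation_span {B. multilinear_map n X scalars B} (tuples n X))"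
    using v by (simp add: multi_tensor_space_def)
  then show "f (to_completion PA v) = g (to_completion PA v)"
  proof (induction rule: evaluation_span_induct)
    case zero
    then show ?case using P.linear_map_zero[OF fl W.vspace_axioms] P.linear_map_zero[OF gl W.vspace_axioms]
      by (simp add: \<open>to_completion PA (\<lambda>_. 0) = \<zero>\<^bsub>P\<^esub>\<close>)
  next
    case (step w c t)
    have w: "w \<in> carrier PA" using step.hyps by (simp add: multi_tensor_space_def)
    have t: "elt t \<in> carrier PA" using step.hyps by (simp add: elem_tensor_mem)
    have ct: "c \<odot>\<^bsub>PA\<^esub> elt t \<in> carrier PA" using A.smult_closed[OF t] .
    have "to_completion PA (w \<oplus>\<^bsub>PA\<^esub> c \<odot>\<^bsub>PA\<^esub> elt t) =
      to_completion PA w \<oplus>\<^bsub>P\<^esub> c \<odot>\<^bsub>P\<^esub> proj_elem_tensor n X t"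
      unfolding tc(2)[OF w ct] tc(3)[OF t] proj_elem_tensor_def ..
    moreover have "(\<lambda>B. w B + c * evaluation {B. multilinear_map n X scalars B} t B) = w \<oplus>\<^bsub>PA\<^esub> c \<odot>\<^bsub>PA\<^esub> elt t"
      by (simp add: elem_tensor_def)
    moreover have "proj_elem_tensor n X t \<in> carrier P" "to_completion PA w \<in> carrier P"
      using tc(1) t w by (simp_all add: proj_elem_tensor_def)
    ultimately show ?case
      using fl gl step.IH eq[OF step.hyps(2)] by (simp add: linear_map_def)
  qed
qed

text \<open>
  The norm of the linearization on the algebraic tensor product is at most \<open>M\<close> by the definition of
  the projective norm, and this bound passes to the completion.
\<close>

lemma linearization_exists:
  assumes W: "is_banach_space W" and T: "multilinear_map n X W T"
    and M: "0 \<le> M" "\<And>x. x \<in> tuples n X \<Longrightarrow> nrm W (T x) \<le> M * (\<Prod>i<n. nrm (X i) (x i))"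
  shows "\<exists>S. linear_map P W S \<and> (\<forall>z\<in>carrier P. nrm W (S z) \<le> M * nrm P z) \<and>
     (\<forall>x\<in>tuples n X. S (proj_elem_tensor n X x) = T x)"
proof -
  have nW: "nspace W" using W by (simp add: nspace_def is_banach_space_def)
  obtain L where L: "linear_map (multi_tensor_space n X) W L" "\<And>x. x \<in> tuples n X \<Longrightarrow> L (elt x) = T x"
    using multi_tensor_lift[OF nW T] by blast
  have "nrm W (L w) \<le> M * nrm PA w" if "w \<in> carrier PA" for w
    using projective_norm_linear[OF nW L(1) M(1), of w] L(2) M(2) that by simp
  from nspace.completion_extend[OF nspace_PA W _ M(1) this] L
  show ?thesis unfolding P_completion linear_map_PA proj_elem_tensor_def
    using elem_tensor_mem by auto
qed

lemma linearization_spec: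
  assumes W: "is_banach_space W" and T: "bounded_multilinear_map n X W T"
  shows "bounded_linear_map P W (linearization n X W T)"
    and "\<And>x. x \<in> tuples n X \<Longrightarrow> linearization n X W T (proj_elem_tensor n X x) = T x"
proof -
  have nW: "nspace W" using W by (simp add: nspace_def is_banach_space_def)
  interpret W: nspace W by (rule nW)
  obtain M where M: "\<And>x. x \<in> tuples n X \<Longrightarrow> nrm W (T x) \<le> M * (\<Prod>i<n. nrm (X i) (x i))"
    using T by (auto simp: bounded_multilinear_map_def)
  have "nrm W (T x) \<le> \<bar>M\<bar> * (\<Prod>i<n. nrm (X i) (x i))" if "x \<in> tuples n X" for x
    using M[OF that] mult_right_mono[OF abs_ge_self[of M] prod_nonneg[OF that order_refl]] by linarith
  then obtain S where S: "linear_map P W S" "\<And>z. z \<in> carrier P \<Longrightarrow> nrm W (S z) \<le> \<bar>M\<bar> * nrm P z"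
     "\<And>x. x \<in> tuples n X \<Longrightarrow> S (proj_elem_tensor n X x) = T x"
    using linearization_exists[OF W _ abs_ge_zero[of M], of T] T by (auto simp: bounded_multilinear_map_def)
  let ?Q = "\<lambda>S. bounded_linear_map P W S \<and> S \<in> extensional (carrier P) \<and>
        (\<forall>x\<in>tuples n X. S (proj_elem_tensor n X x) = T x)"
  have proj: "proj_elem_tensor n X x \<in> carrier P" if "x \<in> tuples n X" for x
    using multilinear_mapD(1)[OF proj_elem_tensor_multilinear that] .
  interpret P: nspace P by (rule nspace_P)
  have "linear_map P W (restrict S (carrier P))"
    using S(1) by (auto simp: linear_map_def)
  then have "bounded_linear_map P W (restrict S (carrier P))"
    using S(2) by (intro bounded_linear_mapI[where M = "\<bar>M\<bar>"]) auto
  then have ex: "?Q (restrict S (carrier P))" using S(3) proj by (simp add: restrict_apply')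
  have "\<exists>!S. ?Q S"
  proof (rule ex1I[of ?Q, OF ex])
    fix S' assume S': "?Q S'"
    have eq: "S' (proj_elem_tensor n X x) = restrict S (carrier P) (proj_elem_tensor n X x)"
      if "x \<in> tuples n X" for x
      using S' ex that by metis
    show "S' = restrict S (carrier P)"
      by (rule extensionalityI[OF conjunct1[OF conjunct2[OF S']] conjunct1[OF conjunct2[OF ex]]
            P_bounded_linear_eq[OF nW conjunct1[OF S'] conjunct1[OF ex] eq]])
  qed
  from theI'[OF this] show "bounded_linear_map P W (linearization n X W T)"
    and "\<And>x. x \<in> tuples n X \<Longrightarrow> linearization n X W T (proj_elem_tensor n X x) = T x"
    unfolding linearization_def by blast+
qed

lemma dual_ball_P_iff:
  "\<phi> \<in> dual_ball P \<longleftrightarrow> linear_map P scalars \<phi> \<and> (\<forall>z\<in>carrier P. norm (\<phi> z) \<le> nrm P z)"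
proof -
  interpret P: nspace P by (rule nspace_P)
  show ?thesis by (rule dual_ball_iff) (auto simp: P.nrm_eq_0 P.nrm_smult P.vspace_axioms)
qed

text \<open>
  Together with \<open>dual_of_form\<close> this identifies the unit ball of the dual of the projective tensor
  product with the unit ball of the space of bounded forms.
\<close>

lemma form_of_dual:
  assumes "\<phi> \<in> dual_ball P" shows "(\<lambda>x. \<phi> (proj_elem_tensor n X x)) \<in> form_ball n X"
  using assms multilinear_map_compose[OF proj_elem_tensor_multilinear, of scalars \<phi>]
    multilinear_mapD(1)[OF proj_elem_tensor_multilinear] proj_elem_tensor_nrm
  unfolding form_ball_iff dual_ball_P_iff by (auto intro: order_trans)

lemma dual_of_form:
  assumes K: "is_banach_space (scalars :: ('k, 'k) normed_module)" and g: "g \<in> form_ball n X"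
  shows "\<exists>\<phi>\<in>dual_ball P. \<forall>x\<in>tuples n X. \<phi> (proj_elem_tensor n X x) = g x"
proof -
  obtain S where "linear_map P scalars S" "\<forall>z\<in>carrier P. norm (S z) \<le> nrm P z"
     "\<forall>x\<in>tuples n X. S (proj_elem_tensor n X x) = g x"
    using linearization_exists[OF K, of g 1] g unfolding form_ball_iff by auto
  then show ?thesis by (intro bexI[of _ S]) (simp_all add: dual_ball_P_iff)
qed

end

lemma banach_scalars: "is_banach_space (scalars :: ('k::{real_normed_field, banach}, 'k) normed_module)"
proof -
  interpret K: nspace "scalars :: ('k, 'k) normed_module" by (rule nspace_scalars)
  have "\<exists>x. limitin K.D.mtopology s x sequentially" if s: "K.D.MCauchy s" for s
  proof -
    have "Cauchy s" using s unfolding K.MCauchy_iff K.cauchy_def by (auto intro!: CauchyI)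
    then obtain x where x: "s \<longlonglongrightarrow> x" by (auto simp: Cauchy_convergent_iff convergent_def)
    then show ?thesis
      unfolding K.D.limit_metric_sequentially by (auto simp: K.ndist_eq LIMSEQ_iff intro!: exI[of _ x])
  qed
  then have "K.D.mcomplete" unfolding K.D.mcomplete_def by blast
  then show ?thesis using K.nsp by (simp add: is_banach_space_def)
qed

section \<open>The sequence spaces and their duality\<close>

text \<open>
  The inequality of Hoelder in the form that occurs for a norming functional. It also covers
  \<open>p = 1\<close>, where the factors \<open>a i powr 0\<close> are \<open>1\<close> or \<open>0\<close>. The proof divides by the right-hand side
  and sums the inequality of Young.
\<close>

lemma Hoelder_sum:
  fixes a b :: "nat \<Rightarrow> real"
  assumes p: "1 \<le> p" and a: "\<And>i. 0 \<le> a i" and b: "\<And>i. 0 \<le> b i"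
  shows "(\<Sum>i<k. a i powr (p - 1) * b i) \<le> (\<Sum>i<k. a i powr p) powr (1 - 1 / p) * (\<Sum>i<k. b i powr p) powr (1 / p)"
proof -
  define A where "A = (\<Sum>i<k. a i powr p)"
  define B where "B = (\<Sum>i<k. b i powr p)"
  have AB0: "0 \<le> A" "0 \<le> B" by (simp_all add: A_def B_def sum_nonneg)
  show ?thesis
  proof (cases "A = 0 \<or> B = 0")
    case True
    then have "(\<forall>i<k. a i = 0) \<or> (\<forall>i<k. b i = 0)"
      unfolding A_def B_def by (auto simp: sum_nonneg_eq_0_iff)
    then have "(\<Sum>i<k. a i powr (p - 1) * b i) = 0" by (auto intro!: sum.neutral)
    then show ?thesis by simp
  next
    case False
    then have AB: "0 < A" "0 < B" using AB0 by auto
    define c where "c = A powr (1 - 1 / p) * B powr (1 / p)"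
    have c: "0 < c" using AB by (simp add: c_def)
    have *: "a i powr (p - 1) * b i \<le> c * ((1 - 1 / p) * (a i powr p / A) + 1 / p * (b i powr p / B))" for i
    proof (cases "a i = 0 \<or> b i = 0")
      case True
      then show ?thesis using p c AB by auto
    next
      case False
      then have ab: "0 < a i" "0 < b i" using a[of i] b[of i] by auto
      have "p * (1 - 1 / p) = p - 1" using p by (simp add: field_simps)
      then have "(a i powr p / A) powr (1 - 1 / p) * (b i powr p / B) powr (1 / p) = a i powr (p - 1) * b i / c"
        using p AB ab by (simp add: powr_divide powr_powr c_def)
      moreover have "(a i powr p / A) powr (1 - 1 / p) * (b i powr p / B) powr (1 / p) \<le>
          (1 - 1 / p) * (a i powr p / A) + 1 / p * (b i powr p / B)"
        using p AB ab by (intro Youngs_inequality_0) auto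
      ultimately have "a i powr (p - 1) * b i / c \<le> (1 - 1 / p) * (a i powr p / A) + 1 / p * (b i powr p / B)" by linarith
      then show ?thesis using c by (simp only: pos_divide_le_eq mult.commute)
    qed
    have "(\<Sum>i<k. a i powr (p - 1) * b i) \<le> (\<Sum>i<k. c * ((1 - 1 / p) * (a i powr p / A) + 1 / p * (b i powr p / B)))"
      by (intro sum_mono *)
    also have "\<dots> = c * ((1 - 1 / p) * (A / A) + 1 / p * (B / B))"
      by (simp only: sum.distrib A_def B_def flip: sum_distrib_left sum_divide_distrib)
    also have "\<dots> = c" using AB by simp
    finally show ?thesis by (simp add: c_def A_def B_def)
  qed
qed

lemma lp_space_simps [simp]:
  "zero (lp_space p Y) = (\<lambda>_. \<zero>\<^bsub>Y\<^esub>)" "add (lp_space p Y) = (\<lambda>s t i. s i \<oplus>\<^bsub>Y\<^esub> t i)"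
  "smult (lp_space p Y) = (\<lambda>a s i. a \<odot>\<^bsub>Y\<^esub> s i)"
  by (simp_all add: lp_space_def)

lemma lp_space_nrm: "nrm (lp_space p Y) s = (\<Sum>i. nrm Y (s i) powr p) powr (1 / p)"
  by (simp add: lp_space_def)

lemma lp_space_mem:
  "s \<in> carrier (lp_space p Y) \<longleftrightarrow> (\<forall>i. s i \<in> carrier Y) \<and> summable (\<lambda>i. nrm Y (s i) powr p)"
  by (simp add: lp_space_def)

context nspace begin

lemma lp_space_smult:
  assumes "s \<in> carrier (lp_space p V)"
  shows "(\<lambda>i. a \<odot> s i) \<in> carrier (lp_space p V)"
  using assms by (simp add: lp_space_mem nrm_smult powr_mult summable_mult)

lemma lp_space_vspace:
  assumes "0 < p" shows "vspace (lp_space p V)"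
proof (rule pointwise_vspace[OF vspace_axioms])
  show "s i \<in> carrier V" if "s \<in> carrier (lp_space p V)" for s i using that by (simp add: lp_space_mem)
  show "\<zero>\<^bsub>lp_space p V\<^esub> \<in> carrier (lp_space p V)" by (simp add: lp_space_mem)
  show "a \<odot>\<^bsub>lp_space p V\<^esub> s \<in> carrier (lp_space p V)" if "s \<in> carrier (lp_space p V)" for a s
    using lp_space_smult[OF that] by simp
  fix s t assume s: "s \<in> carrier (lp_space p V)" and t: "t \<in> carrier (lp_space p V)"
  have st: "s i \<in> carrier V" "t i \<in> carrier V" for i using s t by (simp_all add: lp_space_mem)
  have le: "nrm V (s i \<oplus> t i) powr p \<le> 2 powr p * (nrm V (s i) powr p + nrm V (t i) powr p)" for i
  proof -
    let ?m = "max (nrm V (s i)) (nrm V (t i))"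
    have m: "0 \<le> ?m" using st by (simp add: le_max_iff_disj)
    have "nrm V (s i \<oplus> t i) powr p \<le> (2 * ?m) powr p"
      using nrm_triangle[of "s i" "t i"] st assms by (intro powr_mono2) auto
    also have "\<dots> = 2 powr p * ?m powr p" using m by (simp add: powr_mult)
    also have "\<dots> \<le> 2 powr p * (nrm V (s i) powr p + nrm V (t i) powr p)"
      by (intro mult_left_mono) (auto simp: max_def)
    finally show ?thesis .
  qed
  have "summable (\<lambda>i. 2 powr p * (nrm V (s i) powr p + nrm V (t i) powr p))"
    using s t by (intro summable_mult summable_add) (simp_all add: lp_space_mem)
  then have "summable (\<lambda>i. nrm V (s i \<oplus> t i) powr p)"
    by (rule summable_comparison_test'[where N = 0]) (use le in simp)
  then show "s \<oplus>\<^bsub>lp_space p V\<^esub> t \<in> carrier (lp_space p V)" using st by (simp add: lp_space_mem)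
qed simp_all

lemma lp_space_nrm_smult:
  assumes p: "0 < p" and s: "s \<in> carrier (lp_space p V)"
  shows "nrm (lp_space p V) (\<lambda>i. a \<odot> s i) = norm a * nrm (lp_space p V) s"
proof -
  have s': "s i \<in> carrier V" "summable (\<lambda>i. nrm V (s i) powr p)" for i using s by (simp_all add: lp_space_mem)
  have "(\<Sum>i. nrm V (a \<odot> s i) powr p) = norm a powr p * (\<Sum>i. nrm V (s i) powr p)"
    using s' by (simp add: nrm_smult powr_mult suminf_mult)
  then show ?thesis
    unfolding lp_space_nrm using p s' by (simp add: powr_mult suminf_nonneg powr_powr)
qed

lemma lp_space_nrm_eq_0:
  assumes p: "0 < p" and s: "s \<in> carrier (lp_space p V)" and "nrm (lp_space p V) s = 0"
  shows "s = (\<lambda>_. \<zero>)"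
proof
  fix i
  have s': "s i \<in> carrier V" "summable (\<lambda>i. nrm V (s i) powr p)" for i using s by (simp_all add: lp_space_mem)
  have "(\<Sum>i. nrm V (s i) powr p) = 0" using assms(3) by (simp add: lp_space_nrm)
  then have "nrm V (s i) powr p = 0" using suminf_eq_zero_iff[OF s'(2)] by simp
  then show "s i = \<zero>" using nrm_eq_0[OF s'(1)] by simp
qed

lemma lp_space_finite:
  assumes "\<And>i. i < k \<Longrightarrow> x i \<in> carrier V" "0 < p"
  shows "(\<lambda>j. if j < k then x j else \<zero>) \<in> carrier (lp_space p V)"
    and "nrm (lp_space p V) (\<lambda>j. if j < k then x j else \<zero>) = (\<Sum>i<k. nrm V (x i) powr p) powr (1 / p)"
proof -
  have *: "nrm V (if j < k then x j else \<zero>) powr p = 0" if "j \<notin> {..<k}" for j using that by simp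
  have "summable (\<lambda>j. nrm V (if j < k then x j else \<zero>) powr p)"
    by (rule summable_finite[of "{..<k}", OF _ *]) auto
  then show "(\<lambda>j. if j < k then x j else \<zero>) \<in> carrier (lp_space p V)"
    using assms by (simp add: lp_space_mem)
  show "nrm (lp_space p V) (\<lambda>j. if j < k then x j else \<zero>) = (\<Sum>i<k. nrm V (x i) powr p) powr (1 / p)"
    unfolding lp_space_nrm by (subst suminf_finite[of "{..<k}", OF _ *]) (auto intro!: arg_cong[where f = "\<lambda>x. x powr _"] sum.cong)
qed

end

abbreviation "lp p \<equiv> lp_space p (scalars :: ('k::real_normed_field, 'k) normed_module)"

lemma vspace_lp: "1 \<le> p \<Longrightarrow> vspace (lp p :: ('k::real_normed_field, _) normed_module)"
  by (rule nspace.lp_space_vspace[OF nspace_scalars]) simp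

lemma lp_dual_ball_iff:
  assumes p: "1 \<le> p"
  shows "\<psi> \<in> dual_ball (lp p :: ('k::real_normed_field, _) normed_module) \<longleftrightarrow>
    linear_map (lp p) scalars \<psi> \<and> (\<forall>s\<in>carrier (lp p). norm (\<psi> s) \<le> nrm (lp p) s)"
proof (rule dual_ball_iff)
  have p0: "0 < p" using p by simp
  let ?L = "lp p :: ('k, _) normed_module"
  show "vspace ?L" by (rule vspace_lp[OF p])
  show "nrm ?L \<zero>\<^bsub>?L\<^esub> = 0" using p0 by (simp add: lp_space_nrm)
  show "0 \<le> nrm ?L s" for s by (simp add: lp_space_nrm)
  show "s = \<zero>\<^bsub>?L\<^esub>" if "s \<in> carrier ?L" "nrm ?L s = 0" for s
    using nspace.lp_space_nrm_eq_0[OF nspace_scalars p0 that] by simp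
  show "nrm ?L (a \<odot>\<^bsub>?L\<^esub> s) = norm a * nrm ?L s" if "s \<in> carrier ?L" for a s
    using nspace.lp_space_nrm_smult[OF nspace_scalars p0 that, of a] by simp
qed

lemma lp_finite:
  assumes "1 \<le> p"
  shows "(\<lambda>j. if j < k then x j else 0) \<in> carrier (lp p :: ('k::real_normed_field, _) normed_module)"
    and "nrm (lp p :: ('k::real_normed_field, _) normed_module) (\<lambda>j. if j < k then x j else 0) = (\<Sum>i<k. norm (x i) powr p) powr (1 / p)"
  using nspace.lp_space_finite[OF nspace_scalars, of k x p] assms unfolding scalars_simps by simp_all

lemma unit_seq_lp:
  assumes p: "1 \<le> p" shows "unit_seq i \<in> carrier (lp p :: ('k::real_normed_field, _) normed_module)"
proof -
  have "unit_seq i = (\<lambda>j. if j < Suc i then (if j = i then 1 else 0) else (0::'k))"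
    by (auto simp: unit_seq_def)
  then show ?thesis using lp_finite(1)[OF p, of "Suc i"] by simp
qed

lemma linear_on_finite_sequence:
  assumes p: "1 \<le> p" and \<psi>: "linear_map (lp p :: ('k::real_normed_field, _) normed_module) scalars \<psi>"
  shows "\<psi> (\<lambda>j. if j < k then x j else 0) = (\<Sum>i<k. x i * \<psi> (unit_seq i))"
proof (induction k)
  case 0
  show ?case using vspace.linear_map_zero[OF vspace_lp[OF p] \<psi> vspace_scalars] by simp
next
  case (Suc k)
  let ?s = "\<lambda>j. if j < k then x j else 0"
  have add: "\<psi> (\<lambda>j. s j + t j) = \<psi> s + \<psi> t" if "s \<in> carrier (lp p)" "t \<in> carrier (lp p)" for s t
    using \<psi> that by (simp add: linear_map_def)
  have scale: "\<psi> (\<lambda>j. c * s j) = c * \<psi> s" if "s \<in> carrier (lp p)" for c s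
    using \<psi> that by (simp add: linear_map_def)
  have e: "(\<lambda>j. x k * unit_seq k j) \<in> carrier (lp p)"
    using vspace.smult_closed[OF vspace_lp[OF p] unit_seq_lp[OF p], of "x k" k] by simp
  have eq: "(\<lambda>j. if j < Suc k then x j else 0) = (\<lambda>j. ?s j + x k * unit_seq k j)"
    by (auto simp: unit_seq_def less_Suc_eq)
  have "\<psi> (\<lambda>j. if j < Suc k then x j else 0) = \<psi> ?s + \<psi> (\<lambda>j. x k * unit_seq k j)"
    unfolding eq by (rule add[OF lp_finite(1)[OF p] e])
  also have "\<psi> (\<lambda>j. x k * unit_seq k j) = x k * \<psi> (unit_seq k)"
    by (rule scale[OF unit_seq_lp[OF p]])
  finally show ?case using Suc.IH by simp
qed

lemma lp_dual_le:
  assumes p: "1 \<le> p" and \<psi>: "\<psi> \<in> dual_ball (lp p :: ('k::real_normed_field, _) normed_module)"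
  shows "norm (\<Sum>i<k. \<psi> (unit_seq i) * x i) \<le> (\<Sum>i<k. norm (x i) powr p) powr (1 / p)"
proof -
  have "norm (\<psi> (\<lambda>j. if j < k then x j else 0)) \<le> (\<Sum>i<k. norm (x i) powr p) powr (1 / p)"
    using \<psi> lp_finite[OF p, of k x] unfolding lp_dual_ball_iff[OF p] by metis
  then show ?thesis
    using linear_on_finite_sequence[OF p, of \<psi> k x] \<psi> by (simp add: lp_dual_ball_iff[OF p] mult.commute)
qed

text \<open>
  The functional is given by the coefficients \<open>c i = \<bar>x i\<bar> ^ p / x i\<close>, which equal \<open>0\<close> if
  \<open>x i = 0\<close>, divided by $S^{1-1/p}$, where \<open>S\<close> is the sum of the \<open>\<bar>x i\<bar> ^ p\<close>. It takes the
  value $S^{1/p}$ at \<open>x\<close>, and it has norm at most \<open>1\<close> by the inequality of Hoelder. This formula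
  is the same for real and for complex scalars.
\<close>

lemma lp_dual_norming:
  fixes x :: "nat \<Rightarrow> 'k::real_normed_field"
  assumes p: "1 \<le> p"
  shows "\<exists>\<psi>\<in>dual_ball (lp p). norm (\<Sum>i<k. \<psi> (unit_seq i) * x i) = (\<Sum>i<k. norm (x i) powr p) powr (1 / p)"
proof -
  define S where "S = (\<Sum>i<k. norm (x i) powr p)"
  have S0: "0 \<le> S" by (simp add: S_def sum_nonneg)
  define c where "c i = of_real (norm (x i) powr p) / x i" for i
  have nc: "norm (c i) = norm (x i) powr (p - 1)" for i
    by (cases "x i = 0") (auto simp: c_def norm_divide powr_diff)
  define \<psi> where "\<psi> s = of_real (S powr (1 / p - 1)) * (\<Sum>i<k. c i * s i)" for s :: "nat \<Rightarrow> 'k"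
  have unit: "\<psi> (unit_seq i) = of_real (S powr (1 / p - 1)) * c i" if "i < k" for i
    using that by (simp add: \<psi>_def unit_seq_def if_distrib sum.delta cong: if_cong)
  have "(\<Sum>i<k. \<psi> (unit_seq i) * x i) = (\<Sum>i<k. of_real (S powr (1 / p - 1)) * of_real (norm (x i) powr p))"
    by (intro sum.cong) (auto simp: unit c_def)
  also have "\<dots> = of_real (S powr (1 / p - 1) * S)"
    unfolding S_def by (simp add: sum_distrib_left)
  finally have "norm (\<Sum>i<k. \<psi> (unit_seq i) * x i) = S powr (1 / p - 1) * S"
    using S0 by (simp add: norm_mult)
  also have "\<dots> = S powr (1 / p)" using S0 by (cases "S = 0") (auto simp: powr_diff)
  finally have val: "norm (\<Sum>i<k. \<psi> (unit_seq i) * x i) = S powr (1 / p)" .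
  have "norm (\<psi> s) \<le> nrm (lp p) s" if s: "s \<in> carrier (lp p)" for s :: "nat \<Rightarrow> 'k"
  proof -
    have sum: "summable (\<lambda>i. norm (s i) powr p)" using s by (simp add: lp_space_mem)
    have "norm (\<Sum>i<k. c i * s i) \<le> (\<Sum>i<k. norm (x i) powr (p - 1) * norm (s i))"
      by (rule order_trans[OF norm_sum]) (simp add: norm_mult nc)
    also have "\<dots> \<le> S powr (1 - 1 / p) * (\<Sum>i<k. norm (s i) powr p) powr (1 / p)"
      unfolding S_def by (rule Hoelder_sum[OF p]) auto
    also have "\<dots> \<le> S powr (1 - 1 / p) * nrm (lp p) s"
      unfolding lp_space_nrm using sum p
      by (intro mult_left_mono powr_mono2) (auto intro!: sum_nonneg sum_le_suminf)
    finally have "S powr (1 / p - 1) * norm (\<Sum>i<k. c i * s i) \<le> S powr (1 / p - 1) * (S powr (1 - 1 / p) * nrm (lp p) s)"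
      by (rule mult_left_mono) simp
    also have "\<dots> = (if S = 0 then 0 else nrm (lp p) s)"
      by (simp add: powr_add[symmetric] flip: mult.assoc)
    also have "\<dots> \<le> nrm (lp p) s" by (simp add: lp_space_nrm)
    finally show ?thesis by (simp add: \<psi>_def norm_mult)
  qed
  moreover have "linear_map (lp p) scalars \<psi>"
    unfolding linear_map_def \<psi>_def by (auto simp: sum.distrib sum_distrib_left algebra_simps)
  ultimately have "\<psi> \<in> dual_ball (lp p)" by (simp add: lp_dual_ball_iff[OF p])
  then show ?thesis using val unfolding S_def by blast
qed

section \<open>Tensor products of two spaces\<close>

lemma tensor_lift_spec:
  assumes W: "vspace W" and b: "\<And>x y. x \<in> carrier E \<Longrightarrow> y \<in> carrier F \<Longrightarrow> b x y \<in> carrier W"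
    and lin: "\<And>\<phi>. \<phi> \<in> \<Phi> \<Longrightarrow> linear_map W scalars \<phi>"
    and sep: "\<And>y. y \<in> carrier W \<Longrightarrow> (\<And>\<phi>. \<phi> \<in> \<Phi> \<Longrightarrow> \<phi> y = 0) \<Longrightarrow> y = \<zero>\<^bsub>W\<^esub>"
    and forms: "\<And>\<phi>. \<phi> \<in> \<Phi> \<Longrightarrow> (\<lambda>(x, y). \<phi> (b x y)) \<in> bilinear_forms E F"
  shows "linear_map (tensor_space E F) W (tensor_lift E F W b)"
    and "\<And>x y. x \<in> carrier E \<Longrightarrow> y \<in> carrier F \<Longrightarrow> tensor_lift E F W b (tensor E F x y) = b x y"
proof -
  have "\<exists>!L. linear_map (evaluation_span (bilinear_forms E F) (carrier E \<times> carrier F)) W L \<and>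
      L \<in> extensional (carrier (evaluation_span (bilinear_forms E F) (carrier E \<times> carrier F))) \<and>
     (\<forall>t\<in>carrier E \<times> carrier F. L (evaluation (bilinear_forms E F) t) = (case t of (x, y) \<Rightarrow> b x y))"
  proof (rule evaluation_span_lift[OF W _ lin sep])
    show "(\<lambda>(x, y). b x y) \<in> carrier E \<times> carrier F \<rightarrow> carrier W" using b by auto
    show "(\<lambda>t. \<phi> (case t of (x, y) \<Rightarrow> b x y)) \<in> bilinear_forms E F" if "\<phi> \<in> \<Phi>" for \<phi>
      using forms[OF that] by (simp add: case_prod_unfold)
  qed
  then have "\<exists>!L. linear_map (tensor_space E F) W L \<and> L \<in> extensional (carrier (tensor_space E F)) \<and>
        (\<forall>x\<in>carrier E. \<forall>y\<in>carrier F. L (tensor E F x y) = b x y)"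
    by (simp add: tensor_space_def tensor_def)
  from theI'[OF this] show "linear_map (tensor_space E F) W (tensor_lift E F W b)"
    and "\<And>x y. x \<in> carrier E \<Longrightarrow> y \<in> carrier F \<Longrightarrow> tensor_lift E F W b (tensor E F x y) = b x y"
    unfolding tensor_lift_def by blast+
qed

lemma tensor_space_vspace: "vspace (tensor_space E F)"
  unfolding tensor_space_def by (rule evaluation_span_vspace)

lemma tensor_mem: "x \<in> carrier E \<Longrightarrow> y \<in> carrier F \<Longrightarrow> tensor E F x y \<in> carrier (tensor_space E F)"
  unfolding tensor_space_def tensor_def by (rule evaluation_span_evaluation) simp

lemma (in vspace) finsum_lessThan_Suc:
  assumes "\<And>i. i < Suc k \<Longrightarrow> g i \<in> carrier V"
  shows "(\<Oplus>i\<in>{..<Suc k}. g i) = (\<Oplus>i\<in>{..<k}. g i) \<oplus> g k"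
  unfolding lessThan_Suc using assms
  by (subst M.M.finsum_insert) (auto intro!: M.M.a_comm M.M.finsum_closed)

lemma (in vspace) linear_map_finsum:
  assumes f: "linear_map V W f" and W: "vspace W" and g: "\<And>i. i < (k::nat) \<Longrightarrow> g i \<in> carrier V"
  shows "f (\<Oplus>i\<in>{..<k}. g i) = (\<Oplus>\<^bsub>W\<^esub>i\<in>{..<k}. f (g i))"
  using g
proof (induction k)
  case 0
  interpret W: vspace W by (rule W)
  show ?case using linear_map_zero[OF f W] by (simp add: M.M.finsum_empty W.M.M.finsum_empty)
next
  case (Suc k)
  interpret W: vspace W by (rule W)
  have fc: "f x \<in> carrier W" if "x \<in> carrier V" for x using f that by (auto simp: linear_map_def)
  have "(\<Oplus>i\<in>{..<k}. g i) \<in> carrier V" using Suc.prems by (intro M.M.finsum_closed) auto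
  moreover have "g k \<in> carrier V" using Suc.prems by simp
  ultimately have "f (\<Oplus>i\<in>{..<Suc k}. g i) = f (\<Oplus>i\<in>{..<k}. g i) \<oplus>\<^bsub>W\<^esub> f (g k)"
    using f finsum_lessThan_Suc[of k g] Suc.prems by (simp add: linear_map_def)
  then show ?case using Suc W.finsum_lessThan_Suc[of k "\<lambda>i. f (g i)"] fc by simp
qed

lemma evaluation_span_finsum:
  assumes "\<And>i. i < (k::nat) \<Longrightarrow> g i \<in> carrier (evaluation_span F D :: ('k::real_normed_field, _) module)"
  shows "(\<Oplus>\<^bsub>evaluation_span F D\<^esub>i\<in>{..<k}. g i) B = (\<Sum>i<k. g i B)"
  using assms
proof (induction k)
  interpret V: vspace "evaluation_span F D :: ('k, _) module" by (rule evaluation_span_vspace)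
  case 0
  show ?case by (simp add: V.M.M.finsum_empty)
next
  interpret V: vspace "evaluation_span F D :: ('k, _) module" by (rule evaluation_span_vspace)
  case (Suc k)
  then show ?case using V.finsum_lessThan_Suc[of k g] by simp
qed

lemma lp_space_finsum:
  assumes Y: "nspace Y" and p: "1 \<le> p" and y: "\<And>i. i < k \<Longrightarrow> y i \<in> carrier Y"
  shows "(\<Oplus>\<^bsub>lp_space p Y\<^esub>i\<in>{..<k}. (\<lambda>j. unit_seq i j \<odot>\<^bsub>Y\<^esub> y i)) = (\<lambda>j. if j < k then y j else \<zero>\<^bsub>Y\<^esub>)"
proof -
  have p0: "0 < p" using p by simp
  interpret Y: nspace Y by (rule Y)
  interpret L: vspace "lp_space p Y" by (rule Y.lp_space_vspace[OF p0])
  have mem: "(\<lambda>j. unit_seq i j \<odot>\<^bsub>Y\<^esub> z) \<in> carrier (lp_space p Y)" if "z \<in> carrier Y" for i z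
  proof -
    have "(\<lambda>j. unit_seq i j \<odot>\<^bsub>Y\<^esub> z) = (\<lambda>j. if j < Suc i then (if j = i then z else \<zero>\<^bsub>Y\<^esub>) else \<zero>\<^bsub>Y\<^esub>)"
      using that by (auto simp: unit_seq_def)
    then show ?thesis using Y.lp_space_finite(1)[of "Suc i" "\<lambda>j. if j = i then z else \<zero>\<^bsub>Y\<^esub>" p] that p0 by simp
  qed
  show ?thesis using y
  proof (induction k)
    case 0
    show ?case by (simp add: L.M.M.finsum_empty)
  next
    case (Suc k)
    have "(\<Oplus>\<^bsub>lp_space p Y\<^esub>i\<in>{..<Suc k}. (\<lambda>j. unit_seq i j \<odot>\<^bsub>Y\<^esub> y i)) =
      (\<lambda>j. (if j < k then y j else \<zero>\<^bsub>Y\<^esub>) \<oplus>\<^bsub>Y\<^esub> unit_seq k j \<odot>\<^bsub>Y\<^esub> y k)"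
      using L.finsum_lessThan_Suc[of k "\<lambda>i j. unit_seq i j \<odot>\<^bsub>Y\<^esub> y i"] Suc mem by simp
    also have "\<dots> = (\<lambda>j. if j < Suc k then y j else \<zero>\<^bsub>Y\<^esub>)"
      using Suc.prems by (auto simp: unit_seq_def less_Suc_eq)
    finally show ?case .
  qed
qed

lemma linear_map_compose:
  "linear_map U V f \<Longrightarrow> linear_map V W g \<Longrightarrow> linear_map U W (\<lambda>x. g (f x))"
  unfolding linear_map_def by (auto simp: Pi_iff)

lemma product_bilinear_form:
  assumes "linear_map E scalars \<psi>" "linear_map F scalars \<phi>"
  shows "(\<lambda>(x, y). \<psi> x * \<phi> y) \<in> bilinear_forms E F"
  using assms by (auto simp: bilinear_forms_def linear_map_def algebra_simps)

lemma tensor_apply: "B \<in> bilinear_forms E F \<Longrightarrow> tensor E F x y B = B (x, y)"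
  by (simp add: tensor_def evaluation_def)

text \<open>
  A tensor is zero as soon as all bilinear forms vanish on it, so evaluations at bilinear forms
  are a separating family on the target.
\<close>

lemma tensor_map_spec:
  assumes R: "linear_map E E' R" and S: "linear_map F F' S"
  shows "linear_map (tensor_space E F) (tensor_space E' F') (tensor_map E F E' F' R S)"
    and "\<And>x y. x \<in> carrier E \<Longrightarrow> y \<in> carrier F \<Longrightarrow>
      tensor_map E F E' F' R S (tensor E F x y) = tensor E' F' (R x) (S y)"
proof -
  let ?W = "tensor_space E' F'"
  let ?\<Phi> = "(\<lambda>B w. w B) ` bilinear_forms E' F'"
  have mem: "tensor E' F' (R x) (S y) \<in> carrier ?W" if "x \<in> carrier E" "y \<in> carrier F" for x y
    using R S that by (intro tensor_mem) (auto simp: linear_map_def)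
  have lin: "linear_map ?W scalars \<phi>" if "\<phi> \<in> ?\<Phi>" for \<phi>
    using that by (auto simp: linear_map_def tensor_space_def)
  have sep: "w = \<zero>\<^bsub>?W\<^esub>" if w: "w \<in> carrier ?W" "\<And>\<phi>. \<phi> \<in> ?\<Phi> \<Longrightarrow> \<phi> w = 0" for w
  proof -
    have "w B = 0" for B
    proof (cases "B \<in> bilinear_forms E' F'")
      case True
      then show ?thesis using w(2) by blast
    next
      case False
      then show ?thesis using w(1) by (auto simp: tensor_space_def evaluation_span_def evaluation_def)
    qed
    then show ?thesis by (auto simp: tensor_space_def)
  qed
  have forms: "(\<lambda>(x, y). \<phi> (tensor E' F' (R x) (S y))) \<in> bilinear_forms E F" if \<phi>: "\<phi> \<in> ?\<Phi>" for \<phi>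
  proof -
    obtain B where B: "B \<in> bilinear_forms E' F'" "\<phi> = (\<lambda>w. w B)" using \<phi> by blast
    have "linear_map E scalars (\<lambda>x. B (R x, S y))" if "y \<in> carrier F" for y
      by (rule linear_map_compose[OF R]) (use B(1) S that in \<open>auto simp: bilinear_forms_def linear_map_def[of F]\<close>)
    moreover have "linear_map F scalars (\<lambda>y. B (R x, S y))" if "x \<in> carrier E" for x
      by (rule linear_map_compose[OF S]) (use B(1) R that in \<open>auto simp: bilinear_forms_def linear_map_def[of E]\<close>)
    ultimately show ?thesis using B by (simp add: bilinear_forms_def[of E F] tensor_apply)
  qed
  show "linear_map (tensor_space E F) (tensor_space E' F') (tensor_map E F E' F' R S)"
    unfolding tensor_map_def by (rule tensor_lift_spec(1)[where b = "\<lambda>x y. tensor E' F' (R x) (S y)" and \<Phi> = ?\<Phi> and E = E and F = F,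
        OF tensor_space_vspace mem lin sep forms])
  show "\<And>x y. x \<in> carrier E \<Longrightarrow> y \<in> carrier F \<Longrightarrow>
      tensor_map E F E' F' R S (tensor E F x y) = tensor E' F' (R x) (S y)"
    unfolding tensor_map_def by (rule tensor_lift_spec(2)[where b = "\<lambda>x y. tensor E' F' (R x) (S y)" and \<Phi> = ?\<Phi> and E = E and F = F,
        OF tensor_space_vspace mem lin sep forms])
qed

text \<open>
  The functionals that apply a bounded functional on \<open>Y\<close> to one term of a sequence separate the
  points of $\ell_p[Y]$.
\<close>

lemma lp_embedding_spec:
  fixes Y :: "('k::real_normed_field, 'y) normed_module"
  assumes Y: "nspace Y" and p: "1 \<le> p"
  defines "J \<equiv> tensor_lift (lp p) Y (lp_space p Y) (\<lambda>s y i. s i \<odot>\<^bsub>Y\<^esub> y)"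
  shows "linear_map (tensor_space (lp p) Y) (lp_space p Y) J"
    and "\<And>s y. s \<in> carrier (lp p) \<Longrightarrow> y \<in> carrier Y \<Longrightarrow> J (tensor (lp p) Y s y) = (\<lambda>i. s i \<odot>\<^bsub>Y\<^esub> y)"
proof -
  interpret Y: nspace Y by (rule Y)
  have W: "vspace (lp_space p Y)" using Y.lp_space_vspace p by simp
  let ?\<Phi> = "{(\<lambda>t. \<phi> (t i)) | \<phi> (i::nat). bounded_linear_map Y scalars \<phi>} :: ((nat \<Rightarrow> 'y) \<Rightarrow> 'k) set"
  have mem: "(\<lambda>i. s i \<odot>\<^bsub>Y\<^esub> y) \<in> carrier (lp_space p Y)" if "s \<in> carrier (lp p)" "y \<in> carrier Y" for s y
    using that by (simp add: lp_space_mem Y.nrm_smult powr_mult summable_mult2)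
  have lin: "linear_map (lp_space p Y) scalars \<phi>" if "\<phi> \<in> ?\<Phi>" for \<phi>
    using that by (auto simp: bounded_linear_map_def linear_map_def lp_space_mem)
  have sep: "t = \<zero>\<^bsub>lp_space p Y\<^esub>" if t: "t \<in> carrier (lp_space p Y)" "\<And>\<phi>. \<phi> \<in> ?\<Phi> \<Longrightarrow> \<phi> t = 0" for t
  proof -
    have "t i = \<zero>\<^bsub>Y\<^esub>" for i
    proof (rule ccontr)
      assume "t i \<noteq> \<zero>\<^bsub>Y\<^esub>"
      then obtain \<phi> where "bounded_linear_map Y scalars \<phi>" "\<phi> (t i) \<noteq> 0"
        using Y.separating_functional[of "t i"] t(1) by (auto simp: lp_space_mem)
      then show False using t(2)[of "\<lambda>t. \<phi> (t i)"] by blast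
    qed
    then show ?thesis by auto
  qed
  have forms: "(\<lambda>(s, y). \<phi> (\<lambda>i. s i \<odot>\<^bsub>Y\<^esub> y)) \<in> bilinear_forms (lp p) Y" if \<phi>: "\<phi> \<in> ?\<Phi>" for \<phi>
  proof -
    obtain \<eta> i where \<eta>: "bounded_linear_map Y scalars \<eta>" "\<phi> = (\<lambda>t. \<eta> (t (i::nat)))" using \<phi> by blast
    then show ?thesis
      by (auto simp: bounded_linear_map_def linear_map_def bilinear_forms_def algebra_simps)
  qed
  show "linear_map (tensor_space (lp p) Y) (lp_space p Y) J"
    unfolding J_def by (rule tensor_lift_spec(1)[where b = "\<lambda>s y i. s i \<odot>\<^bsub>Y\<^esub> y" and \<Phi> = ?\<Phi> and E = "lp p" and F = Y,
        OF W mem lin sep forms])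
  show "\<And>s y. s \<in> carrier (lp p) \<Longrightarrow> y \<in> carrier Y \<Longrightarrow> J (tensor (lp p) Y s y) = (\<lambda>i. s i \<odot>\<^bsub>Y\<^esub> y)"
    unfolding J_def by (rule tensor_lift_spec(2)[where b = "\<lambda>s y i. s i \<odot>\<^bsub>Y\<^esub> y" and \<Phi> = ?\<Phi> and E = "lp p" and F = Y,
        OF W mem lin sep forms])
qed

text \<open>
  The embedding is linear and sends the elementary tensor of a unit sequence and \<open>y\<close> to the
  sequence with the single term \<open>y\<close>.
\<close>

lemma delta_norm_sum:
  fixes Y :: "('k::real_normed_field, 'y) normed_module"
  assumes Y: "nspace Y" and p: "1 \<le> p" and y: "\<And>i. i < k \<Longrightarrow> y i \<in> carrier Y"
  shows "delta_norm p Y (\<Oplus>\<^bsub>tensor_space (lp p) Y\<^esub>i\<in>{..<k}. tensor (lp p) Y (unit_seq i) (y i)) =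
     (\<Sum>i<k. nrm Y (y i) powr p) powr (1 / p)"
proof -
  interpret Y: nspace Y by (rule Y)
  interpret L: vspace "lp_space p Y" using Y.lp_space_vspace p by simp
  let ?J = "tensor_lift (lp p) Y (lp_space p Y) (\<lambda>s y i. s i \<odot>\<^bsub>Y\<^esub> y)"
  let ?g = "\<lambda>i. tensor (lp p) Y (unit_seq i) (y i)"
  have "?J (\<Oplus>\<^bsub>tensor_space (lp p) Y\<^esub>i\<in>{..<k}. ?g i) = (\<Oplus>\<^bsub>lp_space p Y\<^esub>i\<in>{..<k}. ?J (?g i))"
    by (rule vspace.linear_map_finsum[OF tensor_space_vspace lp_embedding_spec(1)[OF Y p] L.vspace_axioms])
      (intro tensor_mem unit_seq_lp p y)
  also have "\<dots> = (\<Oplus>\<^bsub>lp_space p Y\<^esub>i\<in>{..<k}. (\<lambda>j. unit_seq i j \<odot>\<^bsub>Y\<^esub> y i))"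
  proof (rule L.M.M.finsum_cong')
    have mem: "(\<lambda>j. unit_seq i j \<odot>\<^bsub>Y\<^esub> y i) = ?J (?g i)" if "i < k" for i
      using lp_embedding_spec(2)[OF Y p unit_seq_lp[OF p] y[OF that]] by simp
    show "?J (?g i) = (\<lambda>j. unit_seq i j \<odot>\<^bsub>Y\<^esub> y i)" if "i \<in> {..<k}" for i using mem that by simp
    have "?J (?g i) \<in> carrier (lp_space p Y)" if "i < k" for i
      using lp_embedding_spec(1)[OF Y p] tensor_mem[OF unit_seq_lp[OF p] y[OF that]]
      by (auto simp: linear_map_def)
    then show "(\<lambda>i j. unit_seq i j \<odot>\<^bsub>Y\<^esub> y i) \<in> {..<k} \<rightarrow> carrier (lp_space p Y)" using mem by auto
  qed simp
  also have "\<dots> = (\<lambda>j. if j < k then y j else \<zero>\<^bsub>Y\<^esub>)" by (rule lp_space_finsum[OF Y p y])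
  finally show ?thesis
    unfolding delta_norm_def using Y.lp_space_finite(2)[where k = k and x = y and p = p] y p by simp
qed

context normed_spaces begin

section \<open>The two sides of the inequalities\<close>

lemma zero_form: "(\<lambda>_. 0) \<in> form_ball n X"
  by (simp add: form_ball_iff multilinear_map_def prod_nonneg)

text \<open>
  Suprema of real numbers are meaningful only for bounded sets. The bound holds because a form in
  the unit ball is at most the product of the norms.
\<close>

lemma form_ball_bounded:
  assumes p: "1 \<le> p" and uv: "\<And>i. i < k \<Longrightarrow> u i \<in> tuples n X" "\<And>i. i < k \<Longrightarrow> v i \<in> tuples n X"
  shows "bdd_above ((\<lambda>g. (\<Sum>i<k. norm (g (u i) - g (v i)) powr p) powr (1 / p)) ` form_ball n X)"
proof (rule bdd_aboveI2)
  fix g assume g: "g \<in> form_ball n X"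
  have "norm (g (u i) - g (v i)) \<le> (\<Prod>j<n. nrm (X j) (u i j)) + (\<Prod>j<n. nrm (X j) (v i j))" if "i < k" for i
    using g uv[OF that] by (intro order_trans[OF norm_triangle_ineq4] add_mono) (auto simp: form_ball_iff)
  then show "(\<Sum>i<k. norm (g (u i) - g (v i)) powr p) powr (1 / p) \<le>
     (\<Sum>i<k. ((\<Prod>j<n. nrm (X j) (u i j)) + (\<Prod>j<n. nrm (X j) (v i j))) powr p) powr (1 / p)"
    using p by (intro powr_mono2 sum_mono sum_nonneg) auto
qed

context
  fixes p :: real and k :: nat and u v and a b
  assumes K: "is_banach_space (scalars :: ('k, 'k) normed_module)" and p: "1 \<le> p"
    and u: "\<And>i. i < k \<Longrightarrow> u i \<in> tuples n X" "\<And>i. i < k \<Longrightarrow> a i = proj_elem_tensor n X (u i)"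
    and v: "\<And>i. i < k \<Longrightarrow> v i \<in> tuples n X" "\<And>i. i < k \<Longrightarrow> b i = proj_elem_tensor n X (v i)"
begin

abbreviation "L \<equiv> lp p :: ('k, nat \<Rightarrow> 'k) normed_module"

abbreviation "z \<equiv> (\<Oplus>\<^bsub>tensor_space L P\<^esub>i\<in>{..<k}. tensor L P (unit_seq i) (a i \<ominus>\<^bsub>P\<^esub> b i))"

lemma diff_mem: "i < k \<Longrightarrow> a i \<in> carrier P" "i < k \<Longrightarrow> b i \<in> carrier P" "i < k \<Longrightarrow> a i \<ominus>\<^bsub>P\<^esub> b i \<in> carrier P"
proof -
  interpret P: nspace P by (rule nspace_P)
  show 1: "a i \<in> carrier P" if "i < k" for i
    using multilinear_mapD(1)[OF proj_elem_tensor_multilinear] u that by simp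
  show 2: "b i \<in> carrier P" if "i < k" for i
    using multilinear_mapD(1)[OF proj_elem_tensor_multilinear] v that by simp
  show "i < k \<Longrightarrow> a i \<ominus>\<^bsub>P\<^esub> b i \<in> carrier P" using 1 2 by simp
qed

lemma delta_side:
  assumes Y: "is_banach_space Y" and T: "bounded_multilinear_map n X Y T"
  shows "delta_norm p Y (tensor_map L P L Y (\<lambda>s. s) (linearization n X Y T) z) =
     (\<Sum>i<k. nrm Y (T (u i) \<ominus>\<^bsub>Y\<^esub> T (v i)) powr p) powr (1 / p)"
proof -
  have nY: "nspace Y" using Y by (simp add: nspace_def is_banach_space_def)
  interpret Y: nspace Y by (rule nY)
  interpret P: nspace P by (rule nspace_P)
  interpret LY: vspace "tensor_space L Y" by (rule tensor_space_vspace)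
  let ?S = "linearization n X Y T"
  have S: "linear_map P Y ?S" using linearization_spec(1)[OF Y T] by (simp add: bounded_linear_map_def)
  have id: "linear_map L L (\<lambda>s. s)" by (simp add: linear_map_def)
  have Tm: "T (u i) \<in> carrier Y" "T (v i) \<in> carrier Y" if "i < k" for i
    using T u(1)[OF that] v(1)[OF that] multilinear_mapD(1) by (auto simp: bounded_multilinear_map_def)
  have Sd: "?S (a i \<ominus>\<^bsub>P\<^esub> b i) = T (u i) \<ominus>\<^bsub>Y\<^esub> T (v i)" if "i < k" for i
    using P.linear_map_minus[OF S Y.vspace_axioms diff_mem(1,2)[OF that]] that u v
      linearization_spec(2)[OF Y T] by simp
  let ?M = "tensor_map L P L Y (\<lambda>s. s) ?S"
  have "?M z = (\<Oplus>\<^bsub>tensor_space L Y\<^esub>i\<in>{..<k}. ?M (tensor L P (unit_seq i) (a i \<ominus>\<^bsub>P\<^esub> b i)))"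
    by (rule vspace.linear_map_finsum[OF tensor_space_vspace tensor_map_spec(1)[OF id S] tensor_space_vspace])
      (intro tensor_mem unit_seq_lp p diff_mem)
  also have "\<dots> = (\<Oplus>\<^bsub>tensor_space L Y\<^esub>i\<in>{..<k}. tensor L Y (unit_seq i) (T (u i) \<ominus>\<^bsub>Y\<^esub> T (v i)))"
  proof (rule LY.M.M.finsum_cong')
    show "?M (tensor L P (unit_seq i) (a i \<ominus>\<^bsub>P\<^esub> b i)) = tensor L Y (unit_seq i) (T (u i) \<ominus>\<^bsub>Y\<^esub> T (v i))"
      if "i \<in> {..<k}" for i
      using tensor_map_spec(2)[OF id S unit_seq_lp[OF p] diff_mem(3)] that Sd by simp
    show "(\<lambda>i. tensor L Y (unit_seq i) (T (u i) \<ominus>\<^bsub>Y\<^esub> T (v i))) \<in> {..<k} \<rightarrow> carrier (tensor_space L Y)"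
      using Tm by (auto intro!: tensor_mem unit_seq_lp p Y.M.M.minus_closed)
  qed simp
  finally show ?thesis using delta_norm_sum[OF nY p, where k = k and y = "\<lambda>i. T (u i) \<ominus>\<^bsub>Y\<^esub> T (v i)"] Tm by simp
qed

text \<open>
  Each number in the supremum that defines \<open>injective_norm\<close> is at most the number \<open>N g\<close> for the
  form \<open>g\<close> that belongs to \<open>\<phi>\<close>. Conversely, \<open>N g\<close> is attained by the linearization of \<open>g\<close> and
  a norming functional.
\<close>

lemma injective_side:
  "injective_norm L P z = (SUP g\<in>form_ball n X. (\<Sum>i<k. norm (g (u i) - g (v i)) powr p) powr (1 / p))"
proof -
  interpret P: nspace P by (rule nspace_P)
  define N where "N g = (\<Sum>i<k. norm (g (u i) - g (v i)) powr p) powr (1 / p)" for g :: "(nat \<Rightarrow> 'x) \<Rightarrow> 'k"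
  let ?A = "{norm (z (\<lambda>(x, y). \<psi> x * \<phi> y)) | \<psi> \<phi>. \<psi> \<in> dual_ball L \<and> \<phi> \<in> dual_ball P}"
  have bdd: "bdd_above (N ` form_ball n X)"
    using form_ball_bounded[OF p u(1) v(1)] by (simp add: N_def[abs_def])
  have val: "z (\<lambda>(x, y). \<psi> x * \<phi> y) = (\<Sum>i<k. \<psi> (unit_seq i) * \<phi> (a i \<ominus>\<^bsub>P\<^esub> b i))"
    if "\<psi> \<in> dual_ball L" "\<phi> \<in> dual_ball P" for \<psi> \<phi>
  proof -
    have B: "(\<lambda>(x, y). \<psi> x * \<phi> y) \<in> bilinear_forms L P"
      using that by (intro product_bilinear_form) (simp_all add: dual_ball_def bounded_linear_map_def)
    have "z (\<lambda>(x, y). \<psi> x * \<phi> y) = (\<Sum>i<k. tensor L P (unit_seq i) (a i \<ominus>\<^bsub>P\<^esub> b i) (\<lambda>(x, y). \<psi> x * \<phi> y))"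
      unfolding tensor_space_def
      by (rule evaluation_span_finsum) (fold tensor_space_def, intro tensor_mem unit_seq_lp p diff_mem)
    then show ?thesis using B by (simp add: tensor_apply)
  qed
  have diff: "\<phi> (a i \<ominus>\<^bsub>P\<^esub> b i) = g (u i) - g (v i)"
    if "\<phi> \<in> dual_ball P" "\<And>x. x \<in> tuples n X \<Longrightarrow> \<phi> (proj_elem_tensor n X x) = g x" "i < k" for \<phi> g i
    using P.linear_map_minus[OF _ vspace_scalars diff_mem(1,2)[OF that(3)], of \<phi>] that u v
    by (simp add: dual_ball_P_iff)
  have le: "norm (z (\<lambda>(x, y). \<psi> x * \<phi> y)) \<le> N g"
    if "\<psi> \<in> dual_ball L" "\<phi> \<in> dual_ball P" "\<And>x. x \<in> tuples n X \<Longrightarrow> \<phi> (proj_elem_tensor n X x) = g x" for \<psi> \<phi> g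
    using lp_dual_le[OF p that(1), where k = k and x = "\<lambda>i. \<phi> (a i \<ominus>\<^bsub>P\<^esub> b i)"] val[OF that(1,2)] diff[OF that(2,3)]
    by (simp add: N_def)
  have le': "y \<le> (SUP g\<in>form_ball n X. N g)" if y: "y \<in> ?A" for y
  proof -
    obtain \<psi> \<phi> where *: "y = norm (z (\<lambda>(x, y). \<psi> x * \<phi> y))" "\<psi> \<in> dual_ball L" "\<phi> \<in> dual_ball P"
      using y by blast
    have "y \<le> N (\<lambda>x. \<phi> (proj_elem_tensor n X x))" using le[OF *(2,3)] *(1) by simp
    also have "\<dots> \<le> (SUP g\<in>form_ball n X. N g)" by (rule cSUP_upper[OF form_of_dual[OF *(3)] bdd])
    finally show ?thesis .
  qed
  have attain: "N g \<in> ?A" if g: "g \<in> form_ball n X" for g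
  proof -
    obtain \<phi> where \<phi>: "\<phi> \<in> dual_ball P" "\<forall>x\<in>tuples n X. \<phi> (proj_elem_tensor n X x) = g x"
      using dual_of_form[OF K g] by blast
    obtain \<psi> where \<psi>: "\<psi> \<in> dual_ball L" "norm (\<Sum>i<k. \<psi> (unit_seq i) * (g (u i) - g (v i))) = N g"
      using lp_dual_norming[OF p, where k = k and x = "\<lambda>i. g (u i) - g (v i)"] by (auto simp: N_def)
    have "(\<Sum>i<k. \<psi> (unit_seq i) * \<phi> (a i \<ominus>\<^bsub>P\<^esub> b i)) = (\<Sum>i<k. \<psi> (unit_seq i) * (g (u i) - g (v i)))"
      using diff[OF \<phi>(1), of g] \<phi>(2) by (intro sum.cong) auto
    then have "N g = norm (z (\<lambda>(x, y). \<psi> x * \<phi> y))" using val[OF \<psi>(1) \<phi>(1)] \<psi>(2) by simp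
    then show ?thesis using \<psi>(1) \<phi>(1) by blast
  qed
  have "Sup ?A = (SUP g\<in>form_ball n X. N g)"
  proof (rule antisym)
    show "Sup ?A \<le> (SUP g\<in>form_ball n X. N g)"
      using attain[OF zero_form] le' by (intro cSup_least) blast+
    have "bdd_above ?A" using le' by (rule bdd_aboveI)
    then show "(SUP g\<in>form_ball n X. N g) \<le> Sup ?A"
      using zero_form attain by (intro cSUP_least cSup_upper) blast+
  qed
  then show ?thesis by (simp add: injective_norm_def N_def)
qed

end

text \<open>
  Points of the Segre set are elementary tensors of tuples, so the two families of inequalities are
  indexed by the same data.
\<close>

lemma summing_const_iff:
  assumes K: "is_banach_space (scalars :: ('k, 'k) normed_module)" and p: "1 \<le> p"
    and Y: "is_banach_space Y" and T: "bounded_multilinear_map n X Y T"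
  shows "tensor_summing_const p n X Y T c \<longleftrightarrow> lipschitz_summing_const p n X Y T c"
proof
  assume t: "tensor_summing_const p n X Y T c"
  show "lipschitz_summing_const p n X Y T c"
    unfolding lipschitz_summing_const_def
  proof (intro allI impI)
    fix k :: nat and u v assume "\<forall>i<k. u i \<in> tuples n X \<and> v i \<in> tuples n X"
    then have uv: "\<And>i. i < k \<Longrightarrow> u i \<in> tuples n X" "\<And>i. i < k \<Longrightarrow> v i \<in> tuples n X" by auto
    define a where "a i = proj_elem_tensor n X (u i)" for i
    define b where "b i = proj_elem_tensor n X (v i)" for i
    have "\<forall>i<k. a i \<in> segre n X \<and> b i \<in> segre n X" using uv by (auto simp: segre_def a_def b_def)
    note t[unfolded tensor_summing_const_def Let_def, rule_format, OF this[rule_format]]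
    then show "(\<Sum>i<k. nrm Y (T (u i) \<ominus>\<^bsub>Y\<^esub> T (v i)) powr p) powr (1 / p)
        \<le> c * (SUP \<phi>\<in>form_ball n X. (\<Sum>i<k. norm (\<phi> (u i) - \<phi> (v i)) powr p) powr (1 / p))"
      using delta_side[OF K p uv(1) a_def uv(2) b_def Y T] injective_side[OF K p uv(1) a_def uv(2) b_def] by simp
  qed
next
  assume l: "lipschitz_summing_const p n X Y T c"
  show "tensor_summing_const p n X Y T c"
    unfolding tensor_summing_const_def Let_def
  proof (intro allI impI)
    fix k :: nat and a b assume ab: "\<forall>i<k. a i \<in> segre n X \<and> b i \<in> segre n X"
    have "\<forall>i. \<exists>x. i < k \<longrightarrow> x \<in> tuples n X \<and> a i = proj_elem_tensor n X x" using ab by (auto simp: segre_def)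
    then obtain u where u: "\<And>i. i < k \<Longrightarrow> u i \<in> tuples n X" "\<And>i. i < k \<Longrightarrow> a i = proj_elem_tensor n X (u i)" by metis
    have "\<forall>i. \<exists>x. i < k \<longrightarrow> x \<in> tuples n X \<and> b i = proj_elem_tensor n X x" using ab by (auto simp: segre_def)
    then obtain v where v: "\<And>i. i < k \<Longrightarrow> v i \<in> tuples n X" "\<And>i. i < k \<Longrightarrow> b i = proj_elem_tensor n X (v i)" by metis
    have "\<forall>i<k. u i \<in> tuples n X \<and> v i \<in> tuples n X" using u(1) v(1) by blast
    note l[unfolded lipschitz_summing_const_def, rule_format, OF this[rule_format]]
    then show "delta_norm p Y (tensor_map (lp p) P (lp p) Y (\<lambda>s. s) (linearization n X Y T)
         (\<Oplus>\<^bsub>tensor_space (lp p) P\<^esub>i\<in>{..<k}. tensor (lp p) P (unit_seq i) (a i \<ominus>\<^bsub>P\<^esub> b i)))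
      \<le> c * injective_norm (lp p) P (\<Oplus>\<^bsub>tensor_space (lp p) P\<^esub>i\<in>{..<k}. tensor (lp p) P (unit_seq i) (a i \<ominus>\<^bsub>P\<^esub> b i))"
      using delta_side[OF K p u v Y T] injective_side[OF K p u v] by simp
  qed
qed

end

theorem theorem6p2:
  fixes X :: "nat \<Rightarrow> ('k::{real_normed_field, banach}, 'x) normed_module"
    and Y :: "('k, 'y) normed_module"
    and T :: "(nat \<Rightarrow> 'x) \<Rightarrow> 'y"
    and n :: nat and p :: real
  assumes "1 \<le> n" and "1 \<le> p"
    and "\<And>i. i < n \<Longrightarrow> is_banach_space (X i)"
    and "is_banach_space Y"
    and "bounded_multilinear_map n X Y T"
  shows "(lipschitz_summing p n X Y T \<longleftrightarrow> (\<exists>C>0. tensor_summing_const p n X Y T C)) \<and>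
    (lipschitz_summing p n X Y T \<longrightarrow>
       lipschitz_summing_norm p n X Y T = Inf {C. 0 < C \<and> tensor_summing_const p n X Y T C})"
proof -
  interpret normed_spaces n X
    using assms(1,3) by unfold_locales (simp_all add: is_banach_space_def)
  have "tensor_summing_const p n X Y T c \<longleftrightarrow> lipschitz_summing_const p n X Y T c" for c
    by (rule summing_const_iff[OF banach_scalars assms(2,4,5)])
  then show ?thesis by (simp add: lipschitz_summing_def lipschitz_summing_norm_def)
qed

end
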